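(* Let $a$ be an integer and $d\ge1$ an integer. Then $$\delta(a,d)=\frac{\varphi((a,d))}{(a,d)}\sum_{\substack{r=1\\ (1+ra,d)=1}}^{\infty}\ \sum_{\substack{m=1\\ (m,d)=1}}^{\infty}\frac{\mu(m)}{m\,r\,\varphi(mrd)}.$$
   Context: Throughout, $p$ denotes a prime, $\mu$ the Möbius function, $\varphi$ Euler's totient, $(a,b)$ the gcd, $\pi(x)$ the number of primes $\le x$. For a prime $p$ and integers $a$, $d\ge1$, let $\delta(p;a,d)=\frac{1}{p-1}\#\{x\in\mathbb F_p^*:\ \mathrm{ord}(x)\equiv a \pmod d\}$, where $\mathrm{ord}(x)$ is the multiplicative order of $x$. Set $N(a,d)(x)=\sum_{p\le x}\delta(p;a,d)$ and $\delta(a,d)=\lim_{x\to\infty}N(a,d)(x)/\pi(x)$ (this limit exists). *)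

theory Defs
  imports "HOL-Analysis.Analysis" "HOL-Number_Theory.Number_Theory"
          "HOL-Computational_Algebra.Squarefree"
begin

text \<open>Moebius function on positive integers (value at 0 is irrelevant).\<close>
definition mu :: "nat \<Rightarrow> int" where
  "mu m = (if squarefree m then (-1) ^ card (prime_factors m) else 0)"

text \<open>delta(p;a,d): proportion of x in F_p^* whose multiplicative order is
  congruent to a modulo d.  F_p^* is represented by {1..p-1}; ord is the
  multiplicative order modulo p (Pocklington.ord).\<close>
definition delta_p :: "nat \<Rightarrow> int \<Rightarrow> nat \<Rightarrow> real" where
  "delta_p p a d =
     real (card {x \<in> {1..p - 1}. [int (ord p x) = a] (mod int d)}) / real (p - 1)"

definition N_ad :: "int \<Rightarrow> nat \<Rightarrow> real \<Rightarrow> real" where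
  "N_ad a d x = (\<Sum>p\<in>{p. prime p \<and> real p \<le> x}. delta_p p a d)"

definition prime_pi :: "real \<Rightarrow> real" where
  "prime_pi x = real (card {p::nat. prime p \<and> real p \<le> x})"

end

theory Submission
  imports Defs "HOL-Complex_Analysis.Complex_Analysis" "HOL-Real_Asymp.Real_Asymp"
begin

text \<open>
  Write \<open>t = (p - 1) / ord x\<close> for the index and expand \<open>\<phi>(n)/n = \<Sum>\<mu>(m)/m\<close> over the divisors
  \<open>m\<close> of \<open>n\<close>. This turns \<open>\<delta>(p; a, d)\<close> into the sum of \<open>\<mu>(m) / (m t)\<close> over all pairs with
  \<open>t m\<close> dividing \<open>p - 1\<close> and \<open>(p - 1) / t \<equiv> a\<close> modulo \<open>d\<close>. For fixed \<open>(t, m)\<close> this is a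
  residue class condition on \<open>p\<close>, so the prime number theorem for arithmetic progressions gives
  its density. The limit may be exchanged with the sum over the pairs because the number of
  primes \<open>p \<le> x\<close> congruent to 1 modulo \<open>k\<close> has an elementary upper bound that makes the sum
  converge dominatedly. In the resulting series, splitting \<open>m\<close> into a divisor of \<open>(a, d)\<close> and
  a part coprime to \<open>d\<close> produces the factor \<open>\<phi>((a, d)) / (a, d)\<close>.

  The prime number theorem for arithmetic progressions is obtained by Newman's contour method. The
  logarithmic derivatives of the L-functions have no poles on \<open>Re s = 1\<close> other than \<open>s = 1\<close>, by
  the inequality \<open>3 + 4 cos \<theta> + cos 2\<theta> \<ge> 0\<close> and, for real characters at \<open>s = 1\<close>, by Monsky's
  argument with Lambert series.
\<close>

section \<open>Newman's Tauberian theorem\<close>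

text \<open>The exchange of limit and sum dictates the prime estimates. The trivial count N / k of
  primes congruent to 1 modulo k loses a factor ln N against pi(N), so it gives no majorant
  independent of N. But the terms already carry 1 / (m t), hence any uniform saving k^(-c) with c >
  0 is enough, and c = 1/2 comes cheaply from a divisibility argument on products over progressions.
  Newman's method asks of the L-functions only holomorphy and nonvanishing near Re s \<ge> 1, with
  no growth bound along the line; the price is a linear bound for the summatory function, which
  Chebyshev's argument supplies. Everything is phrased through integrals over unit slices because
  these are entire in s, so that partial sums make sense on both sides of the line. For a
  nonprincipal character the trigonometric inequality falls short only when its square is principal
  and the point is 1: the pole of the square then leaves 4 m \<le> 4 for the order m of a zero, and
  a simple zero is not excluded. Characters are built without the structure theory of the unit
  group, as joint eigenvectors of its translations.\<close>

lemma newman_kernel_on_circle: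
  fixes w :: complex
  assumes "norm w = R" "R > 0"
  shows "(1 + w\<^sup>2 / of_real (R\<^sup>2)) / w = of_real (2 * Re w / R\<^sup>2)"
proof -
  have w: "w \<noteq> 0" using assms by auto
  \<comment> \<open>On the circle R^2 + w^2 = w (w + cnj w), so the kernel is real there and
    proportional to Re w. This is what later cancels the factor 1 / |Re w| in the bounds for the
    series.\<close>
  have "w * cnj w = of_real (R\<^sup>2)"
    using assms by (simp add: complex_norm_square [symmetric])
  moreover have "w + cnj w = of_real (2 * Re w)"
    by (simp add: complex_add_cnj)
  ultimately have "of_real (R\<^sup>2) + w\<^sup>2 = w * of_real (2 * Re w)"
    by (metis add.commute distrib_left power2_eq_square)
  then show ?thesis
    using w assms by (simp add: field_simps)
qed

text \<open>Cauchy's formula at the centre, cut where Re w = 0. The difference quotient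
  \<open>q\<close> is entire and integrates to 0 over the closed circle; the remaining
  \<open>f 0 / w\<close> is integrated from the parametrisation.\<close>

lemma has_contour_integral_circle_two_arcs:
  fixes f :: "complex \<Rightarrow> complex"
  assumes "f holomorphic_on UNIV" "R > 0"
  defines "A1 \<equiv> part_circlepath 0 R (-pi/2) (pi/2)" and "A2 \<equiv> part_circlepath 0 R (pi/2) (3*pi/2)"
  shows "contour_integral A1 (\<lambda>w. f w / w) + contour_integral A2 (\<lambda>w. f w / w)
           = 2 * of_real pi * \<i> * f 0"
proof -
  let ?A = "part_circlepath 0 R (-pi/2) (3*pi/2)"
  define q where "q = (\<lambda>z. if z = 0 then deriv f 0 else (f z - f 0) / (z - 0))"
  have q: "q holomorphic_on UNIV"
    unfolding q_def by (rule pole_lemma) (use assms in auto)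
  have nz: "w \<noteq> 0" if "w \<in> path_image (part_circlepath 0 R s t)" for w s t
    using that path_image_part_circlepath_subset'[of R 0 s t] assms(2) by auto
  have "3 * pi / 2 = pi + pi / 2" by simp
  then have c: "cos (3 * pi / 2) = 0" "sin (3 * pi / 2) = -1"
    by (simp_all only: cos_add sin_add) auto
  have cl: "pathfinish ?A = pathstart ?A"
    using pathfinish_part_circlepath pathstart_part_circlepath
    by (simp add: complex_eq_iff Re_exp Im_exp c)
  have "(q has_contour_integral 0) ?A"
    using Cauchy_theorem_convex_simple[OF q convex_UNIV] cl by auto
  moreover have "((\<lambda>w. f 0 / w) has_contour_integral (2 * of_real pi * \<i> * f 0)) ?A"
  proof -
    have "((\<lambda>t. f 0 * \<i>) has_integral (3*pi/2 - (-pi/2)) *\<^sub>R (f 0 * \<i>)) {-pi/2..3*pi/2}"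
      using has_integral_const_real[of "f 0 * \<i>" "-pi/2" "3*pi/2"] by simp
    moreover have "(3*pi/2 - (-pi/2)) *\<^sub>R (f 0 * \<i>) = 2 * of_real pi * \<i> * f 0"
      by (simp add: scaleR_conv_of_real)
    moreover have "-pi/2 < 3*pi/2" using pi_gt_zero by linarith
    ultimately show ?thesis
      using assms(2) by (simp add: has_contour_integral_part_circlepath_iff)
  qed
  ultimately have "((\<lambda>w. q w + f 0 / w) has_contour_integral (0 + 2 * of_real pi * \<i> * f 0)) ?A"
    by (rule has_contour_integral_add)
  then have "((\<lambda>w. f w / w) has_contour_integral (2 * of_real pi * \<i> * f 0)) ?A"
    unfolding add_0
    by (rule has_contour_integral_eq) (use nz in \<open>auto simp: q_def field_simps\<close>)
  \<comment> \<open>In parametrised form the interval can be split at pi/2, which yields the two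
    arcs.\<close>
  then have *: "((\<lambda>t. f (R * cis t) / (R * cis t) * R * \<i> * cis t) has_integral (2 * of_real pi * \<i> * f 0)) {-pi/2..3*pi/2}"
    by (subst (asm) has_contour_integral_part_circlepath_iff) (use pi_gt_zero in auto)
  have ci: "(\<lambda>w. f w / w) contour_integrable_on part_circlepath 0 R s t" for s t
    by (intro contour_integrable_continuous_part_circlepath continuous_intros)
       (use assms nz in \<open>auto intro: holomorphic_on_imp_continuous_on holomorphic_on_subset\<close>)
  have 1: "((\<lambda>t. f (R * cis t) / (R * cis t) * R * \<i> * cis t) has_integral contour_integral A1 (\<lambda>w. f w / w)) {-pi/2..pi/2}"
    using has_contour_integral_integral[OF ci[of "-pi/2" "pi/2"]] unfolding A1_def
    by (subst (asm) has_contour_integral_part_circlepath_iff) (use pi_gt_zero in auto)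
  have 2: "((\<lambda>t. f (R * cis t) / (R * cis t) * R * \<i> * cis t) has_integral contour_integral A2 (\<lambda>w. f w / w)) {pi/2..3*pi/2}"
    using has_contour_integral_integral[OF ci[of "pi/2" "3*pi/2"]] unfolding A2_def
    by (subst (asm) has_contour_integral_part_circlepath_iff) (use pi_gt_zero in auto)
  have "-pi/2 \<le> pi/2" "pi/2 \<le> 3*pi/2" using pi_gt_zero by linarith+
  from has_integral_combine[OF this 1 2] * show ?thesis
    by (rule has_integral_unique)
qed

text \<open>Since \<open>g w - g 0\<close> vanishes at 0, the integrand is holomorphic across 0 and
  the arc may be replaced by the segment on the imaginary axis. There exp (w L) has modulus 1, and
  one integration by parts gains 1 / L; its boundary terms vanish because 1 + w^2 / R^2 is 0 at both
  ends. The bound \<open>B\<close> depends on \<open>R\<close> but not on \<open>L\<close>.\<close>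

lemma newman_right_arc:
  fixes g :: "complex \<Rightarrow> complex"
  assumes U: "open U" "{z. Re z \<ge> 0} \<subseteq> U" and g: "g holomorphic_on U" and R: "R > 0"
  obtains B where "\<And>L. L > 0 \<Longrightarrow>
     norm (contour_integral (part_circlepath 0 R (-pi/2) (pi/2))
        (\<lambda>w. (g w - g 0) * exp (w * of_real L) * ((1 + w\<^sup>2 / of_real (R\<^sup>2)) / w))) \<le> B / L"
proof -
  let ?A = "part_circlepath 0 R (-pi/2) (pi/2)"
  let ?l = "linepath (-(\<i> * of_real R)) (\<i> * of_real R)"
  define q where "q = (\<lambda>z. if z = 0 then deriv g 0 else (g z - g 0) / (z - 0))"
  have q: "q holomorphic_on U"
    unfolding q_def by (rule pole_lemma) (use g U in \<open>auto simp: interior_open\<close>)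
  define Q where "Q = (\<lambda>z. q z * (1 + z\<^sup>2 / of_real (R\<^sup>2)))"
  have Q: "Q holomorphic_on U"
    unfolding Q_def by (intro holomorphic_intros q) (use R in auto)
  have Q': "deriv Q holomorphic_on U" using Q U by (simp add: holomorphic_deriv)
  have seg: "closed_segment (-(\<i> * of_real R)) (\<i> * of_real R) \<subseteq> {z. Re z = 0}"
    by (auto simp: closed_segment_def)
  have "compact (deriv Q ` closed_segment (-(\<i> * of_real R)) (\<i> * of_real R))"
    by (intro compact_continuous_image holomorphic_on_imp_continuous_on holomorphic_on_subset[OF Q'])
       (use seg U in force)+
  then obtain B where B: "\<And>z. z \<in> closed_segment (-(\<i> * of_real R)) (\<i> * of_real R) \<Longrightarrow> norm (deriv Q z) \<le> B"
    by (fastforce dest!: compact_imp_bounded simp: bounded_iff)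
  have B0: "B \<ge> 0" using B[of "\<i> * of_real R"] norm_ge_zero order_trans by blast
  have "norm (contour_integral ?A (\<lambda>w. (g w - g 0) * exp (w * of_real L) * ((1 + w\<^sup>2 / of_real (R\<^sup>2)) / w))) \<le> (B * (2 * R)) / L"
    if L: "L > 0" for L
  proof -
    define E where "E = (\<lambda>w::complex. exp (w * of_real L))"
    have E: "E holomorphic_on X" for X unfolding E_def by (intro holomorphic_intros)
    have ps: "pathstart ?A = -(\<i> * of_real R)" "pathfinish ?A = \<i> * of_real R"
      by (simp_all add: complex_eq_iff Re_exp Im_exp)
    have pim: "path_image ?A \<subseteq> {z. Re z \<ge> 0}" 
      using R pi_gt_zero by (auto simp: path_image_part_circlepath Re_exp intro!: mult_nonneg_nonneg cos_ge_zero)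
    have nz: "w \<noteq> 0" if "w \<in> path_image ?A" for w
      using that path_image_part_circlepath_subset'[of R 0 "-pi/2" "pi/2"] R by auto
    have QE: "(\<lambda>w. Q w * E w) holomorphic_on {z. Re z \<ge> 0}"
      by (intro holomorphic_intros E holomorphic_on_subset[OF Q]) (use U in auto)
    have conv: "convex {z. Re z \<ge> 0}" by (simp add: convex_halfspace_Re_ge)
    have ciA: "(\<lambda>w. Q w * E w) contour_integrable_on ?A"
      by (intro contour_integrable_continuous_part_circlepath holomorphic_on_imp_continuous_on
            holomorphic_on_subset[OF QE] pim)
    have seg2: "path_image ?l \<subseteq> {z. Re z \<ge> 0}" using seg by auto
    then have seg3: "closed_segment (\<i> * of_real R) (-(\<i> * of_real R)) \<subseteq> {z. Re z \<ge> 0}"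
      by (simp add: closed_segment_commute)
    have cil: "(\<lambda>w. Q w * E w) contour_integrable_on ?l"
      by (intro contour_integrable_continuous_linepath holomorphic_on_imp_continuous_on
            holomorphic_on_subset[OF QE]) (use seg in auto)
    have "((\<lambda>w. Q w * E w) has_contour_integral 0) (?A +++ reversepath ?l)"
      by (rule Cauchy_theorem_convex_simple[OF QE conv])
         (use pim seg3 ps in \<open>auto intro!: valid_path_join simp: path_image_join\<close>)
    then have "contour_integral (?A +++ reversepath ?l) (\<lambda>w. Q w * E w) = 0"
      by (rule contour_integral_unique)
    moreover have "contour_integral (?A +++ reversepath ?l) (\<lambda>w. Q w * E w) =
        contour_integral ?A (\<lambda>w. Q w * E w) + contour_integral (reversepath ?l) (\<lambda>w. Q w * E w)"
      by (intro contour_integral_join ciA contour_integrable_reversepath cil) auto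
    moreover have "contour_integral (reversepath ?l) (\<lambda>w. Q w * E w) = - contour_integral ?l (\<lambda>w. Q w * E w)"
      by (rule contour_integral_reversepath) auto
    ultimately have eq1: "contour_integral ?A (\<lambda>w. Q w * E w) = contour_integral ?l (\<lambda>w. Q w * E w)"
      by simp
    \<comment> \<open>The integration by parts, written as a primitive: Q E / L has derivative Q' E
      / L + Q E.\<close>
    have dF: "((\<lambda>w. Q w * E w / L) has_field_derivative (deriv Q w * E w / L + Q w * E w)) (at w within {z. Re z \<ge> 0})"
      if "w \<in> {z. Re z \<ge> 0}" for w
    proof -
      have "(Q has_field_derivative deriv Q w) (at w)"
        using Q U that holomorphic_derivI by blast
      moreover have "(E has_field_derivative (E w * L)) (at w)"
        unfolding E_def by (auto intro!: derivative_eq_intros)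
      ultimately have "((\<lambda>w. Q w * E w / L) has_field_derivative ((deriv Q w * E w + E w * L * Q w) / L)) (at w)"
        by (intro DERIV_cdivide DERIV_mult)
      moreover have "(deriv Q w * E w + E w * L * Q w) / L = deriv Q w * E w / L + Q w * E w"
        using L by (simp add: field_simps)
      ultimately show ?thesis by (metis has_field_derivative_at_within)
    qed
    have "((\<lambda>w. deriv Q w * E w / L + Q w * E w) has_contour_integral
        (Q (pathfinish ?l) * E (pathfinish ?l) / L - Q (pathstart ?l) * E (pathstart ?l) / L)) ?l"
      by (rule contour_integral_primitive[OF dF]) (use seg2 in auto)
    moreover have "Q (\<i> * of_real R) = 0" "Q (- (\<i> * of_real R)) = 0"
      using R by (auto simp: Q_def power_mult_distrib)
    ultimately have z: "((\<lambda>w. deriv Q w * E w / L + Q w * E w) has_contour_integral 0) ?l"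
      by simp
    have "((\<lambda>w. (deriv Q w * E w / L + Q w * E w) - Q w * E w) has_contour_integral (0 - contour_integral ?l (\<lambda>w. Q w * E w))) ?l"
      by (intro has_contour_integral_diff z has_contour_integral_integral cil)
    then have z2: "((\<lambda>w. deriv Q w * E w / L) has_contour_integral (- contour_integral ?l (\<lambda>w. Q w * E w))) ?l"
      by simp
    have "norm (- contour_integral ?l (\<lambda>w. Q w * E w)) \<le> B / L * norm (\<i> * of_real R - (-(\<i> * of_real R)))"
    proof (rule has_contour_integral_bound_linepath[OF z2])
      show "0 \<le> B / L" using B0 L by simp
      fix w assume w: "w \<in> closed_segment (-(\<i> * of_real R)) (\<i> * of_real R)"
      then have "Re w = 0" using seg by auto
      then have "norm (E w) = 1" by (simp add: E_def norm_exp_eq_Re)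
      then show "norm (deriv Q w * E w / L) \<le> B / L"
        using B[OF w] L by (simp add: norm_mult norm_divide divide_right_mono)
    qed
    also have "norm (\<i> * of_real R - (-(\<i> * of_real R))) = 2 * R"
      using R by (simp add: norm_mult flip: mult_2)
    finally have *: "norm (contour_integral ?l (\<lambda>w. Q w * E w)) \<le> B * (2 * R) / L" by simp
    have "contour_integral ?A (\<lambda>w. (g w - g 0) * exp (w * of_real L) * ((1 + w\<^sup>2 / of_real (R\<^sup>2)) / w))
        = contour_integral ?A (\<lambda>w. Q w * E w)"
      by (rule contour_integral_eq) (use nz in \<open>auto simp: Q_def E_def q_def\<close>)
    then show ?thesis using * eq1 by simp
  qed
  then show ?thesis using that by blast
qed

text \<open>Here \<open>S\<close> is a partial sum, \<open>g\<close> the full sum and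
  \<open>L\<close> the logarithm of the cutoff. On the right arc \<open>S - g 0\<close> splits into
  \<open>S - g\<close>, controlled by the tail bound, and \<open>g - g 0\<close>, controlled by
  \<open>B\<close>. On the left arc \<open>g\<close> may not exist, but \<open>S\<close> is entire
  and is estimated directly. In both half planes the kernel 2 |Re w| / R^2 cancels the singular
  factor 1 / |Re w| and exp (w L) cancels the exponential, which leaves O(1 / R).\<close>

lemma newman_finite_bound:
  fixes S g :: "complex \<Rightarrow> complex"
  assumes U: "open U" "{z. Re z \<ge> 0} \<subseteq> U" and g: "g holomorphic_on U" and R: "R > 0"
    and S: "S holomorphic_on UNIV" and L: "L > 0" and C: "C \<ge> 0"
    and B: "norm (contour_integral (part_circlepath 0 R (-pi/2) (pi/2))
        (\<lambda>w. (g w - g 0) * exp (w * of_real L) * ((1 + w\<^sup>2 / of_real (R\<^sup>2)) / w))) \<le> B / L"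
    and neg: "\<And>z. Re z < 0 \<Longrightarrow> norm (S z) \<le> C * exp (- Re z * L) / \<bar>Re z\<bar>"
    and pos: "\<And>z. Re z > 0 \<Longrightarrow> norm (S z - g z) \<le> C * exp (- Re z * L) / Re z"
  shows "2 * pi * norm (S 0 - g 0) \<le> 4 * pi * C / R + (B + 2 * pi * norm (g 0) / R) / L"
proof -
  let ?A1 = "part_circlepath 0 R (-pi/2) (pi/2)" and ?A2 = "part_circlepath 0 R (pi/2) (3*pi/2)"
  define E where "E = (\<lambda>w::complex. exp (w * of_real L))"
  define P where "P = (\<lambda>w::complex. (1 + w\<^sup>2 / of_real (R\<^sup>2)))"
  define f where "f = (\<lambda>w. (S w - g 0) * E w * P w)"
  have f: "f holomorphic_on UNIV"
    unfolding f_def E_def P_def by (intro holomorphic_intros S) (use R in auto)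
  have on: "norm w = R" if "w \<in> path_image (part_circlepath 0 R s t)" for w s t
    using that path_image_part_circlepath_subset'[of R 0 s t] R by auto
  have nz: "w \<noteq> 0" if "w \<in> path_image (part_circlepath 0 R s t)" for w s t
    using on[OF that] R by auto
  have K: "norm (P w / w) = 2 * \<bar>Re w\<bar> / R\<^sup>2" if "norm w = R" for w
    using newman_kernel_on_circle[OF that R] unfolding P_def
    by (simp add: norm_of_real abs_mult del: of_real_divide of_real_mult of_real_power)
  \<comment> \<open>At the two points with Re w = 0 the bounds \<open>neg\<close> and
    \<open>pos\<close> say nothing; being finitely many, they may be left out of the arc-length
    estimate.\<close>
  have fin: "finite {\<i> * of_real R, -(\<i> * of_real R)}" by simp
  have ax: "w \<in> {\<i> * of_real R, -(\<i> * of_real R)}" if "norm w = R" "Re w = 0" for w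
  proof -
    have "(Im w)\<^sup>2 = R\<^sup>2" using that R by (auto simp: cmod_def)
    then have "Im w = R \<or> Im w = -R" by (simp add: power2_eq_iff)
    then show ?thesis using that by (auto simp: complex_eq_iff)
  qed
  have pim1: "path_image ?A1 \<subseteq> {z. Re z \<ge> 0}" 
    using R pi_gt_zero by (auto simp: path_image_part_circlepath Re_exp intro!: mult_nonneg_nonneg cos_ge_zero)
  have pim2: "path_image ?A2 \<subseteq> {z. Re z \<le> 0}" 
  proof
    fix z assume "z \<in> path_image ?A2"
    then obtain t where t: "z = R * cis t" "pi/2 \<le> t" "t \<le> 3*pi/2"
      using pi_gt_zero by (auto simp: path_image_part_circlepath cis_conv_exp)
    have "cos (t - pi) \<ge> 0" using t by (intro cos_ge_zero) auto
    then show "z \<in> {z. Re z \<le> 0}" using t R by (simp add: mult_nonneg_nonpos)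
  qed
  have contg: "continuous_on (path_image ?A1) g"
    using pim1 U by (intro holomorphic_on_imp_continuous_on holomorphic_on_subset[OF g]) auto
  have contS: "continuous_on X S" for X
    by (intro holomorphic_on_imp_continuous_on holomorphic_on_subset[OF S]) auto
  have i1: "(\<lambda>w. (S w - g w) * E w * (P w / w)) contour_integrable_on ?A1"
    and i2: "(\<lambda>w. (g w - g 0) * E w * (P w / w)) contour_integrable_on ?A1"
    and i3: "(\<lambda>w. f w / w) contour_integrable_on ?A2"
    unfolding f_def E_def P_def
    by (intro contour_integrable_continuous_part_circlepath continuous_intros contS contg; use R nz in auto)+
  have "contour_integral ?A1 (\<lambda>w. f w / w) = contour_integral ?A1 (\<lambda>w. (S w - g w) * E w * (P w / w) + (g w - g 0) * E w * (P w / w))"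
    by (intro arg_cong2[where f=contour_integral] refl) (auto simp: f_def field_simps add_divide_distrib diff_divide_distrib)
  also have "\<dots> = contour_integral ?A1 (\<lambda>w. (S w - g w) * E w * (P w / w)) + contour_integral ?A1 (\<lambda>w. (g w - g 0) * E w * (P w / w))"
    by (intro contour_integral_add i1 i2)
  finally have e1: "contour_integral ?A1 (\<lambda>w. f w / w) = \<dots>" .
  have nE: "norm (E w) = exp (Re w * L)" for w by (simp add: E_def norm_exp_eq_Re)
  have b1: "norm (contour_integral ?A1 (\<lambda>w. (S w - g w) * E w * (P w / w))) \<le> (2 * C / R\<^sup>2) * R * (pi/2 - (-pi/2))"
  proof (rule has_contour_integral_bound_part_circlepath_strong[OF has_contour_integral_integral[OF i1] fin])
    fix w assume w: "w \<in> path_image ?A1 - {\<i> * of_real R, -(\<i> * of_real R)}"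
    have R': "norm w = R" using on w by auto
    have x: "Re w > 0" using w pim1 ax[OF R'] by (force simp: less_le)
    have "norm ((S w - g w) * E w * (P w / w)) = norm (S w - g w) * exp (Re w * L) * (2 * \<bar>Re w\<bar> / R\<^sup>2)"
      by (simp only: norm_mult nE K[OF R'])
    also have "\<dots> \<le> (C * exp (- Re w * L) / Re w) * exp (Re w * L) * (2 * \<bar>Re w\<bar> / R\<^sup>2)"
      by (intro mult_right_mono pos x) auto
    also have "\<dots> = 2 * C / R\<^sup>2" using x by (simp add: exp_minus field_simps)
    finally show "norm ((S w - g w) * E w * (P w / w)) \<le> 2 * C / R\<^sup>2" .
  qed (use R C pi_gt_zero in auto)
  have b2: "norm (contour_integral ?A2 (\<lambda>w. f w / w)) \<le> (2 * C / R\<^sup>2 + 2 * norm (g 0) / (R\<^sup>2 * L)) * R * (3*pi/2 - pi/2)"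
  proof (rule has_contour_integral_bound_part_circlepath_strong[OF has_contour_integral_integral[OF i3] fin])
    fix w assume w: "w \<in> path_image ?A2 - {\<i> * of_real R, -(\<i> * of_real R)}"
    have R': "norm w = R" using on w by auto
    have x: "Re w < 0" using w pim2 ax[OF R'] by (force simp: less_le)
    define y where "y = - Re w"
    have y: "y > 0" "\<bar>Re w\<bar> = y" "Re w = -y" using x by (auto simp: y_def)
    have "f w / w = (S w - g 0) * E w * (P w / w)" by (simp add: f_def)
    then have "norm (f w / w) = norm (S w - g 0) * exp (- y * L) * (2 * y / R\<^sup>2)"
      by (simp only: norm_mult nE K[OF R'] y(2)) (simp add: y(3))
    also have "\<dots> \<le> (C * exp (y * L) / y + norm (g 0)) * exp (- y * L) * (2 * y / R\<^sup>2)"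
      using neg[OF x] y
      by (intro mult_right_mono order_trans[OF norm_triangle_ineq4]) auto
    also have "\<dots> = 2 * C / R\<^sup>2 + (2 * norm (g 0) / R\<^sup>2) * (y / exp (y * L))"
      using y R by (simp add: exp_minus field_simps)
    \<comment> \<open>From exp (y L) \<ge> y L: the constant \<open>g 0\<close> costs only O(1 / L),
      even near the imaginary axis.\<close>
    also have "y / exp (y * L) \<le> 1 / L"
      using exp_ge_add_one_self[of "y*L"] L by (simp add: field_simps del: exp_ge_add_one_self)
    then have "2 * C / R\<^sup>2 + (2 * norm (g 0) / R\<^sup>2) * (y / exp (y * L)) \<le> 2 * C / R\<^sup>2 + (2 * norm (g 0) / R\<^sup>2) * (1 / L)"
      by (intro add_left_mono mult_left_mono) auto
    finally show "norm (f w / w) \<le> 2 * C / R\<^sup>2 + 2 * norm (g 0) / (R\<^sup>2 * L)" by simp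
  qed (use R C L pi_gt_zero in auto)
  have "2 * pi * norm (S 0 - g 0) = norm (2 * of_real pi * \<i> * f 0)"
    by (simp add: f_def E_def P_def norm_mult)
  also have "\<dots> = norm (contour_integral ?A1 (\<lambda>w. f w / w) + contour_integral ?A2 (\<lambda>w. f w / w))"
    by (simp only: has_contour_integral_circle_two_arcs[OF f R])
  also have "\<dots> \<le> (2 * C / R\<^sup>2) * R * pi + B / L + (2 * C / R\<^sup>2 + 2 * norm (g 0) / (R\<^sup>2 * L)) * R * pi"
    unfolding e1
    by (intro order_trans[OF norm_triangle_ineq] add_mono)
       (use b1 b2 B in \<open>auto simp: E_def P_def\<close>)
  also have "\<dots> = 4 * pi * C / R + (B + 2 * pi * norm (g 0) / R) / L"
    using R L by (simp add: field_simps power2_eq_square)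
  finally show ?thesis .
qed

text \<open>The assumed bound is C times the integral of t^(-Re z - 1) over [n + 1, n + 2], for
  either sign of Re z. It telescopes: for Re z < 0 it bounds the partial sums, for Re z > 0 the
  tails, and these are the two inputs of the finite estimate.\<close>

theorem newman_tauberian:
  fixes u :: "nat \<Rightarrow> complex \<Rightarrow> complex"
  assumes u: "\<And>n. u n holomorphic_on UNIV"
    and bound: "\<And>n z. Re z \<noteq> 0 \<Longrightarrow>
      norm (u n z) \<le> C * (exp (- Re z * ln (real n + 1)) - exp (- Re z * ln (real n + 2))) / Re z"
    and sums: "\<And>z. Re z > 0 \<Longrightarrow> (\<lambda>n. u n z) sums g z"
    and U: "open U" "{z. Re z \<ge> 0} \<subseteq> U" and g: "g holomorphic_on U"
  shows "(\<lambda>n. u n 0) sums g 0"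
proof -
  define e where "e = (\<lambda>x n. exp (- x * ln (real n + 1)))"
  have C: "C \<ge> 0"
  proof -
    have "0 \<le> C * (1 - exp (- ln 2))"
      using order_trans[OF norm_ge_zero bound[of 1 0]] by (simp add: algebra_simps)
    moreover have "1 - exp (- ln 2) = (1/2::real)" by (simp add: exp_minus)
    ultimately show ?thesis by simp
  qed
  define S where "S = (\<lambda>N z. \<Sum>n<N. u n z)"
  have S: "S N holomorphic_on UNIV" for N unfolding S_def by (intro holomorphic_intros u)
  have bound': "norm (u n z) \<le> C / Re z * (e (Re z) n - e (Re z) (Suc n))" if "Re z \<noteq> 0" for n z
    using bound[OF that, of n] by (simp add: e_def add.commute)
  have tele: "(\<Sum>n<N. e x n - e x (Suc n)) = e x 0 - e x N" for x N
    by (rule sum_lessThan_telescope')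
  have neg: "norm (S N z) \<le> C * exp (- Re z * ln (real N + 1)) / \<bar>Re z\<bar>" if "Re z < 0" for N z
  proof -
    have "norm (S N z) \<le> (\<Sum>n<N. C / Re z * (e (Re z) n - e (Re z) (Suc n)))"
      unfolding S_def by (intro order_trans[OF norm_sum] sum_mono bound') (use that in auto)
    also have "\<dots> = C / Re z * (e (Re z) 0 - e (Re z) N)"
      by (simp only: sum_distrib_left[symmetric] tele)
    also have "\<dots> = C / \<bar>Re z\<bar> * (e (Re z) N - 1)"
      using that by (simp add: e_def field_simps)
    also have "\<dots> \<le> C / \<bar>Re z\<bar> * e (Re z) N"
      using C by (intro mult_left_mono) auto
    finally show ?thesis by (simp add: e_def)
  qed
  have pos: "norm (S N z - g z) \<le> C * exp (- Re z * ln (real N + 1)) / Re z" if "Re z > 0" for N z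
  proof -
    have "e (Re z) \<longlonglongrightarrow> 0"
      unfolding e_def using that by real_asymp
    then have "(\<lambda>n. e (Re z) (n + N)) \<longlonglongrightarrow> 0" by (rule LIMSEQ_ignore_initial_segment)
    from telescope_sums'[OF this] have t: "(\<lambda>n. e (Re z) (n + N) - e (Re z) (Suc n + N)) sums e (Re z) N"
      by simp
    have t2: "(\<lambda>n. C / Re z * (e (Re z) (n + N) - e (Re z) (Suc n + N))) sums (C / Re z * e (Re z) N)"
      by (intro sums_mult t)
    have s: "(\<lambda>n. u (n + N) z) sums (g z - S N z)"
      unfolding S_def by (rule sums_split_initial_segment[OF sums[OF that]])
    have "norm (g z - S N z) \<le> C / Re z * e (Re z) N"
      unfolding sums_unique[OF s] sums_unique[OF t2]
      by (rule norm_suminf_le[OF _ sums_summable[OF t2]]) (use bound'[of z] that in auto)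
    then show ?thesis by (simp add: e_def norm_minus_commute)
  qed
  have "(\<lambda>N. S N 0) \<longlonglongrightarrow> g 0"
  proof (rule LIMSEQ_I)
    fix r :: real assume r: "r > 0"
    \<comment> \<open>With this radius the term 4 pi C / R is at most pi r, half of the allowed 2 pi
      r; the other half is left for \<open>K / L\<close>, which tends to 0 for fixed
      \<open>R\<close>.\<close>
    define R where "R = 8 * (C + 1) / r"
    have R: "R > 0" using C r by (simp add: R_def)
    obtain B where B: "\<And>L. L > 0 \<Longrightarrow> norm (contour_integral (part_circlepath 0 R (-pi/2) (pi/2))
        (\<lambda>w. (g w - g 0) * exp (w * of_real L) * ((1 + w\<^sup>2 / of_real (R\<^sup>2)) / w))) \<le> B / L"
      using newman_right_arc[OF U g R] by blast
    define K where "K = (B + 2 * pi * norm (g 0) / R)"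
    have "(\<lambda>N::nat. K / ln (real N + 1)) \<longlonglongrightarrow> 0" by real_asymp
    then have "eventually (\<lambda>N. K / ln (real N + 1) < r) sequentially"
      using r by (rule order_tendstoD)
    moreover have "eventually (\<lambda>N::nat. N > 0) sequentially" by (rule eventually_gt_at_top)
    ultimately have "eventually (\<lambda>N. norm (S N 0 - g 0) < r) sequentially"
    proof eventually_elim
      case (elim N)
      define L where "L = ln (real N + 1)"
      have L: "L > 0" using elim by (simp add: L_def)
      have "2 * pi * norm (S N 0 - g 0) \<le> 4 * pi * C / R + K / L"
        unfolding K_def using neg pos
        by (intro newman_finite_bound[OF U g R S L C B[OF L]]) (simp_all add: L_def)
      also have "4 * pi * C / R = pi * r * (C / (2 * (C + 1)))" using r C by (simp add: R_def field_simps)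
      also have "pi * r * (C / (2 * (C + 1))) \<le> pi * r * 1"
        using r C by (intro mult_left_mono) (auto simp: field_simps)
      also have "K / L < pi * r" using elim r pi_gt3 unfolding L_def
        by (smt (verit) mult_less_cancel_right2)
      finally show ?case using pi_gt_zero r by simp
    qed
    then show "\<exists>no. \<forall>n\<ge>no. norm (S n 0 - g 0) < r"
      by (simp add: eventually_sequentially)
  qed
  then show ?thesis by (simp add: sums_def S_def)
qed

section \<open>Dirichlet characters\<close>

text \<open>Functions on all of \<open>nat\<close>, zero off the units, so that they serve directly
  as coefficients of Dirichlet series.\<close>

definition dchar :: "nat \<Rightarrow> (nat \<Rightarrow> complex) \<Rightarrow> bool" where
  "dchar k \<xi> \<longleftrightarrow> (\<forall>n. \<xi> (n + k) = \<xi> n) \<and> (\<forall>m n. \<xi> (m * n) = \<xi> m * \<xi> n) \<and> (\<forall>n. \<xi> n \<noteq> 0 \<longleftrightarrow> coprime n k)"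

definition principal :: "nat \<Rightarrow> nat \<Rightarrow> complex" where
  "principal k n = of_bool (coprime n k)"

lemma periodic_mod:
  fixes f :: "nat \<Rightarrow> 'a"
  assumes "\<And>n. f (n + k) = f n"
  shows "f (n mod k) = f n"
proof -
  have "f (m + k * j) = f m" for m j
  proof (induction j)
    case (Suc j)
    then show ?case using assms[of "m + k * j"] by (simp add: add_ac)
  qed simp
  from this[of "n mod k" "n div k"] show ?thesis by (simp add: add.commute)
qed

lemma periodic_cong:
  fixes f :: "nat \<Rightarrow> 'a"
  assumes "\<And>n. f (n + k) = f n" "[m = n] (mod k)"
  shows "f m = f n"
  using periodic_mod[of f k m] periodic_mod[of f k n] assms by (simp add: cong_def)

lemma dchar_mult: "dchar k \<xi> \<Longrightarrow> \<xi> (m * n) = \<xi> m * \<xi> n"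
  and dchar_eq_0_iff: "dchar k \<xi> \<Longrightarrow> \<xi> n = 0 \<longleftrightarrow> \<not>coprime n k"
  and dchar_periodic: "dchar k \<xi> \<Longrightarrow> \<xi> (n + k) = \<xi> n"
  unfolding dchar_def by blast+

lemma dchar_cong: "dchar k \<xi> \<Longrightarrow> [m = n] (mod k) \<Longrightarrow> \<xi> m = \<xi> n"
  using periodic_cong[of \<xi> k m n] dchar_periodic[of k \<xi>] by blast

lemma dchar_1: "dchar k \<xi> \<Longrightarrow> \<xi> 1 = 1" "dchar k \<xi> \<Longrightarrow> \<xi> (Suc 0) = 1"
  using dchar_mult[of k \<xi> 1 1] dchar_eq_0_iff[of k \<xi> 1] by simp_all

lemma dchar_power: "dchar k \<xi> \<Longrightarrow> \<xi> (m ^ j) = \<xi> m ^ j"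
  by (induction j) (use dchar_1[of k \<xi>] dchar_mult[of k \<xi>] in simp_all)

lemma dchar_root_of_unity:
  assumes "dchar k \<xi>" "coprime n k"
  shows "\<xi> n ^ totient k = 1"
  using dchar_cong[OF assms(1) euler_theorem[OF assms(2)]]
  by (simp add: dchar_power[OF assms(1)] dchar_1[OF assms(1)])

lemma norm_dchar:
  assumes "dchar k \<xi>" "k > 0"
  shows "norm (\<xi> n) = of_bool (coprime n k)"
proof (cases "coprime n k")
  case True
  then have "norm (\<xi> n) ^ totient k = 1"
    using dchar_root_of_unity[OF assms(1) True] by (metis norm_one norm_power)
  then have "norm (\<xi> n) = 1"
    using power_eq_imp_eq_base[of "norm (\<xi> n)" "totient k" 1] assms(2) by simp
  then show ?thesis using True by simp
qed (use assms dchar_eq_0_iff[OF assms(1), of n] in simp)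

lemma norm_dchar_le: "dchar k \<xi> \<Longrightarrow> k > 0 \<Longrightarrow> norm (\<xi> n) \<le> 1"
  using norm_dchar[of k \<xi> n] by simp

lemma dchar_mult_cnj: "dchar k \<xi> \<Longrightarrow> k > 0 \<Longrightarrow> \<xi> n * cnj (\<xi> n) = of_bool (coprime n k)"
  using norm_dchar[of k \<xi> n] complex_norm_square[of "\<xi> n"] by (cases "coprime n k") auto

lemma dchar_principal: "dchar k (principal k)"
proof -
  have "coprime (n + k) k \<longleftrightarrow> coprime n k" for n
    by (simp only: coprime_iff_gcd_eq_1 gcd_add1)
  then show ?thesis by (auto simp: dchar_def principal_def)
qed

lemma dchar_product: "dchar k \<xi> \<Longrightarrow> dchar k \<psi> \<Longrightarrow> dchar k (\<lambda>n. \<xi> n * \<psi> n)"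
  by (auto simp: dchar_def)

lemma dchar_cnj: "dchar k \<xi> \<Longrightarrow> dchar k (\<lambda>n. cnj (\<xi> n))"
  by (auto simp: dchar_def)

text \<open>A character is determined by its restriction to \<open>{..<k}\<close>, whose values are
  0 or roots of unity of order dividing \<open>totient k\<close>.\<close>

lemma finite_dchar:
  assumes "k > 0"
  shows "finite {\<xi>. dchar k \<xi>}"
proof -
  let ?r = "\<lambda>\<xi>. restrict \<xi> {..<k}"
  have "?r ` {\<xi>. dchar k \<xi>} \<subseteq> PiE {..<k} (\<lambda>_. insert 0 {z. z ^ totient k = 1})"
  proof (clarsimp simp: PiE_iff)
    fix \<xi> n assume "dchar k \<xi>" "\<xi> n ^ totient k \<noteq> 1"
    then show "\<xi> n = 0"
      using dchar_root_of_unity[of k \<xi> n] dchar_eq_0_iff[of k \<xi> n] by auto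
  qed
  moreover have "finite (PiE {..<k} (\<lambda>_. insert 0 {z::complex. z ^ totient k = 1}))"
    by (intro finite_PiE) (use assms finite_roots_unity[of "totient k"] in \<open>auto simp: Suc_le_eq\<close>)
  ultimately have "finite (?r ` {\<xi>. dchar k \<xi>})" by (rule finite_subset)
  moreover have "inj_on ?r {\<xi>. dchar k \<xi>}"
  proof (intro inj_onI ext)
    fix \<xi> \<psi> n assume *: "\<xi> \<in> {\<xi>. dchar k \<xi>}" "\<psi> \<in> {\<xi>. dchar k \<xi>}" "?r \<xi> = ?r \<psi>"
    have "\<xi> (n mod k) = \<psi> (n mod k)"
      using fun_cong[OF *(3), of "n mod k"] assms by simp
    then show "\<xi> n = \<psi> n"
      using * periodic_mod[of \<xi> k n] periodic_mod[of \<psi> k n] dchar_periodic[of k] by simp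
  qed
  ultimately show ?thesis by (rule finite_imageD)
qed

section \<open>Construction of characters as joint eigenvectors of translations\<close>

text \<open>Functions on the unit group modulo \<open>k\<close>, extended by 0. Translations by
  units act on this space as commuting operators of finite order, and a common eigenvector is a
  character up to scaling.\<close>

definition unit_fun :: "nat \<Rightarrow> (nat \<Rightarrow> complex) \<Rightarrow> bool" where
  "unit_fun k f \<longleftrightarrow> (\<forall>n. f (n + k) = f n) \<and> (\<forall>n. \<not>coprime n k \<longrightarrow> f n = 0)"

text \<open>Up to a factor, the projection onto the eigenspace of the translation by \<open>g\<close> with
  eigenvalue \<open>z\<close>.\<close>
definition eigenproj :: "nat \<Rightarrow> nat \<Rightarrow> complex \<Rightarrow> (nat \<Rightarrow> complex) \<Rightarrow> nat \<Rightarrow> complex" where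
  "eigenproj k g z f x = (\<Sum>i<totient k. inverse z ^ i * f (g ^ i * x))"

lemma unit_fun_cong: "unit_fun k f \<Longrightarrow> [m = n] (mod k) \<Longrightarrow> f m = f n"
  by (rule periodic_cong[where k=k]) (auto simp: unit_fun_def)

lemma unit_fun_eigenproj:
  assumes "unit_fun k f"
  shows "unit_fun k (eigenproj k g z f)"
proof -
  have "f (g ^ i * (n + k)) = f (g ^ i * n)" for i n
    by (rule unit_fun_cong[OF assms]) (auto simp: cong_def algebra_simps)
  moreover have "f (g ^ i * n) = 0" if "\<not>coprime n k" for i n
    using assms that by (auto simp: unit_fun_def)
  ultimately show ?thesis
    by (auto simp: unit_fun_def eigenproj_def)
qed

lemma eigenproj_translate:
  assumes f: "unit_fun k f" and g: "coprime g k" and z: "z ^ totient k = 1" "k > 0"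
  shows "eigenproj k g z f (g * x) = z * eigenproj k g z f x"
proof -
  define F where "F = (\<lambda>i. inverse z ^ i * f (g ^ i * x))"
  have z0: "z \<noteq> 0" using z by (auto simp: power_0_left)
  have "[g ^ totient k * x = 1 * x] (mod k)"
    by (intro cong_mult cong_refl euler_theorem g)
  then have "F (totient k) = F 0"
    using unit_fun_cong[OF f] z by (simp add: F_def power_inverse)
  then have shift: "(\<Sum>i<totient k. F (Suc i)) = (\<Sum>i<totient k. F i)"
    using sum.lessThan_Suc_shift[of F "totient k"] sum.lessThan_Suc[of F "totient k"] by (simp add: algebra_simps)
  have "eigenproj k g z f (g * x) = (\<Sum>i<totient k. z * F (Suc i))"
    unfolding eigenproj_def F_def using z0 by (intro sum.cong) (auto simp: field_simps mult_ac)
  then show ?thesis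
    unfolding sum_distrib_left[symmetric] shift by (simp add: F_def eigenproj_def)
qed

text \<open>If every projection vanished at \<open>x\<close>, the polynomial with coefficients
  \<open>f (g ^ i * x)\<close> would vanish at all \<open>totient k\<close> roots of unity although
  its degree is smaller, so it would be 0; but its constant coefficient is
  \<open>f x\<close>.\<close>

lemma eigenproj_nonzero:
  assumes f: "f x \<noteq> 0" and k: "k > 0"
  shows "\<exists>z. z ^ totient k = 1 \<and> eigenproj k g z f x \<noteq> 0"
proof (rule ccontr)
  assume *: "\<not>(\<exists>z. z ^ totient k = 1 \<and> eigenproj k g z f x \<noteq> 0)"
  define p where "p = (\<Sum>i<totient k. Polynomial.monom (f (g ^ i * x)) i)"
  have coeff: "poly.coeff p 0 = f x"
    using k by (simp add: p_def coeff_sum)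
  then have p: "p \<noteq> 0" using f by auto
  have "poly p z = 0" if "z ^ totient k = 1" for z
  proof -
    have "eigenproj k g (inverse z) f x = 0" using * that
      by (metis inverse_1 power_inverse)
    then show ?thesis by (simp add: p_def poly_sum poly_monom eigenproj_def mult.commute)
  qed
  then have "card {z::complex. z ^ totient k = 1} \<le> card {z. poly p z = 0}"
    by (intro card_mono poly_roots_finite p) auto
  also have "\<dots> \<le> Polynomial.degree p" by (rule card_poly_roots_bound[OF p])
  also have "Polynomial.degree p \<le> totient k - 1"
    unfolding p_def by (intro degree_sum_le) (auto intro: order_trans[OF degree_monom_le])
  also have "\<dots> < totient k" using k by simp
  finally show False using card_roots_unity_eq[of "totient k"] k by simp
qed

text \<open>Induction over \<open>S\<close>, with one projection per new element. Translations
  commute, so the eigenvector relations already obtained survive each projection, including the one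
  for \<open>n\<close> with its eigenvalue different from 1.\<close>

lemma exists_joint_eigenvector:
  assumes k: "k > 0" and n: "coprime n k" "\<not>[n = 1] (mod k)" and S: "finite S" "\<And>g. g \<in> S \<Longrightarrow> coprime g k"
  shows "\<exists>f z. unit_fun k f \<and> (\<exists>x. f x \<noteq> 0) \<and> z \<noteq> 1 \<and> (\<forall>x. f (n * x) = z * f x) \<and>
             (\<forall>g\<in>S. \<exists>c. \<forall>x. f (g * x) = c * f x)"
  using S
proof (induction rule: finite_induct)
  case empty
  define d :: "nat \<Rightarrow> complex" where "d = (\<lambda>x. of_bool ([x = 1] (mod k)))"
  define f where "f = (\<lambda>x. d x - d (n * x))"
  have cop: "coprime x k" if "[x = 1] (mod k)" for x
    using that by (metis coprime_1_left cong_imp_coprime cong_sym)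
  have d: "unit_fun k d"
    using cop by (auto simp: unit_fun_def d_def cong_def)
  have d': "unit_fun k (\<lambda>x. d (n * x))"
    using cop[of "n * _"] by (auto simp: unit_fun_def d_def cong_def algebra_simps)
  have f: "unit_fun k f" using d d' by (auto simp: f_def unit_fun_def)
  have f1: "f 1 \<noteq> 0" using n by (auto simp: f_def d_def)
  obtain z where z: "z ^ totient k = 1" "eigenproj k n z f 1 \<noteq> 0"
    using eigenproj_nonzero[of f, OF f1 k] by blast
  \<comment> \<open>For this \<open>f\<close>, the difference of the indicator of 1 and its
    translate, the projection to the eigenvalue 1 telescopes around the orbit of \<open>n\<close> to
    0. Hence an eigenvalue with nonzero projection cannot be 1.\<close>
  have "eigenproj k n 1 f 1 = (\<Sum>i<totient k. d (n ^ i) - d (n ^ Suc i))"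
    by (simp add: eigenproj_def f_def)
  also have "\<dots> = d 1 - d (n ^ totient k)"
    by (subst sum_lessThan_telescope') simp
  also have "\<dots> = 0" using unit_fun_cong[OF d euler_theorem[OF n(1)]] by simp
  finally have "z \<noteq> 1" using z by auto
  then show ?case
    using unit_fun_eigenproj[OF f] z eigenproj_translate[OF f n(1) z(1) k] by blast
next
  case (insert g S)
  have "\<exists>f z. unit_fun k f \<and> (\<exists>x. f x \<noteq> 0) \<and> z \<noteq> 1 \<and> (\<forall>x. f (n * x) = z * f x) \<and>
             (\<forall>g\<in>S. \<exists>c. \<forall>x. f (g * x) = c * f x)"
    using insert.prems by (intro insert.IH) auto
  then obtain f z x where fz: "unit_fun k f" "f x \<noteq> 0" "z \<noteq> 1" "\<forall>x. f (n * x) = z * f x"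
    "\<forall>g\<in>S. \<exists>c. \<forall>x. f (g * x) = c * f x" by (elim exE conjE)
  then have f: "unit_fun k f" "z \<noteq> 1" "\<And>x. f (n * x) = z * f x"
       "\<And>h. h \<in> S \<Longrightarrow> \<exists>c. \<forall>x. f (h * x) = c * f x" by simp_all
  note x = fz(2)
  obtain w where w: "w ^ totient k = 1" "eigenproj k g w f x \<noteq> 0"
    using eigenproj_nonzero[of f, OF x k] by blast
  let ?f = "eigenproj k g w f"
  have *: "?f (h * y) = c * ?f y" if "\<And>x. f (h * x) = c * f x" for h c y
  proof -
    have "f (g ^ i * (h * y)) = c * f (g ^ i * y)" for i
      using that[of "g ^ i * y"] by (simp add: mult_ac)
    then show ?thesis by (simp add: eigenproj_def sum_distrib_left mult_ac)
  qed
  have "\<exists>c. \<forall>x. ?f (h * x) = c * ?f x" if h: "h \<in> insert g S" for h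
  proof (cases "h = g")
    case True
    then show ?thesis using eigenproj_translate[OF f(1) _ w(1) k] insert.prems by blast
  next
    case False
    then obtain c where "\<And>x. f (h * x) = c * f x" using f(4) h by blast
    then show ?thesis using * by blast
  qed
  then show ?case
    using unit_fun_eigenproj[OF f(1)] f(2) *[OF f(3)] w(2) by blast
qed

text \<open>Dividing a joint eigenvector by \<open>f 1\<close> gives a character: the relation
  \<open>f (l * m) = c * f m\<close> at m = 1 identifies the eigenvalue \<open>c\<close> as
  \<open>f l / f 1\<close>, and \<open>f 1\<close> is nonzero because \<open>f\<close> is nonzero at
  some unit. Its value at \<open>n\<close> is the eigenvalue that differs from 1.\<close>

lemma exists_separating_dchar:
  assumes k: "k > 0" and n: "coprime n k" "\<not>[n = 1] (mod k)"
  obtains \<xi> where "dchar k \<xi>" "\<xi> n \<noteq> 1"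
proof -
  have "finite {g. g < k \<and> coprime g k}" by simp
  from exists_joint_eigenvector[OF k n this] obtain f z x0 where
    f: "unit_fun k f" "f x0 \<noteq> 0" "z \<noteq> 1" "\<And>x. f (n * x) = z * f x"
    and "\<forall>g\<in>{g. g < k \<and> coprime g k}. \<exists>c. \<forall>x. f (g * x) = c * f x" by auto
  then have eig: "\<exists>c. \<forall>x. f (g * x) = c * f x" if "coprime g k" for g
  proof -
    have "g mod k \<in> {g. g < k \<and> coprime g k}" using that k by (simp add: coprime_commute)
    then obtain c where "\<And>x. f (g mod k * x) = c * f x"
      using \<open>\<forall>g\<in>_. _\<close> by blast
    moreover have "f (g mod k * x) = f (g * x)" for x
      by (intro unit_fun_cong[OF f(1)]) (simp add: cong_def mod_mult_left_eq)
    ultimately show ?thesis by metis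
  qed
  have cop: "coprime x0 k" using f by (auto simp: unit_fun_def)
  have f1: "f 1 \<noteq> 0" using eig[OF cop] f(2) by (metis mult.right_neutral mult_zero_right)
  define \<xi> where "\<xi> = (\<lambda>m. f m / f 1)"
  have "\<xi> (m + k) = \<xi> m" for m using f(1) by (simp add: \<xi>_def unit_fun_def)
  moreover have "\<xi> (l * m) = \<xi> l * \<xi> m" for l m
  proof (cases "coprime l k")
    case True
    then obtain c where c: "\<And>x. f (l * x) = c * f x" using eig by blast
    then show ?thesis using c[of 1] c[of m] f1 by (simp add: \<xi>_def)
  next
    case False
    then show ?thesis using f(1) by (simp add: \<xi>_def unit_fun_def)
  qed
  moreover have "\<xi> m \<noteq> 0 \<longleftrightarrow> coprime m k" for m
  proof
    assume m: "coprime m k"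
    obtain m' where "[m * m' = Suc 0] (mod k)" using cong_solve_coprime_nat[OF m] by (elim exE)
    then have m': "[m * m' = 1] (mod k)" by simp
    then have "coprime (m * m') k" by (metis coprime_1_left cong_imp_coprime cong_sym)
    then have "coprime m' k" by simp
    then obtain c where c: "\<And>x. f (m' * x) = c * f x" using eig by blast
    have "f 1 = f (m' * m)" by (metis unit_fun_cong[OF f(1) m'] mult.commute)
    then show "\<xi> m \<noteq> 0" using f1 c by (auto simp: \<xi>_def)
  qed (use f(1) in \<open>auto simp: \<xi>_def unit_fun_def\<close>)
  ultimately have "dchar k \<xi>" by (auto simp: dchar_def)
  moreover have "\<xi> n \<noteq> 1" using f(3) f(4)[of 1] f1 by (auto simp: \<xi>_def)
  ultimately show ?thesis using that by blast
qed

section \<open>Orthogonality relations\<close>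

text \<open>Multiplication by a character with \<psi> n \<noteq> 1 permutes the characters, its
  inverse being multiplication by the conjugate; so the sum is unchanged by a factor other than
  1.\<close>

lemma sum_dchar_eq_0:
  assumes k: "k > 0" and n: "\<not>[n = 1] (mod k)"
  shows "(\<Sum>\<xi> | dchar k \<xi>. \<xi> n) = 0"
proof (cases "coprime n k")
  case True
  then obtain \<psi> where \<psi>: "dchar k \<psi>" "\<psi> n \<noteq> 1" using exists_separating_dchar[OF k _ n] by blast
  let ?m = "\<lambda>\<psi> \<xi> n. \<psi> n * \<xi> n"
  have "bij_betw (?m \<psi>) {\<xi>. dchar k \<xi>} {\<xi>. dchar k \<xi>}"
  proof (rule bij_betwI[where g = "?m (\<lambda>n. cnj (\<psi> n))"])
    have z: "\<xi> m * of_bool (coprime m k) = \<xi> m" if "dchar k \<xi>" for \<xi> m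
      using dchar_eq_0_iff[OF that, of m] by (cases "coprime m k") auto
    have e: "\<psi> m * (cnj (\<psi> m) * \<xi> m) = \<xi> m * of_bool (coprime m k)"
      "cnj (\<psi> m) * (\<psi> m * \<xi> m) = \<xi> m * of_bool (coprime m k)" for \<xi> m
      using dchar_mult_cnj[OF \<psi>(1) k, of m] by (metis mult.assoc mult.commute)+
    show "?m (\<lambda>n. cnj (\<psi> n)) (?m \<psi> \<xi>) = \<xi>" "?m \<psi> (?m (\<lambda>n. cnj (\<psi> n)) \<xi>) = \<xi>" if "\<xi> \<in> {\<xi>. dchar k \<xi>}" for \<xi>
      using that by (auto simp: e z fun_eq_iff)
  qed (use \<psi> dchar_cnj in \<open>auto intro: dchar_product\<close>)
  from sum.reindex_bij_betw[OF this, of "\<lambda>\<xi>. \<xi> n"]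
  have "\<psi> n * (\<Sum>\<xi> | dchar k \<xi>. \<xi> n) = (\<Sum>\<xi> | dchar k \<xi>. \<xi> n)"
    by (simp add: sum_distrib_left)
  then show ?thesis using \<psi>(2) by (metis mult_cancel_right1)
next
  case False
  then show ?thesis by (intro sum.neutral) (auto simp: dchar_def)
qed

lemma sum_nonprincipal_eq_0:
  assumes k: "k > 0" and \<xi>: "dchar k \<xi>" "\<xi> \<noteq> principal k"
  shows "(\<Sum>n<k. \<xi> n) = 0"
proof -
  obtain a where a: "\<xi> a \<noteq> principal k a" using \<xi>(2) by blast
  then have a': "coprime a k" "\<xi> a \<noteq> 1" using dchar_eq_0_iff[OF \<xi>(1), of a] by (auto simp: principal_def of_bool_def split: if_splits)
  have "inj_on (\<lambda>n. a * n mod k) {..<k}"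
  proof (rule inj_onI)
    fix x y assume *: "x \<in> {..<k}" "y \<in> {..<k}" "a * x mod k = a * y mod k"
    then have "[x = y] (mod k)" using cong_mult_lcancel_nat[OF a'(1)] by (simp add: cong_def)
    then show "x = y" using * by (simp add: cong_def)
  qed
  moreover have "(\<lambda>n. a * n mod k) ` {..<k} \<subseteq> {..<k}" using k by auto
  ultimately have "bij_betw (\<lambda>n. a * n mod k) {..<k} {..<k}"
    by (simp add: bij_betw_def endo_inj_surj)
  from sum.reindex_bij_betw[OF this, of \<xi>]
  have "(\<Sum>n<k. \<xi> (a * n mod k)) = (\<Sum>n<k. \<xi> n)" .
  moreover have "\<xi> (a * n mod k) = \<xi> a * \<xi> n" for n
    using dchar_mult[OF \<xi>(1), of a n] periodic_mod[of \<xi> k "a * n"] dchar_periodic[OF \<xi>(1)] by simp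
  ultimately have "\<xi> a * (\<Sum>n<k. \<xi> n) = (\<Sum>n<k. \<xi> n)" by (simp add: sum_distrib_left)
  then show ?thesis using a'(2) by (metis mult_cancel_right1)
qed

lemma sum_principal:
  assumes k: "k > 0"
  shows "(\<Sum>n<k. principal k n) = of_nat (totient k)"
proof (cases "k = 1")
  case False
  have "(\<Sum>n<k. principal k n) = (\<Sum>n\<in>{n\<in>{..<k}. coprime n k}. 1)"
    unfolding principal_def of_bool_def by (subst sum.inter_filter) auto
  also have "{n\<in>{..<k}. coprime n k} = totatives k"
  proof -
    have "n < k \<and> coprime n k \<longleftrightarrow> 0 < n \<and> n \<le> k \<and> coprime n k" for n
      using False k by (cases "n = 0"; cases "n = k") auto
    then show ?thesis unfolding set_eq_iff mem_Collect_eq lessThan_iff in_totatives_iff by blast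
  qed
  finally show ?thesis by (simp add: totient_def)
qed (auto simp: principal_def)

text \<open>The double sum of \<xi> n over residues and characters is evaluated in both orders: only
  the residue of 1 survives one way, only the principal character the other. The residue is written
  \<open>1 mod k\<close> because it is 0 when k = 1.\<close>

lemma card_dchar:
  assumes k: "k > 0"
  shows "card {\<xi>. dchar k \<xi>} = totient k"
proof -
  have "(\<Sum>n<k. \<Sum>\<xi> | dchar k \<xi>. \<xi> n) = (\<Sum>n\<in>{1 mod k}. \<Sum>\<xi> | dchar k \<xi>. \<xi> n)"
  proof (intro sum.mono_neutral_right ballI)
    fix n assume n: "n \<in> {..<k} - {1 mod k}"
    then have "\<not> [n = 1] (mod k)" by (auto simp: cong_def)
    then show "(\<Sum>\<xi> | dchar k \<xi>. \<xi> n) = 0" by (rule sum_dchar_eq_0[OF k])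
  qed (use k in auto)
  also have "\<dots> = (\<Sum>\<xi> | dchar k \<xi>. 1)"
  proof -
    have "\<xi> (1 mod k) = 1" if "dchar k \<xi>" for \<xi>
      using periodic_mod[of \<xi> k 1] dchar_periodic[OF that] dchar_1[OF that] by simp
    then have "(\<Sum>\<xi> | dchar k \<xi>. \<xi> (1 mod k)) = (\<Sum>\<xi> | dchar k \<xi>. 1)"
      by (intro sum.cong) auto
    moreover have "(\<Sum>n\<in>{m}. f n) = f m" for f :: "nat \<Rightarrow> complex" and m by simp
    ultimately show ?thesis by (simp only:)
  qed
  also have "\<dots> = of_nat (card {\<xi>. dchar k \<xi>})" by (simp only: sum_constant mult_1_right)
  finally have 1: "(\<Sum>n<k. \<Sum>\<xi> | dchar k \<xi>. \<xi> n) = of_nat (card {\<xi>. dchar k \<xi>})" .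
  have "(\<Sum>n<k. \<Sum>\<xi> | dchar k \<xi>. \<xi> n) = (\<Sum>\<xi> | dchar k \<xi>. \<Sum>n<k. \<xi> n)"
    by (rule sum.swap)
  also have "\<dots> = (\<Sum>\<xi>\<in>{principal k}. \<Sum>n<k. \<xi> n)"
  proof (intro sum.mono_neutral_right finite_dchar k ballI)
    fix \<xi> assume "\<xi> \<in> {\<xi>. dchar k \<xi>} - {principal k}"
    then show "(\<Sum>n<k. \<xi> n) = 0" using sum_nonprincipal_eq_0[OF k, of \<xi>] by blast
  next
    show "{principal k} \<subseteq> {\<xi>. dchar k \<xi>}" using dchar_principal[of k] by blast
  qed
  also have "\<dots> = of_nat (totient k)"
    using sum_principal[OF k] by (subst sum.insert) auto
  finally have "(of_nat (card {\<xi>. dchar k \<xi>}) :: complex) = of_nat (totient k)"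
    unfolding 1 .
  then show ?thesis by (simp only: of_nat_eq_iff)
qed

text \<open>With \<open>c\<close> inverse to \<open>b\<close> modulo \<open>k\<close>, the conjugate
  of \<xi> b is \<xi> c, so the sum becomes the plain sum over characters at
  \<open>c * n\<close>.\<close>

lemma dchar_orthogonality:
  assumes k: "k > 0" and b: "coprime b k"
  shows "(\<Sum>\<xi> | dchar k \<xi>. cnj (\<xi> b) * \<xi> n) = of_bool ([n = b] (mod k)) * of_nat (totient k)"
proof -
  obtain c where "[b * c = Suc 0] (mod k)" using cong_solve_coprime_nat[OF b] by (elim exE)
  then have c: "[b * c = 1] (mod k)" by simp
  have cc: "cnj (\<xi> b) = \<xi> c" if \<xi>: "dchar k \<xi>" for \<xi>
  proof -
    have "\<xi> b * \<xi> c = 1" using dchar_cong[OF \<xi> c] dchar_mult[OF \<xi>] dchar_1[OF \<xi>] by metis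
    moreover have "\<xi> b * cnj (\<xi> b) = 1" using dchar_mult_cnj[OF \<xi> k] b by simp
    ultimately show ?thesis by (metis mult_cancel_left zero_neq_one mult_zero_left)
  qed
  have "(\<Sum>\<xi> | dchar k \<xi>. cnj (\<xi> b) * \<xi> n) = (\<Sum>\<xi> | dchar k \<xi>. \<xi> (c * n))"
    by (intro sum.cong) (auto simp: cc dchar_def)
  moreover have "[c * n = 1] (mod k) \<longleftrightarrow> [n = b] (mod k)"
  proof
    assume "[c * n = 1] (mod k)"
    then have "[b * (c * n) = b * 1] (mod k)" by (intro cong_mult cong_refl)
    moreover have "[b * c * n = 1 * n] (mod k)" by (intro cong_mult cong_refl c)
    ultimately show "[n = b] (mod k)" by (simp add: mult.assoc cong_def)
  next
    assume "[n = b] (mod k)"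
    then have "[c * n = c * b] (mod k)" by (intro cong_mult cong_refl)
    then show "[c * n = 1] (mod k)" using c by (simp add: mult.commute cong_def)
  qed
  moreover have "(\<Sum>\<xi> | dchar k \<xi>. \<xi> (c * n)) = of_nat (totient k)" if "[c * n = 1] (mod k)"
  proof -
    have "(\<Sum>\<xi> | dchar k \<xi>. \<xi> (c * n)) = (\<Sum>\<xi> | dchar k \<xi>. 1)"
    proof (intro sum.cong refl)
      fix \<xi> assume "\<xi> \<in> {\<xi>. dchar k \<xi>}"
      then show "\<xi> (c * n) = 1" using dchar_cong[OF _ that, of \<xi>] dchar_1[of k \<xi>] by simp
    qed
    then show ?thesis using card_dchar[OF k] by simp
  qed
  ultimately show ?thesis using sum_dchar_eq_0[OF k, of "c * n"] by auto
qed

section \<open>Analytic continuation of Dirichlet series\<close>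

lemma of_nat_powr_minus:
  "n > 0 \<Longrightarrow> (of_nat n :: complex) powr (-s) = exp (- s * of_real (ln (real n)))"
  by (simp add: powr_def Ln_of_nat)

lemma norm_of_nat_powr_minus: "norm ((of_nat n :: complex) powr (-s)) = real n powr (- Re s)"
  by (cases "n = 0") (auto simp: norm_powr_real_powr)

text \<open>The integral of (A t - c t) t^(-s-1) over [n + 1, n + 2], where the summatory function
  has the value \<open>A (Suc n)\<close> up to the right endpoint. Summed over n it is the Mellin
  transform of the error term; cutting it into slices makes every summand entire in
  \<open>s\<close>.\<close>

definition slice_int :: "(nat \<Rightarrow> complex) \<Rightarrow> complex \<Rightarrow> nat \<Rightarrow> complex \<Rightarrow> complex" where
  "slice_int A c n s = integral {real n + 1..real n + 2}
      (\<lambda>t. (A (Suc n) - c * of_real t) * exp (- (s + 1) * of_real (ln t)))"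

lemma continuous_on_slice:
  fixes A :: "nat \<Rightarrow> complex"
  shows "continuous_on {real n + 1..real n + 2} (\<lambda>t. (A (Suc n) - c * of_real t) * exp (- (s + 1) * of_real (ln t)))"
  by (intro continuous_intros) auto

lemma slice_int_holomorphic: "slice_int A c n holomorphic_on UNIV"
proof -
  let ?f = "\<lambda>s t. (A (Suc n) - c * of_real t) * exp (- (s + 1) * of_real (ln t))"
  have "(\<lambda>s. integral (cbox (real n + 1) (real n + 2)) (?f s)) holomorphic_on UNIV"
  proof (rule leibniz_rule_holomorphic)
    show "((\<lambda>s. ?f s t) has_field_derivative ?f s t * (- of_real (ln t))) (at s within UNIV)" for s t
      by (auto intro!: derivative_eq_intros)
    show "?f s integrable_on cbox (real n + 1) (real n + 2)" for s
      using continuous_on_slice[of n A c s] by (intro integrable_continuous) auto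
    show "continuous_on (UNIV \<times> cbox (real n + 1) (real n + 2)) (\<lambda>(s, t). ?f s t * (- of_real (ln t)))"
      unfolding case_prod_unfold by (intro continuous_intros) auto
  qed auto
  then show ?thesis unfolding slice_int_def by simp
qed

text \<open>This is the bound that Newman's theorem asks for. The argument is shifted by 1 so that
  the line Re s = 1 becomes Re z = 0, and the majorant C t^(-Re z - 1) is integrated
  explicitly.\<close>

lemma norm_slice_int_le_linear:
  assumes "\<And>t. real n + 1 \<le> t \<Longrightarrow> t \<le> real n + 2 \<Longrightarrow> norm (A (Suc n) - c * of_real t) \<le> C * t" and "Re z \<noteq> 0"
  shows "norm (slice_int A c n (z + 1)) \<le>
           C * (exp (- Re z * ln (real n + 1)) - exp (- Re z * ln (real n + 2))) / Re z"
proof -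
  let ?f = "\<lambda>t. (A (Suc n) - c * of_real t) * exp (- (z + 1 + 1) * of_real (ln t))"
  let ?h = "\<lambda>t. - C / Re z * exp (- Re z * ln t)"
  have h: "((\<lambda>t. C * exp (- (Re z + 1) * ln t)) has_integral (?h (real n + 2) - ?h (real n + 1))) {real n + 1..real n + 2}"
  proof (rule fundamental_theorem_of_calculus)
    fix t assume t: "t \<in> {real n + 1..real n + 2}"
    then have "t > 0" by auto
    then have "(?h has_real_derivative (- C / Re z * (exp (- Re z * ln t) * (- Re z * (1 / t))))) (at t)"
      by (auto intro!: derivative_eq_intros)
    also have "- C / Re z * (exp (- Re z * ln t) * (- Re z * (1 / t))) = C * exp (- (Re z + 1) * ln t)"
      using \<open>t > 0\<close> assms(2) by (simp add: algebra_simps exp_add exp_diff exp_minus field_simps)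
    finally show "(?h has_vector_derivative C * exp (- (Re z + 1) * ln t)) (at t within {real n + 1..real n + 2})"
      by (simp add: has_real_derivative_iff_has_vector_derivative has_vector_derivative_at_within)
  qed auto
  have "norm (slice_int A c n (z + 1)) \<le> integral {real n + 1..real n + 2} (\<lambda>t. C * exp (- (Re z + 1) * ln t))"
    unfolding slice_int_def
  proof (rule integral_norm_bound_integral)
    show "?f integrable_on {real n + 1..real n + 2}"
      using continuous_on_slice[of n A c "z+1"] by (rule integrable_continuous_real)
    show "(\<lambda>t. C * exp (- (Re z + 1) * ln t)) integrable_on {real n + 1..real n + 2}"
      using h by blast
    fix t assume t: "t \<in> {real n + 1..real n + 2}"
    then have t0: "t > 0" by auto
    have "norm (?f t) = norm (A (Suc n) - c * of_real t) * exp (- (Re z + 2) * ln t)"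
      by (simp add: norm_mult norm_exp_eq_Re)
    also have "\<dots> \<le> C * t * exp (- (Re z + 2) * ln t)"
      using t by (intro mult_right_mono assms) auto
    also have "\<dots> = C * exp (- (Re z + 1) * ln t)"
    proof -
      have "t * exp (- (Re z + 2) * ln t) = exp (ln t + - (Re z + 2) * ln t)"
        using t0 by (simp only: exp_add exp_ln)
      also have "ln t + - (Re z + 2) * ln t = - (Re z + 1) * ln t" by (simp add: algebra_simps)
      finally show ?thesis by simp
    qed
    finally show "norm (?f t) \<le> C * exp (- (Re z + 1) * ln t)" .
  qed
  also have "\<dots> = ?h (real n + 2) - ?h (real n + 1)"
    using h by (rule integral_unique)
  also have "\<dots> = C * (exp (- Re z * ln (real n + 1)) - exp (- Re z * ln (real n + 2))) / Re z"
    using assms(2) by (simp add: field_simps)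
  finally show ?thesis .
qed

text \<open>For a bounded error term the slices decay like n^(-Re s - 1), which gives convergence
  for all Re s > 0.\<close>

lemma norm_slice_int_le_bounded:
  assumes "\<And>t. real n + 1 \<le> t \<Longrightarrow> t \<le> real n + 2 \<Longrightarrow> norm (A (Suc n) - c * of_real t) \<le> B" and "Re s \<ge> 0"
  shows "norm (slice_int A c n s) \<le> B * real (Suc n) powr (- Re s - 1)"
proof -
  let ?f = "\<lambda>t. (A (Suc n) - c * of_real t) * exp (- (s + 1) * of_real (ln t))"
  have B: "B \<ge> 0" using order_trans[OF norm_ge_zero assms(1)[of "real n + 1"]] by simp
  have "norm (slice_int A c n s) \<le> integral {real n + 1..real n + 2} (\<lambda>t. B * real (Suc n) powr (- Re s - 1))"
    unfolding slice_int_def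
  proof (rule integral_norm_bound_integral)
    show "?f integrable_on {real n + 1..real n + 2}"
      using continuous_on_slice[of n A c s] by (rule integrable_continuous_real)
    fix t assume t: "t \<in> {real n + 1..real n + 2}"
    then have t0: "t > 0" by auto
    have "norm (?f t) = norm (A (Suc n) - c * of_real t) * t powr (- Re s - 1)"
    proof -
      have "norm (exp (- (s + 1) * of_real (ln t))) = t powr (- Re s - 1)"
        using t0 by (simp add: norm_exp_eq_Re powr_def algebra_simps)
      then show ?thesis by (simp only: norm_mult)
    qed
    also have "\<dots> \<le> B * real (Suc n) powr (- Re s - 1)"
      using t assms B by (intro mult_mono powr_mono2') auto
    finally show "norm (?f t) \<le> B * real (Suc n) powr (- Re s - 1)" .
  qed auto
  then show ?thesis by simp
qed

lemma slice_int_eq: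
  assumes "s \<noteq> 0" "s \<noteq> 1 \<or> c = 0"
  shows "s * slice_int A c n s = A (Suc n) * (of_nat (n + 1) powr (-s) - of_nat (n + 2) powr (-s))
           - c * s / (s - 1) * (of_nat (n + 1) powr (-(s - 1)) - of_nat (n + 2) powr (-(s - 1)))"
proof -
  let ?f = "\<lambda>t. (A (Suc n) - c * of_real t) * exp (- (s + 1) * of_real (ln t))"
  let ?F = "\<lambda>t. - A (Suc n) / s * exp (- s * of_real (ln t)) + c / (s - 1) * exp (- (s - 1) * of_real (ln t))"
  have "(?f has_integral (?F (real n + 2) - ?F (real n + 1))) {real n + 1..real n + 2}"
  proof (rule fundamental_theorem_of_calculus)
    fix t assume t: "t \<in> {real n + 1..real n + 2}"
    then have t0: "t > 0" by auto
    let ?G = "\<lambda>z. - A (Suc n) / s * exp (- s * Ln z) + c / (s - 1) * exp (- (s - 1) * Ln z)"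
    have Ln: "Ln (of_real t) = of_real (ln t)" using t0 by (simp add: Ln_of_real)
    have et: "exp (of_real (ln t)) = (of_real t :: complex)" using t0 by (simp add: exp_of_real)
    have e1: "exp (- w * of_real (ln t)) / of_real t = exp (- (w + 1) * of_real (ln t))" for w :: complex
    proof -
      have "- w * of_real (ln t) = - (w + 1) * of_real (ln t) + of_real (ln t)" by (simp add: algebra_simps)
      then show ?thesis using t0 by (simp only: exp_add et) simp
    qed
    have e2: "exp (- w * of_real (ln t)) = exp (- (w + 1) * of_real (ln t)) * of_real t" for w :: complex
    proof -
      have "- w * of_real (ln t) = - (w + 1) * of_real (ln t) + of_real (ln t)" by (simp add: algebra_simps)
      then show ?thesis by (simp only: exp_add et)
    qed
    have "(?G has_field_derivative 
        (- A (Suc n) / s * (exp (- s * Ln (of_real t)) * (- s * (1 / of_real t))) + c / (s - 1) * (exp (- (s - 1) * Ln (of_real t)) * (- (s - 1) * (1 / of_real t))))) (at (of_real t))"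
    proof -
      have "((\<lambda>z. exp (w * Ln z)) has_field_derivative exp (w * Ln (of_real t)) * (w * (1 / of_real t))) (at (of_real t))" for w
        using t0 by (auto intro!: derivative_eq_intros simp: field_simps)
      then show ?thesis by (intro DERIV_add DERIV_cmult)
    qed
    then have "((\<lambda>t. ?G (of_real t)) has_vector_derivative 
       (- A (Suc n) / s * (exp (- s * Ln (of_real t)) * (- s * (1 / of_real t))) + c / (s - 1) * (exp (- (s - 1) * Ln (of_real t)) * (- (s - 1) * (1 / of_real t))))) (at t within {real n + 1..real n + 2})"
      by (intro has_vector_derivative_real_field has_vector_derivative_at_within)
    also have "- A (Suc n) / s * (exp (- s * Ln (of_real t)) * (- s * (1 / of_real t))) + c / (s - 1) * (exp (- (s - 1) * Ln (of_real t)) * (- (s - 1) * (1 / of_real t)))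
      = A (Suc n) * (exp (- s * Ln (of_real t)) / of_real t) - c * (exp (- (s - 1) * Ln (of_real t)) / of_real t)"
    proof -
      have 1: "- a / s * (e * (- s * (1 / u))) = a * (e / u)" for a e u
        using assms(1) by (simp add: field_simps)
      have 2: "c / (s - 1) * (e * (- (s - 1) * (1 / u))) = - (c * (e / u))" for e u
      proof (cases "c = 0")
        case False
        then have "s - 1 \<noteq> 0" using assms(2) by auto
        then have "c / (s - 1) * (e * (- (s - 1) * (1 / u))) = - (c * (e * (1 / u)))"
          by (metis (no_types, opaque_lifting) mult.assoc mult.commute mult_minus_left nonzero_eq_divide_eq)
        then show ?thesis by simp
      qed simp
      show ?thesis by (simp only: 1 2) simp
    qed
    also have "exp (- s * Ln (of_real t)) / of_real t = exp (- (s + 1) * of_real (ln t))"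
      using e1[of s] by (simp add: Ln)
    also have "exp (- (s - 1) * Ln (of_real t)) / of_real t = exp (- (s + 1) * of_real (ln t)) * of_real t"
      using e1[of "s - 1"] e1[of s] e2[of s] by (simp add: Ln)
    also have "A (Suc n) * exp (- (s + 1) * of_real (ln t)) - c * (exp (- (s + 1) * of_real (ln t)) * of_real t) = ?f t"
      by (simp add: algebra_simps)
    finally show "(?F has_vector_derivative ?f t) (at t within {real n + 1..real n + 2})"
      by (rule has_vector_derivative_transform[rotated 2]) (use t in \<open>auto simp: Ln_of_real\<close>)
  qed auto
  then have "slice_int A c n s = ?F (real n + 2) - ?F (real n + 1)"
    unfolding slice_int_def by (rule integral_unique)
  moreover have "of_nat (n + 1) powr (-w) = exp (- w * of_real (ln (real n + 1)))"
    "of_nat (n + 2) powr (-w) = exp (- w * of_real (ln (real n + 2)))" for w :: complex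
    using of_nat_powr_minus[of "n+1" w] of_nat_powr_minus[of "n+2" w] by (simp_all add: add_ac)
  moreover have "s * (- a / s * e2 + D * g2 - (- a / s * e1 + D * g1)) = a * (e1 - e2) - D * s * (g1 - g2)" for a e1 e2 g1 g2 D
    using assms(1) by (simp add: field_simps)
  moreover have "c * s / (s - 1) = c / (s - 1) * s" by simp
  ultimately show ?thesis by (simp only:)
qed

text \<open>Abel summation: s times the integral of A t * t^(-s-1) is the Dirichlet series, and the
  subtracted linear term contributes c s / (s - 1). The term n = 0 of the series vanishes because
  \<open>0 powr (-s)\<close> is 0, so \<open>A\<close> starts at 1.\<close>

lemma sums_slice_int:
  fixes a :: "nat \<Rightarrow> complex"
  defines "A \<equiv> (\<lambda>N. \<Sum>n\<in>{1..N}. a n)"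
  assumes s: "Re s > 1" and F: "(\<lambda>n. a n * of_nat n powr (-s)) sums F"
    and A: "\<And>N. norm (A N) \<le> C * (real N + 1)"
  shows "(\<lambda>n. s * slice_int A c n s) sums (F - c * s / (s - 1))"
proof -
  have s01: "s \<noteq> 0" "s \<noteq> 1" using s by auto
  have abel: "(\<Sum>n<M. A (Suc n) * (of_nat (n + 1) powr (-s) - of_nat (n + 2) powr (-s)))
      = (\<Sum>n<Suc M. a n * of_nat n powr (-s)) - A M * of_nat (M + 1) powr (-s)" for M
    by (induction M) (simp_all add: A_def algebra_simps)
  have tele: "(\<Sum>n<M. of_nat (n + 1) powr (-(s - 1)) - of_nat (n + 2) powr (-(s - 1))) =
      1 - of_nat (M + 1) powr (-(s - 1))" for M
    by (induction M) simp_all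
  have "(\<lambda>M. (\<Sum>n<Suc M. a n * of_nat n powr (-s)) - A M * of_nat (M + 1) powr (-s)
         - c * s / (s - 1) * (1 - of_nat (M + 1) powr (-(s - 1)))) \<longlonglongrightarrow> F - 0 - c * s / (s - 1) * (1 - 0)"
  proof (intro tendsto_intros)
    show "(\<lambda>M. \<Sum>n<Suc M. a n * of_nat n powr (-s)) \<longlonglongrightarrow> F"
      using F unfolding sums_def by (rule LIMSEQ_Suc)
    have 1: "(\<lambda>M. real (M + 1) powr (- (Re s - 1))) \<longlonglongrightarrow> 0"
      using s by real_asymp
    show "(\<lambda>M. of_nat (M + 1) powr (-(s - 1))) \<longlonglongrightarrow> 0"
      by (rule tendsto_norm_zero_cancel) (use 1 in \<open>simp only: norm_of_nat_powr_minus minus_complex.simps one_complex.simps\<close>)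
    show "(\<lambda>M. A M * of_nat (M + 1) powr (-s)) \<longlonglongrightarrow> 0"
    proof (rule Lim_null_comparison)
      show "(\<lambda>M. C * real (M + 1) powr (- (Re s - 1))) \<longlonglongrightarrow> 0"
        using tendsto_mult_right_zero[OF 1, of C] by simp
      have "norm (A M * of_nat (M + 1) powr (-s)) \<le> C * real (M + 1) powr (- (Re s - 1))" for M
      proof -
        have "norm (A M * of_nat (M + 1) powr (-s)) = norm (A M) * real (M + 1) powr (- Re s)"
          by (simp only: norm_mult norm_of_nat_powr_minus)
        also have "\<dots> \<le> C * real (M + 1) * real (M + 1) powr (- Re s)"
          using A[of M] by (intro mult_right_mono) (auto simp: add_ac)
        also have "\<dots> = C * (real (M + 1) powr 1 * real (M + 1) powr (- Re s))" by simp
        also have "\<dots> = C * real (M + 1) powr (- (Re s - 1))"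
          by (simp only: powr_add[symmetric]) simp
        finally show ?thesis .
      qed
      then show "\<forall>\<^sub>F M in sequentially. norm (A M * of_nat (M + 1) powr (-s)) \<le> C * real (M + 1) powr (- (Re s - 1))"
        by simp
    qed
  qed
  moreover have "(\<Sum>n<M. s * slice_int A c n s) = (\<Sum>n<Suc M. a n * of_nat n powr (-s)) - A M * of_nat (M + 1) powr (-s)
         - c * s / (s - 1) * (1 - of_nat (M + 1) powr (-(s - 1)))" for M
  proof -
    have "(\<Sum>n<M. s * slice_int A c n s) = 
       (\<Sum>n<M. A (Suc n) * (of_nat (n + 1) powr (-s) - of_nat (n + 2) powr (-s)))
       - c * s / (s - 1) * (\<Sum>n<M. of_nat (n + 1) powr (-(s - 1)) - of_nat (n + 2) powr (-(s - 1)))"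
    proof -
      have "s * slice_int A c n s = A (Suc n) * (of_nat (n + 1) powr (-s) - of_nat (n + 2) powr (-s))
           - c * s / (s - 1) * (of_nat (n + 1) powr (-(s - 1)) - of_nat (n + 2) powr (-(s - 1)))" for n
        by (rule slice_int_eq) (use s01 in auto)
      then have "(\<Sum>n<M. s * slice_int A c n s) = (\<Sum>n<M. A (Suc n) * (of_nat (n + 1) powr (-s) - of_nat (n + 2) powr (-s))
           - c * s / (s - 1) * (of_nat (n + 1) powr (-(s - 1)) - of_nat (n + 2) powr (-(s - 1))))"
        by (intro sum.cong refl)
      also have "\<dots> = (\<Sum>n<M. A (Suc n) * (of_nat (n + 1) powr (-s) - of_nat (n + 2) powr (-s)))
       - c * s / (s - 1) * (\<Sum>n<M. of_nat (n + 1) powr (-(s - 1)) - of_nat (n + 2) powr (-(s - 1)))"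
        by (subst sum_distrib_left, rule sum_subtractf)
      finally show ?thesis .
    qed
    then show ?thesis by (simp only: abel tele)
  qed
  ultimately show ?thesis by (simp add: sums_def)
qed

lemma slice_series_holomorphic:
  assumes "\<And>n t. real n + 1 \<le> t \<Longrightarrow> t \<le> real n + 2 \<Longrightarrow> norm (A (Suc n) - c * of_real t) \<le> B"
  obtains H where "H holomorphic_on {s. Re s > 0}" "\<And>s. Re s > 0 \<Longrightarrow> (\<lambda>n. slice_int A c n s) sums H s"
proof -
  let ?S = "{s::complex. Re s > 0}"
  have B: "B \<ge> 0" using order_trans[OF norm_ge_zero assms(1)[of 0 1]] by simp
  have S: "open ?S" by (simp add: open_halfspace_Re_gt)
  have "\<exists>g g'. \<forall>x\<in>?S. (\<lambda>n. slice_int A c n x) sums g x \<and> (\<lambda>n. deriv (slice_int A c n) x) sums g' x \<and>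
          (g has_field_derivative g' x) (at x)"
  proof (rule series_and_derivative_comparison_local[OF S])
    show "(slice_int A c n has_field_derivative deriv (slice_int A c n) x) (at x)" for n x
      using slice_int_holomorphic[of A c n] by (metis UNIV_I holomorphic_derivI open_UNIV)
    fix x assume x: "x \<in> ?S"
    define e where "e = Re x / 2"
    have e: "e > 0" using x by (simp add: e_def)
    define h where "h = (\<lambda>n. B * real (Suc n) powr (- e - 1))"
    have "summable (\<lambda>n. real n powr (- e - 1))" using e by (simp add: summable_real_powr_iff)
    then have h: "summable h" unfolding h_def by (intro summable_mult) (subst summable_Suc_iff)
    have "norm (slice_int A c n y) \<le> h n" if y: "y \<in> ball x e" for n y
    proof -
      have "\<bar>Re x - Re y\<bar> \<le> dist x y" unfolding dist_norm by (metis abs_Re_le_cmod minus_complex.simps(1))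
      then have "Re y \<ge> e" using y by (simp add: e_def)
      then have "norm (slice_int A c n y) \<le> B * real (Suc n) powr (- Re y - 1)"
        using e by (intro norm_slice_int_le_bounded assms) auto
      also have "\<dots> \<le> h n" unfolding h_def using \<open>Re y \<ge> e\<close> B by (intro mult_left_mono powr_mono) auto
      finally show ?thesis .
    qed
    then show "\<exists>d h. 0 < d \<and> summable h \<and> (\<forall>\<^sub>F n in sequentially. \<forall>y\<in>ball x d \<inter> ?S. norm (slice_int A c n y) \<le> h n)"
      using e h by (intro exI[of _ e] exI[of _ h]) auto
  qed
  then obtain g g' where "\<And>x. x \<in> ?S \<Longrightarrow> (\<lambda>n. slice_int A c n x) sums g x \<and> (g has_field_derivative g' x) (at x)"
    by blast
  then show ?thesis
    by (intro that[of g]) (auto intro!: derivative_intros simp: holomorphic_on_open[OF S])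
qed

text \<open>The deviation from the linear main term is itself periodic, because a full period of
  \<open>a\<close> adds exactly c k; hence it takes only finitely many values.\<close>

lemma periodic_sums_bounded:
  fixes a :: "nat \<Rightarrow> complex"
  assumes k: "k > 0" and per: "\<And>n. a (n + k) = a n"
  defines "c \<equiv> (\<Sum>n<k. a n) / of_nat k"
  obtains B where "\<And>N. norm ((\<Sum>n\<in>{1..N}. a n) - c * of_nat N) \<le> B"
proof -
  define D where "D = (\<lambda>N. (\<Sum>n<Suc N. a n) - a 0 - c * of_nat N)"
  have T: "(\<Sum>n<N + k. a n) = (\<Sum>n<N. a n) + (\<Sum>n<k. a n)" for N
    by (induction N) (auto simp: per)
  have D: "D (N + k) = D N" for N
    using T[of "Suc N"] k by (simp add: D_def c_def algebra_simps add_divide_distrib)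
  have D': "D (m + k * q) = D m" for m q
    by (induction q) (simp_all add: add.assoc[symmetric] D add.commute[of k])
  have "norm (D N) \<le> (\<Sum>n<k. norm (D n))" for N
  proof -
    have "norm (D N) = norm (D (N mod k))" using D'[of "N mod k" "N div k"] by simp
    also have "\<dots> \<le> (\<Sum>n<k. norm (D n))" using k by (intro member_le_sum) auto
    finally show ?thesis .
  qed
  moreover have "(\<Sum>n\<in>{1..N}. a n) - c * of_nat N = D N" for N
  proof -
    have "(\<Sum>n<Suc N. a n) = a 0 + (\<Sum>n\<in>{1..N}. a n)"
      by (induction N) auto
    then show ?thesis by (simp add: D_def)
  qed
  ultimately show ?thesis using that by metis
qed

text \<open>The logarithm makes room for the von Mangoldt coefficients; it is absorbed by half of
  the excess of Re s over 1.\<close>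

lemma summable_dirichlet:
  fixes a :: "nat \<Rightarrow> complex"
  assumes "\<And>n. norm (a n) \<le> C * ln (real n + 2)" "Re s > 1"
  shows "summable (\<lambda>n. norm (a n * of_nat n powr (-s)))"
proof (rule summable_comparison_test_bigo)
  define e where "e = (Re s - 1) / 2"
  have e: "e > 0" "Re s = 1 + 2 * e" using assms(2) by (auto simp: e_def field_simps)
  show "summable (\<lambda>n. norm (real n powr (- 1 - e)))" using e by (simp add: summable_real_powr_iff)
  have "(\<lambda>n. norm (a n * of_nat n powr (-s))) \<in> O(\<lambda>n. C * ln (real n + 2) * real n powr (- Re s))"
    by (intro landau_o.big_mono always_eventually)
       (auto simp: norm_mult norm_of_nat_powr_minus intro!: order_trans[OF _ abs_ge_self] mult_right_mono assms(1))
  also have "(\<lambda>n. C * ln (real n + 2) * real n powr (- Re s)) \<in> O(\<lambda>n. real n powr (- 1 - e))"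
    unfolding e(2) using e(1) by real_asymp
  finally show "(\<lambda>n. norm (a n * of_nat n powr (-s))) \<in> O(\<lambda>n. real n powr (- 1 - e))" .
qed

section \<open>Divisor sums\<close>

text \<open>The factors are recovered from the product as its gcd with \<open>a\<close> and with
  \<open>b\<close>.\<close>

lemma bij_betw_divisors_coprime:
  fixes a b :: nat
  assumes "coprime a b"
  shows "bij_betw (\<lambda>(x, y). x * y) ({d. d dvd a} \<times> {d. d dvd b}) {d. d dvd a * b}"
  unfolding bij_betw_def
proof
  have g: "gcd (x * y) a = x" if "x dvd a" "y dvd b" for x y
  proof -
    have "coprime y a" using assms that(2) by (meson coprime_commute coprime_divisors dvd_refl)
    then have "gcd (x * y) a = gcd x a" by (simp add: gcd_mult_right_right_cancel gcd.commute coprime_commute)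
    then show ?thesis using that(1) by (simp add: gcd_nat.absorb1)
  qed
  have g': "gcd (x * y) b = y" if "x dvd a" "y dvd b" for x y
  proof -
    have "coprime x b" using assms that(1) by (meson coprime_commute coprime_divisors dvd_refl)
    then have "gcd (x * y) b = gcd y b" by (simp add: gcd_mult_right_left_cancel gcd.commute coprime_commute)
    then show ?thesis using that(2) by (simp add: gcd_nat.absorb1)
  qed
  show "inj_on (\<lambda>(x, y). x * y) ({d. d dvd a} \<times> {d. d dvd b})"
    by (rule inj_onI) (clarsimp, metis g g')
  show "(\<lambda>(x, y). x * y) ` ({d. d dvd a} \<times> {d. d dvd b}) = {d. d dvd a * b}"
  proof (intro equalityI subsetI)
    fix d assume "d \<in> {d. d dvd a * b}"
    then obtain x y where "d = x * y" "x dvd a" "y dvd b" using division_decomp[of d a b] by auto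
    then show "d \<in> (\<lambda>(x, y). x * y) ` ({d. d dvd a} \<times> {d. d dvd b})" by force
  qed (auto intro: mult_dvd_mono)
qed

lemma sum_divisors_coprime:
  fixes f :: "nat \<Rightarrow> 'a :: comm_monoid_add"
  assumes "coprime a b"
  shows "(\<Sum>d | d dvd a * b. f d) = (\<Sum>x | x dvd a. \<Sum>y | y dvd b. f (x * y))"
proof -
  have "(\<Sum>d | d dvd a * b. f d) = (\<Sum>(x, y)\<in>{d. d dvd a} \<times> {d. d dvd b}. f (x * y))"
    by (subst sum.reindex_bij_betw[OF bij_betw_divisors_coprime[OF assms], symmetric]) (auto simp: case_prod_unfold)
  then show ?thesis by (simp add: sum.cartesian_product)
qed

lemma divisors_prime_power:
  fixes p :: nat
  assumes "prime p"
  shows "{d. d dvd p ^ a} = (\<lambda>i. p ^ i) ` {..a}" "inj_on (\<lambda>i. p ^ i) {..a}"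
  using assms prime_gt_1_nat[OF assms]
  by (auto simp: divides_primepow_nat inj_on_def)

lemma sum_divisors_prime_power:
  fixes p :: nat and f :: "nat \<Rightarrow> 'a :: comm_monoid_add"
  assumes "prime p"
  shows "(\<Sum>d | d dvd p ^ a. f d) = (\<Sum>i\<le>a. f (p ^ i))"
  unfolding divisors_prime_power(1)[OF assms]
  by (subst sum.reindex[OF divisors_prime_power(2)[OF assms]]) simp

text \<open>The induction step for multiplicative divisor sums: splitting off the full power of one
  prime leaves a smaller, coprime cofactor.\<close>

lemma nat_prime_power_decompose:
  fixes n :: nat
  assumes "n > 1"
  obtains p a m where "prime p" "a > 0" "n = p ^ a * m" "coprime (p ^ a) m" "m > 0" "m < n"
proof -
  obtain p where p: "prime p" "p dvd n" using assms prime_factor_nat[of n] by auto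
  define a where "a = multiplicity p n"
  have n0: "n \<noteq> 0" "\<not>is_unit p" using assms p by auto
  obtain m where m: "n = p ^ a * m" "\<not>p dvd m"
    using multiplicity_decompose'[OF n0] unfolding a_def by metis
  have a: "a > 0" unfolding a_def using p n0 by (simp add: prime_multiplicity_gt_zero_iff)
  have m0: "m > 0" using m by (auto intro: Nat.gr0I)
  moreover have "p ^ a > 1" using one_less_power[OF prime_gt_1_nat[OF p(1)] a] .
  then have "m < n" using m m0 by simp
  moreover have "coprime (p ^ a) m" using m(2) p(1) by (simp add: prime_imp_coprime)
  ultimately show ?thesis using that[of p a m] p a m by blast
qed

section \<open>The Moebius function\<close>

lemma mu_1 [simp]: "mu 1 = 1" "mu (Suc 0) = 1"
  by (simp_all add: mu_def)

lemma abs_mu_le: "\<bar>mu n\<bar> \<le> 1"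
  by (simp add: mu_def power_abs)

lemma mu_mult_coprime:
  assumes "coprime a b"
  shows "mu (a * b) = mu a * mu b"
proof (cases "squarefree a \<and> squarefree b")
  case True
  then have nz: "a \<noteq> 0" "b \<noteq> 0" by (metis not_squarefree_0)+
  have "prime_factors a \<inter> prime_factors b = {}"
    using assms by (auto simp: in_prime_factors_iff dest: coprime_common_divisor)
  then have "card (prime_factors (a * b)) = card (prime_factors a) + card (prime_factors b)"
    using nz by (simp add: prime_factors_product card_Un_disjoint)
  then show ?thesis using True assms by (simp add: mu_def squarefree_mult_coprime power_add)
next
  case False
  then have "\<not>squarefree (a * b)" by (meson dvd_triv_left dvd_triv_right squarefree_mono)
  then show ?thesis using False by (auto simp: mu_def)
qed

lemma mu_prime_power: "prime p \<Longrightarrow> mu (p ^ i) = (if i = 0 then 1 else if i = 1 then -1 else 0)"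
  by (auto simp: mu_def squarefree_power_iff prime_factorization_prime_power squarefree_prime
      prime_prime_factors)

lemma sum_mu_divisors:
  assumes "n > 0"
  shows "(\<Sum>d | d dvd n. mu d) = of_bool (n = 1)"
proof (cases "n = 1")
  case False
  then obtain p a m where *: "prime p" "a > 0" "n = p ^ a * m" "coprime (p ^ a) m"
    using nat_prime_power_decompose[of n] assms by (metis less_one linorder_neqE_nat not_less_zero)
  have "(\<Sum>d | d dvd p ^ a. mu d) = (\<Sum>i\<le>a. if i = 0 then 1 else if i = 1 then -1 else 0)"
    using *(1) by (simp add: sum_divisors_prime_power mu_prime_power)
  also have "\<dots> = (\<Sum>i\<in>{0,1::nat}. if i = 0 then 1 else if i = 1 then -1 else 0)"
    by (intro sum.mono_neutral_right) (use *(2) in auto)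
  finally have 0: "(\<Sum>d | d dvd p ^ a. mu d) = 0" by simp
  have cop: "coprime x y" if "x dvd p ^ a" "y dvd m" for x y
    using *(4) that by (meson coprime_divisors)
  have "(\<Sum>d | d dvd n. mu d) = (\<Sum>x | x dvd p ^ a. \<Sum>y | y dvd m. mu x * mu y)"
    unfolding *(3) sum_divisors_coprime[OF *(4)] by (intro sum.cong refl) (auto simp: mu_mult_coprime cop)
  also have "\<dots> = (\<Sum>x | x dvd p ^ a. mu x) * (\<Sum>y | y dvd m. mu y)"
    by (simp add: sum_product)
  finally show ?thesis using 0 False by simp
qed simp

text \<open>Both sides are multiplicative; on a prime power only the divisors 1 and p contribute,
  giving 1 - 1 / p.\<close>

lemma sum_mu_over_divisors_eq_totient:
  assumes "n > 0"
  shows "(\<Sum>d | d dvd n. real_of_int (mu d) / real d) = real (totient n) / real n"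
  using assms
proof (induction n rule: less_induct)
  case (less n)
  show ?case
  proof (cases "n = 1")
    case False
    then obtain p a m where *: "prime p" "a > 0" "n = p ^ a * m" "coprime (p ^ a) m" "m > 0" "m < n"
      using nat_prime_power_decompose[of n] less.prems by (metis less_one linorder_neqE_nat not_less_zero)
    have p: "p > 0" using *(1) prime_gt_0_nat by blast
    let ?f = "\<lambda>d. real_of_int (mu d) / real d"
    have "(\<Sum>d | d dvd p ^ a. ?f d) = (\<Sum>i\<le>a. if i = 0 then 1 else if i = 1 then -1/p else 0)"
      using *(1) by (subst sum_divisors_prime_power) (auto simp: mu_prime_power intro!: sum.cong)
    also have "\<dots> = (\<Sum>i\<in>{0,1::nat}. if i = 0 then 1 else if i = 1 then -1/p else 0)"
      by (intro sum.mono_neutral_right) (use *(2) in auto)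
    also have "\<dots> = real (totient (p ^ a)) / real (p ^ a)"
    proof -
      obtain b where b: "a = Suc b" using *(2) by (cases a) auto
      have "totient (p ^ a) = p ^ b * (p - 1)" using totient_prime_power_Suc[OF *(1), of b] unfolding b by simp
      then show ?thesis using p unfolding b by (simp add: field_simps of_nat_diff)
    qed
    finally have 1: "(\<Sum>d | d dvd p ^ a. ?f d) = real (totient (p ^ a)) / real (p ^ a)" .
    have cop: "coprime x y" if "x dvd p ^ a" "y dvd m" for x y
      using *(4) that by (meson coprime_divisors)
    have "(\<Sum>d | d dvd n. ?f d) = (\<Sum>x | x dvd p ^ a. \<Sum>y | y dvd m. ?f x * ?f y)"
      unfolding *(3) sum_divisors_coprime[OF *(4)] by (intro sum.cong refl) (auto simp: mu_mult_coprime cop)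
    also have "\<dots> = (\<Sum>x | x dvd p ^ a. ?f x) * (\<Sum>y | y dvd m. ?f y)"
      by (simp add: sum_product)
    also have "\<dots> = real (totient n) / real n"
      unfolding 1 less.IH[OF *(6,5)] *(3) totient_mult_coprime[OF *(4)] by simp
    finally show ?thesis .
  qed simp
qed

section \<open>Dirichlet products and logarithmic derivatives\<close>

text \<open>An unconditionally convergent double series may be regrouped along the hyperbolas d e =
  n. Both Dirichlet products and Lambert series rest on this.\<close>

lemma has_sum_divisors:
  fixes f :: "nat \<Rightarrow> nat \<Rightarrow> 'a :: {real_normed_field, banach}"
  assumes "((\<lambda>(d, e). f d e) has_sum S) ({1..} \<times> {1..})"
  shows "((\<lambda>n. \<Sum>d | d dvd n. f d (n div d)) has_sum S) {1..}"
proof -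
  have "((\<lambda>(n, d). f d (n div d)) has_sum S) (Sigma {1..} (\<lambda>n. {d. d dvd n}))"
    using assms
    by (rule iffD1[OF has_sum_reindex_bij_witness[where i = "\<lambda>(n, d). (d, n div d)" and j = "\<lambda>(d, e). (d * e, d)"], rotated -1])
       (auto simp: Suc_le_eq intro!: Nat.gr0I elim!: dvdE)
  then show ?thesis
    by (rule has_sum_SigmaD) (auto intro!: has_sum_finite simp: Suc_le_eq)
qed

lemma abs_summable_on_product:
  fixes f g :: "nat \<Rightarrow> 'a :: {real_normed_field, banach}"
  assumes "(\<lambda>x. norm (f x)) summable_on A" "(\<lambda>x. norm (g x)) summable_on B"
  shows "(\<lambda>z. norm (case z of (x, y) \<Rightarrow> f x * g y)) summable_on A \<times> B"
proof -
  define c where "c = (\<Sum>\<^sub>\<infinity>y\<in>B. norm (g y))"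
  have "c \<ge> 0" unfolding c_def by (rule infsum_nonneg) simp
  moreover have "(\<Sum>\<^sub>\<infinity>y\<in>B. norm (f x * g y)) = norm (f x) * c" for x
    unfolding c_def norm_mult by (rule infsum_cmult_right')
  moreover have "(\<lambda>y. norm (f x * g y)) summable_on B" for x
    unfolding norm_mult by (rule summable_on_cmult_right[OF assms(2)])
  moreover have "(\<lambda>x. norm (f x) * c) summable_on A"
    by (rule summable_on_cmult_left[OF assms(1)])
  ultimately show ?thesis
    unfolding Infinite_Sum.abs_summable_on_Sigma_iff by simp
qed

lemma dirichlet_product:
  fixes a b :: "nat \<Rightarrow> complex"
  assumes a: "summable (\<lambda>n. norm (a n * of_nat n powr (-s)))" "(\<lambda>n. a n * of_nat n powr (-s)) sums F"
    and b: "summable (\<lambda>n. norm (b n * of_nat n powr (-s)))" "(\<lambda>n. b n * of_nat n powr (-s)) sums G"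
  shows "(\<lambda>n. (\<Sum>d | d dvd n. a d * b (n div d)) * of_nat n powr (-s)) sums (F * G)"
proof -
  let ?f = "\<lambda>n. a n * of_nat n powr (-s)" and ?g = "\<lambda>n. b n * of_nat n powr (-s)"
  have F: "(?f has_sum F) {1..}" and G: "(?g has_sum G) {1..}"
    using norm_summable_imp_has_sum[OF a] norm_summable_imp_has_sum[OF b]
    by (auto elim!: has_sum_cong_neutral[THEN iffD1, rotated -1] simp: Suc_le_eq)
  have af: "(\<lambda>n. norm (?f n)) summable_on {1..}" and ag: "(\<lambda>n. norm (?g n)) summable_on {1..}"
    using norm_summable_imp_summable_on[of "\<lambda>n. norm (?f n)"] norm_summable_imp_summable_on[of "\<lambda>n. norm (?g n)"] a(1) b(1)
    by (auto intro: summable_on_subset_banach)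
  have "(\<lambda>(d, e). ?f d * ?g e) summable_on {1..} \<times> {1..}"
    using abs_summable_on_product[OF af ag] by (rule abs_summable_summable)
  then obtain S where S: "((\<lambda>(d, e). ?f d * ?g e) has_sum S) ({1..} \<times> {1..})"
    by (auto simp: summable_on_def)
  have "((\<lambda>d. ?f d * G) has_sum S) {1..}"
    by (rule has_sum_SigmaD[OF S]) (use has_sum_cmult_right[OF G] in auto)
  moreover have "((\<lambda>d. ?f d * G) has_sum F * G) {1..}" using F by (rule has_sum_cmult_left)
  ultimately have "S = F * G" by (rule has_sum_unique)
  with has_sum_divisors[OF S]
  have "((\<lambda>n. \<Sum>d | d dvd n. ?f d * ?g (n div d)) has_sum (F * G)) {1..}" by simp
  moreover have "(\<Sum>d | d dvd n. ?f d * ?g (n div d)) = (\<Sum>d | d dvd n. a d * b (n div d)) * of_nat n powr (-s)" if "n \<in> {1..}" for n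
  proof -
    have "?f d * ?g (n div d) = a d * b (n div d) * of_nat n powr (-s)" if d: "d dvd n" for d
    proof -
      obtain e where e: "n = d * e" using d by auto
      then have "d > 0" "e > 0" using \<open>n \<in> {1..}\<close> by (auto intro!: Nat.gr0I)
      moreover from this have "(of_nat (d * e) :: complex) powr (-s) = of_nat d powr (-s) * of_nat e powr (-s)"
        unfolding of_nat_powr_minus[OF \<open>d > 0\<close>] of_nat_powr_minus[OF \<open>e > 0\<close>]
        by (subst of_nat_powr_minus) (auto simp: ln_mult algebra_simps exp_diff exp_minus exp_add field_simps)
      ultimately show ?thesis unfolding e by simp
    qed
    then show ?thesis unfolding sum_distrib_right by (intro sum.cong refl) simp
  qed
  ultimately have "((\<lambda>n. (\<Sum>d | d dvd n. a d * b (n div d)) * of_nat n powr (-s)) has_sum (F * G)) {1..}"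
    by (rule has_sum_cong[THEN iffD1, rotated])
  then have "((\<lambda>n. (\<Sum>d | d dvd n. a d * b (n div d)) * of_nat n powr (-s)) has_sum (F * G)) UNIV"
    by (rule has_sum_cong_neutral[THEN iffD1, rotated -1]) (auto simp: Suc_le_eq)
  then show ?thesis by (rule has_sum_imp_sums)
qed

lemma dirichlet_derivative:
  fixes a :: "nat \<Rightarrow> complex"
  assumes a: "\<And>n. norm (a n) \<le> 1"
  shows "\<exists>L. (\<forall>s. Re s > 1 \<longrightarrow> (\<lambda>n. a n * of_nat n powr (-s)) sums L s) \<and>
    (\<forall>s. Re s > 1 \<longrightarrow> (\<lambda>n. a n * of_real (ln (real n)) * of_nat n powr (-s)) sums (- deriv L s)) \<and>
    L holomorphic_on {s. Re s > 1}"
proof -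
  let ?S = "{s::complex. Re s > 1}"
  have S: "open ?S" by (simp add: open_halfspace_Re_gt)
  have "\<exists>g g'. \<forall>x\<in>?S. (\<lambda>n. a n * of_nat n powr (-x)) sums g x \<and>
      (\<lambda>n. - (a n * of_real (ln (real n)) * of_nat n powr (-x))) sums g' x \<and> (g has_field_derivative g' x) (at x)"
  proof (rule series_and_derivative_comparison_local[OF S])
    show "((\<lambda>x. a n * of_nat n powr (-x)) has_field_derivative - (a n * of_real (ln (real n)) * of_nat n powr (-x))) (at x)" for n x
    proof (cases "n = 0")
      case False
      then have "n > 0" by simp
      then show ?thesis unfolding of_nat_powr_minus[OF \<open>n > 0\<close>]
        by (auto intro!: derivative_eq_intros)
    qed simp
    fix x assume x: "x \<in> ?S"
    define e where "e = (Re x - 1) / 2"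
    have e: "e > 0" using x by (simp add: e_def)
    have "norm (a n * of_nat n powr (-y)) \<le> real n powr (- 1 - e)" if y: "y \<in> ball x e" for n y
    proof (cases "n = 0")
      case False
      have "\<bar>Re x - Re y\<bar> \<le> dist x y" unfolding dist_norm by (metis abs_Re_le_cmod minus_complex.simps(1))
      then have "Re y \<ge> 1 + e" using y by (simp add: e_def field_simps)
      have "norm (a n * of_nat n powr (-y)) \<le> 1 * real n powr (- Re y)"
        unfolding norm_mult norm_of_nat_powr_minus by (intro mult_right_mono a) auto
      also have "\<dots> \<le> real n powr (- 1 - e)"
        using False \<open>Re y \<ge> 1 + e\<close> by (auto intro!: powr_mono)
      finally show ?thesis .
    qed simp
    then show "\<exists>d h. 0 < d \<and> summable h \<and> (\<forall>\<^sub>F n in sequentially. \<forall>y\<in>ball x d \<inter> ?S. norm (a n * of_nat n powr (-y)) \<le> h n)"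
      using e by (intro exI[of _ e] exI[of _ "\<lambda>n. real n powr (- 1 - e)"]) (auto simp: summable_real_powr_iff)
  qed
  then obtain g g' where g: "\<And>x. x \<in> ?S \<Longrightarrow> (\<lambda>n. a n * of_nat n powr (-x)) sums g x"
      "\<And>x. x \<in> ?S \<Longrightarrow> (\<lambda>n. - (a n * of_real (ln (real n)) * of_nat n powr (-x))) sums g' x"
      "\<And>x. x \<in> ?S \<Longrightarrow> (g has_field_derivative g' x) (at x)" by blast
  have d: "deriv g x = g' x" if "x \<in> ?S" for x using g(3)[OF that] by (rule DERIV_imp_deriv)
  show ?thesis
  proof (intro exI[of _ g] conjI allI impI)
    show "(\<lambda>n. a n * of_nat n powr (-s)) sums g s" if "Re s > 1" for s using g(1) that by simp
    show "(\<lambda>n. a n * of_real (ln (real n)) * of_nat n powr (-s)) sums (- deriv g s)" if "Re s > 1" for s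
      using sums_minus[OF g(2)[of s]] d[of s] that by simp
    show "g holomorphic_on ?S" using g(3) by (auto simp: holomorphic_on_open[OF S])
  qed
qed

text \<open>Complete multiplicativity lets \<xi> n be pulled out of a convolution. Twisted by \<xi>,
  the identity that \<open>mu\<close> convolved with 1 is the unit exhibits an inverse of
  \<open>L\<close>, and the identity that \<open>mangoldt\<close> convolved with 1 is the logarithm
  gives the logarithmic derivative.\<close>

lemma dchar_log_derivative:
  assumes k: "k > 0" and \<xi>: "dchar k \<xi>" and s: "Re s > 1"
    and L: "\<And>s. Re s > 1 \<Longrightarrow> (\<lambda>n. \<xi> n * of_nat n powr (-s)) sums L s"
    and L': "\<And>s. Re s > 1 \<Longrightarrow> (\<lambda>n. \<xi> n * of_real (ln (real n)) * of_nat n powr (-s)) sums (- deriv L s)"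
  shows "L s \<noteq> 0" "(\<lambda>n. \<xi> n * mangoldt n * of_nat n powr (-s)) sums (- (deriv L s / L s))"
    "summable (\<lambda>n. norm (\<xi> n * mangoldt n * of_nat n powr (-s)))"
proof -
  have mult: "\<xi> d * \<xi> (n div d) = \<xi> n" if "d dvd n" for d n
    using dchar_mult[OF \<xi>, of d "n div d"] that by simp
  have 2: "norm (\<xi> n) \<le> 1" for n using norm_dchar_le[OF \<xi> k] .
  \<comment> \<open>Bounded coefficients fit the bound C ln (n + 2) with C = 1 / ln 2, since ln 2 is
    its smallest value.\<close>
  have ln2: "ln 2 \<le> ln (real n + 2)" for n by simp
  have ln2': "(1::real) \<le> 1 / ln 2 * ln (real n + 2)" for n
    using ln2[of n] by (simp add: field_simps)
  have sm: "summable (\<lambda>n. norm (\<xi> n * of_nat n powr (-s)))"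
    by (rule summable_dirichlet[of _ "1 / ln 2"]) (use 2 ln2' s order_trans in blast)+
  have smu: "summable (\<lambda>n. norm (\<xi> n * of_int (mu n) * of_nat n powr (-s)))"
  proof (rule summable_dirichlet[of _ "1 / ln 2"])
    fix n
    have "norm (\<xi> n * of_int (mu n)) \<le> 1 * 1"
      unfolding norm_mult using 2 abs_mu_le[of n]
      by (intro mult_mono) (auto simp: of_int_abs[symmetric] simp del: of_int_abs)
    then show "norm (\<xi> n * of_int (mu n)) \<le> 1 / ln 2 * ln (real n + 2)"
      using ln2'[of n] unfolding mult_1 by (rule order_trans)
  qed (use s in auto)
  have "(\<lambda>n. (\<Sum>d | d dvd n. (\<xi> d * of_int (mu d)) * \<xi> (n div d)) * of_nat n powr (-s))
     sums ((\<Sum>n. \<xi> n * of_int (mu n) * of_nat n powr (-s)) * L s)"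
    by (rule dirichlet_product[OF smu summable_sums[OF summable_norm_cancel[OF smu]] sm L[OF s]])
  moreover have "(\<Sum>d | d dvd n. (\<xi> d * of_int (mu d)) * \<xi> (n div d)) * of_nat n powr (-s) = (if n = 1 then 1 else 0)" for n
  proof (cases "n = 0")
    case False
    have "(\<Sum>d | d dvd n. (\<xi> d * of_int (mu d)) * \<xi> (n div d)) = (\<Sum>d | d dvd n. \<xi> n * of_int (mu d))"
      using mult by (intro sum.cong) (auto simp: mult_ac)
    also have "\<dots> = \<xi> n * of_int (\<Sum>d | d dvd n. mu d)" by (simp add: sum_distrib_left)
    also have "\<dots> = \<xi> n * of_bool (n = 1)" using False by (subst sum_mu_divisors) auto
    finally show ?thesis using dchar_1[OF \<xi>] by auto
  qed simp
  moreover have "(\<lambda>n::nat. if n = 1 then 1 else 0 :: complex) sums 1"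
    using sums_single[of 1 "\<lambda>_. 1::complex"] by simp
  ultimately have "(\<Sum>n. \<xi> n * of_int (mu n) * of_nat n powr (-s)) * L s = 1"
    by (simp add: sums_unique2)
  then show L0: "L s \<noteq> 0" by auto
  show sL: "summable (\<lambda>n. norm (\<xi> n * mangoldt n * of_nat n powr (-s)))"
  proof (rule summable_dirichlet[of _ 1])
    fix n
    have "norm (\<xi> n * mangoldt n) \<le> 1 * mangoldt n"
      unfolding norm_mult using 2 by (intro mult_mono) (auto simp: mangoldt_nonneg)
    also have "\<dots> \<le> ln (real n + 2)"
    proof (cases "n = 0")
      case False
      then have "mangoldt n \<le> ln (real n)" by (intro mangoldt_le) auto
      also have "\<dots> \<le> ln (real n + 2)" using False by simp
      finally show ?thesis by simp
    qed simp
    finally show "norm (\<xi> n * mangoldt n) \<le> 1 * ln (real n + 2)" by simp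
  qed (use s in auto)
  have "(\<lambda>n. (\<Sum>d | d dvd n. (\<xi> d * mangoldt d) * \<xi> (n div d)) * of_nat n powr (-s))
     sums ((\<Sum>n. \<xi> n * mangoldt n * of_nat n powr (-s)) * L s)"
    by (rule dirichlet_product[OF sL summable_sums[OF summable_norm_cancel[OF sL]] sm L[OF s]])
  moreover have "(\<Sum>d | d dvd n. (\<xi> d * mangoldt d) * \<xi> (n div d)) * of_nat n powr (-s) = \<xi> n * of_real (ln (real n)) * of_nat n powr (-s)" for n
  proof (cases "n = 0")
    case False
    have "(\<Sum>d | d dvd n. (\<xi> d * mangoldt d) * \<xi> (n div d)) = (\<Sum>d | d dvd n. \<xi> n * mangoldt d)"
      using mult by (intro sum.cong) (auto simp: mult_ac)
    also have "\<dots> = \<xi> n * (\<Sum>d | d dvd n. mangoldt d)" by (simp add: sum_distrib_left)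
    also have "\<dots> = \<xi> n * of_real (ln (real n))" using False by (subst mangoldt_sum) auto
    finally show ?thesis by simp
  qed simp
  ultimately have "(\<Sum>n. \<xi> n * mangoldt n * of_nat n powr (-s)) * L s = - deriv L s"
    using L'[OF s] by (simp add: sums_unique2)
  then have "(\<Sum>n. \<xi> n * mangoldt n * of_nat n powr (-s)) = - (deriv L s / L s)"
    using L0 by (simp add: field_simps)
  then show "(\<lambda>n. \<xi> n * mangoldt n * of_nat n powr (-s)) sums (- (deriv L s / L s))"
    using summable_sums[OF summable_norm_cancel[OF sL]] by simp
qed

text \<open>\<open>K\<close> is \<open>(s - 1) * L(s)\<close> for the principal character and \<open>L(s)\<close> for the others.\<close>
definition continues_L :: "nat \<Rightarrow> (nat \<Rightarrow> complex) \<Rightarrow> (complex \<Rightarrow> complex) \<Rightarrow> bool" where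
  "continues_L k \<xi> K \<longleftrightarrow> K holomorphic_on {s. Re s > 0} \<and> (\<forall>s. Re s > 1 \<longrightarrow> K s \<noteq> 0) \<and>
    (\<forall>s. Re s > 1 \<longrightarrow> (\<lambda>n. \<xi> n * mangoldt n * of_nat n powr (-s)) sums
        (of_bool (\<xi> = principal k) / (s - 1) - deriv K s / K s)) \<and>
    (\<xi> = principal k \<longrightarrow> K 1 \<noteq> 0) \<and>
    (\<xi> \<noteq> principal k \<longrightarrow>
       (\<lambda>n. (\<Sum>m\<in>{1..Suc n}. \<xi> m) * (1 / of_nat (n + 1) - 1 / of_nat (n + 2))) sums K 1)"

text \<open>Partial sums of \<xi> are c N + O(1), so the slice series \<open>H\<close> converges for
  Re s > 0, and s H(s) + c s / (s - 1) continues the L-series. The mean \<open>c\<close> is nonzero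
  exactly for the principal character.\<close>

lemma exists_continues_L:
  assumes k: "k > 0" and \<xi>: "dchar k \<xi>"
  shows "\<exists>K. continues_L k \<xi> K"
proof -
  define c where "c = (\<Sum>n<k. \<xi> n) / of_nat k"
  define A where "A = (\<lambda>N. \<Sum>n\<in>{1..N}. \<xi> n)"
  obtain B where B: "\<And>N. norm (A N - c * of_nat N) \<le> B"
    using periodic_sums_bounded[OF k, of \<xi>] dchar_periodic[OF \<xi>] unfolding A_def c_def by blast
  have "norm (A (Suc n) - c * of_real t) \<le> B + norm c" if "real n + 1 \<le> t" "t \<le> real n + 2" for n t
  proof -
    have "A (Suc n) - c * of_real t = (A (Suc n) - c * of_nat (Suc n)) - c * of_real (t - real (Suc n))"
      by (simp add: algebra_simps)
    also have "norm \<dots> \<le> norm (A (Suc n) - c * of_nat (Suc n)) + norm (c * of_real (t - real (Suc n)))"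
      by (rule norm_triangle_ineq4)
    also have "norm (c * of_real (t - real (Suc n))) = norm c * \<bar>t - real (Suc n)\<bar>"
      by (simp add: norm_mult del: of_real_diff)
    also have "\<dots> \<le> norm c * 1"
      using that by (intro mult_left_mono) auto
    finally show ?thesis using B[of "Suc n"] by simp
  qed
  then obtain H where H: "H holomorphic_on {s. Re s > 0}" "\<And>s. Re s > 0 \<Longrightarrow> (\<lambda>n. slice_int A c n s) sums H s"
    using slice_series_holomorphic[of A c] by blast
  have n1: "norm (\<xi> n) \<le> 1" for n using norm_dchar_le[OF \<xi> k] .
  obtain L where "\<forall>s. Re s > 1 \<longrightarrow> (\<lambda>n. \<xi> n * of_nat n powr (-s)) sums L s"
    "\<forall>s. Re s > 1 \<longrightarrow> (\<lambda>n. \<xi> n * of_real (ln (real n)) * of_nat n powr (-s)) sums (- deriv L s)"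
    "L holomorphic_on {s. Re s > 1}"
    using dirichlet_derivative[of \<xi>, OF n1] by (elim exE conjE)
  then have L: "\<And>s. Re s > 1 \<Longrightarrow> (\<lambda>n. \<xi> n * of_nat n powr (-s)) sums L s"
    "\<And>s. Re s > 1 \<Longrightarrow> (\<lambda>n. \<xi> n * of_real (ln (real n)) * of_nat n powr (-s)) sums (- deriv L s)"
    "L holomorphic_on {s. Re s > 1}"
    by simp_all
  have LH: "L s = s * H s + c * s / (s - 1)" if s: "Re s > 1" for s
  proof -
    have "norm (A N) \<le> 1 * (real N + 1)" for N
    proof -
      have "norm (A N) \<le> (\<Sum>n\<in>{1..N}. 1)" unfolding A_def by (intro order_trans[OF norm_sum] sum_mono n1)
      then show ?thesis by simp
    qed
    then have "norm (\<Sum>n\<in>{1..N}. \<xi> n) \<le> 1 * (real N + 1)" for N unfolding A_def .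
    from sums_slice_int[OF s L(1)[OF s] this]
    have "(\<lambda>n. s * slice_int A c n s) sums (L s - c * s / (s - 1))" unfolding A_def .
    moreover have "(\<lambda>n. s * slice_int A c n s) sums (s * H s)"
      using H(2)[of s] s by (intro sums_mult) auto
    ultimately have "s * H s = L s - c * s / (s - 1)" by (rule sums_unique2[symmetric])
    then show ?thesis by simp
  qed
  have ce: "c \<noteq> 0 \<longleftrightarrow> \<xi> = principal k"
    using sum_nonprincipal_eq_0[OF k \<xi>] sum_principal[OF k] k by (auto simp: c_def)
  define e :: nat where "e = of_bool (\<xi> = principal k)"
  \<comment> \<open>One formula for both cases: with e = 1 the factor s - 1 removes the pole and
    leaves K 1 = c, with e = 0 the term c s is 0.\<close>
  define K where "K = (\<lambda>s. (s - 1) ^ e * s * H s + c * s)"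
  have KL: "K s = (s - 1) ^ e * L s" if "Re s > 1" for s
  proof (cases "\<xi> = principal k")
    case True
    have "s - 1 \<noteq> 0" using that by auto
    then have "(s - 1) * (s * H s + c * s / (s - 1)) = (s - 1) * s * H s + c * s" by (simp add: field_simps)
    then show ?thesis using True LH[OF that] by (simp add: K_def e_def)
  next
    case False
    then show ?thesis using ce LH[OF that] by (simp add: K_def e_def)
  qed
  have K1: "\<xi> = principal k \<Longrightarrow> K 1 \<noteq> 0" using ce by (simp add: K_def e_def)
  have K1': "(\<lambda>n. A (Suc n) * (1 / of_nat (n + 1) - 1 / of_nat (n + 2))) sums K 1" if "\<xi> \<noteq> principal k"
  proof -
    have c: "c = 0" using ce that by blast
    have "slice_int A c n 1 = A (Suc n) * (1 / of_nat (n + 1) - 1 / of_nat (n + 2))" for n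
      using slice_int_eq[of 1 c A n] c by (simp add: powr_minus field_simps del: of_nat_Suc of_nat_add)
    then show ?thesis using H(2)[of 1] that c by (simp add: K_def e_def)
  qed
  have K: "K holomorphic_on {s. Re s > 0}"
    unfolding K_def by (intro holomorphic_intros H)
  have dK: "deriv K s / K s = of_nat e / (s - 1) + deriv L s / L s" if s: "Re s > 1" for s
  proof -
    have s1: "s - 1 \<noteq> 0" using s by auto
    have L0: "L s \<noteq> 0" using dchar_log_derivative(1)[OF k \<xi> s L(1,2)] .
    have S: "open {s::complex. Re s > 1}" by (simp add: open_halfspace_Re_gt)
    have "(L has_field_derivative deriv L s) (at s)" using L(3) S s holomorphic_derivI by blast
    then have "((\<lambda>s. (s - 1) ^ e * L s) has_field_derivative (of_nat e * (s - 1) ^ (e - 1) * L s + deriv L s * (s - 1) ^ e)) (at s)"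
      by (auto intro!: derivative_eq_intros)
    then have "(K has_field_derivative (of_nat e * (s - 1) ^ (e - 1) * L s + deriv L s * (s - 1) ^ e)) (at s)"
      by (rule has_field_derivative_transform_within_open[OF _ S]) (use s KL in auto)
    then have "deriv K s = of_nat e * (s - 1) ^ (e - 1) * L s + deriv L s * (s - 1) ^ e"
      by (rule DERIV_imp_deriv)
    then show ?thesis unfolding KL[OF s] using s1 L0 by (cases "\<xi> = principal k") (simp_all add: e_def field_simps)
  qed
  show ?thesis
    unfolding continues_L_def
  proof (intro exI[of _ K] conjI allI impI)
    show "K s \<noteq> 0" if "Re s > 1" for s
      using KL[OF that] dchar_log_derivative(1)[OF k \<xi> that L(1,2)] that by auto
    show "(\<lambda>n. \<xi> n * mangoldt n * of_nat n powr (-s)) sums (of_bool (\<xi> = principal k) / (s - 1) - deriv K s / K s)"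
      if "Re s > 1" for s
      using dchar_log_derivative(2)[OF k \<xi> that L(1,2)] dK[OF that] by (simp add: e_def)
  qed (use K K1 K1' in \<open>auto simp: A_def\<close>)
qed

text \<open>At a zero of order m the logarithmic derivative is m / (w - z) plus a function
  continuous at z, so multiplication by the distance e to the line extracts m. Nonvanishing to the
  right of the line rules out that \<open>K\<close> is identically 0.\<close>

lemma log_derivative_order:
  assumes K: "K holomorphic_on {s. Re s > 0}" and nz: "\<And>s. Re s > 1 \<Longrightarrow> K s \<noteq> 0" and z: "Re z = 1"
  obtains m :: nat where "m = 0 \<longleftrightarrow> K z \<noteq> 0"
    "((\<lambda>e. of_real e * (deriv K (z + of_real e) / K (z + of_real e))) \<longlongrightarrow> of_nat m) (at_right 0)"
proof -
  let ?S = "{s::complex. Re s > 0}"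
  have S: "open ?S" "connected ?S" by (simp_all add: open_halfspace_Re_gt convex_connected convex_halfspace_Re_gt)
  have key: "((\<lambda>e. of_real e * (deriv K (z + of_real e) / K (z + of_real e))) \<longlongrightarrow> of_nat m) (at_right 0)"
    if r: "r > 0" "ball z r \<subseteq> ?S" and g: "g holomorphic_on ball z r" "\<And>w. w \<in> ball z r \<Longrightarrow> K w = (w - z) ^ m * g w"
      "\<And>w. w \<in> ball z r \<Longrightarrow> g w \<noteq> 0" for r g m
  proof -
    have lim: "((\<lambda>e::real. z + of_real e) \<longlongrightarrow> z) (at_right 0)"
      by (auto intro!: tendsto_eq_intros)
    have "continuous_on (ball z r) (\<lambda>w. deriv g w / g w)"
      by (intro holomorphic_on_imp_continuous_on holomorphic_on_divide holomorphic_deriv g) auto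
    then have "isCont (\<lambda>w. deriv g w / g w) z"
      using r(1) by (simp add: continuous_on_eq_continuous_at)
    have "((\<lambda>e. of_real e * (deriv g (z + of_real e) / g (z + of_real e))) \<longlongrightarrow> of_real 0 * (deriv g z / g z)) (at_right 0)"
      by (rule tendsto_mult[OF tendsto_of_real[OF tendsto_ident_at] isCont_tendsto_compose[OF \<open>isCont _ z\<close> lim]])
    then have "((\<lambda>e. of_nat m + of_real e * (deriv g (z + of_real e) / g (z + of_real e))) \<longlongrightarrow> of_nat m + 0) (at_right 0)"
      by (intro tendsto_add tendsto_const) simp
    then have "((\<lambda>e. of_nat m + of_real e * (deriv g (z + of_real e) / g (z + of_real e))) \<longlongrightarrow> of_nat m) (at_right 0)"
      by simp
    moreover have "eventually (\<lambda>e. e \<in> {0<..<r}) (at_right 0)"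
      using r(1) by (intro eventually_at_right_real) 
    then have "eventually (\<lambda>e. of_nat m + of_real e * (deriv g (z + of_real e) / g (z + of_real e)) =
         of_real e * (deriv K (z + of_real e) / K (z + of_real e))) (at_right 0)"
    proof eventually_elim
      case (elim e)
      let ?w = "z + of_real e"
      have w: "?w \<in> ball z r" using elim by (simp add: dist_norm)
      have "(g has_field_derivative deriv g ?w) (at ?w)" using g(1) w by (meson holomorphic_derivI open_ball)
      then have "((\<lambda>w. (w - z) ^ m * g w) has_field_derivative (of_nat m * (?w - z) ^ (m - 1) * g ?w + deriv g ?w * (?w - z) ^ m)) (at ?w)"
        by (auto intro!: derivative_eq_intros)
      then have "(K has_field_derivative (of_nat m * (?w - z) ^ (m - 1) * g ?w + deriv g ?w * (?w - z) ^ m)) (at ?w)"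
        by (rule has_field_derivative_transform_within_open[OF _ open_ball w]) (use g(2) in auto)
      then have "deriv K ?w = of_nat m * (?w - z) ^ (m - 1) * g ?w + deriv g ?w * (?w - z) ^ m"
        by (rule DERIV_imp_deriv)
      then show ?case using g(2,3)[OF w] elim by (cases m) (auto simp: field_simps)
    qed
    ultimately show ?thesis by (rule Lim_transform_eventually)
  qed
  have zS: "z \<in> ?S" using z by simp
  show ?thesis
  proof (cases "K z = 0")
    case True
    have "\<not>K constant_on ?S"
    proof
      assume "K constant_on ?S"
      then have "K 2 = K z" using zS by (force simp: constant_on_def)
      then show False using True nz[of 2] by simp
    qed
    then obtain g r m where
      *: "0 < m" "0 < r" "ball z r \<subseteq> ?S" "g holomorphic_on ball z r" "\<And>w. w \<in> ball z r \<Longrightarrow> K w = (w - z) ^ m * g w"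
        "\<And>w. w \<in> ball z r \<Longrightarrow> g w \<noteq> 0"
      using holomorphic_factor_zero_nonconstant[OF K S zS True, of thesis] by blast
    show ?thesis
      by (rule that[of m]) (use *(1) True key[of r g m, OF *(2-6)] in auto)
  next
    case False
    have "isCont K z" using K S(1) zS by (meson holomorphic_on_imp_continuous_on continuous_on_eq_continuous_at)
    then obtain r1 where r1: "r1 > 0" "\<And>w. dist z w < r1 \<Longrightarrow> K w \<noteq> 0"
      using continuous_at_avoid[of z K 0] False by auto
    obtain r2 where r2: "r2 > 0" "ball z r2 \<subseteq> ?S" using S(1) zS openE by blast
    show ?thesis
    proof (rule that[of 0])
      have sub: "ball z (min r1 r2) \<subseteq> ?S" using r2(2) by (auto simp: subset_iff)
      show "((\<lambda>e. of_real e * (deriv K (z + of_real e) / K (z + of_real e))) \<longlongrightarrow> of_nat 0) (at_right 0)"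
        by (rule key[of "min r1 r2" K 0, OF _ sub holomorphic_on_subset[OF K sub]]) (use r1 r2 in auto)
    qed (use False in auto)
  qed
qed

section \<open>Nonvanishing for real characters\<close>

text \<open>The arithmetic-geometric mean inequality for 1, y^2, ..., y^(2 n - 2). The induction
  goes in steps of two and peels off the outermost pair, whose sum 1 + q^2 is at least 2 q.\<close>

lemma geometric_lower_bound:
  fixes y :: real
  assumes "y \<ge> 0"
  shows "real n * y ^ (n - 1) \<le> (\<Sum>i<n. (y\<^sup>2) ^ i)"
proof (induction n rule: induct_nat_012)
  case (ge2 n)
  have "(\<Sum>i<Suc (Suc n). (y\<^sup>2) ^ i) = 1 + y\<^sup>2 * (\<Sum>i<n. (y\<^sup>2) ^ i) + (y ^ Suc n)\<^sup>2"
  proof -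
    have "(\<Sum>i<Suc (Suc n). q ^ i) = 1 + q * (\<Sum>i<n. q ^ i) + q ^ Suc n" for q :: real
      by (subst sum.lessThan_Suc_shift) (simp add: sum_distrib_left algebra_simps)
    moreover have "(y\<^sup>2) ^ Suc n = (y ^ Suc n)\<^sup>2"
      by (simp only: power_mult[symmetric] mult.commute)
    ultimately show ?thesis by (simp only:)
  qed
  also have "\<dots> \<ge> 1 + y\<^sup>2 * (real n * y ^ (n - 1)) + (y ^ Suc n)\<^sup>2"
    using ge2(1) by (intro add_mono mult_left_mono order_refl) auto
  also have "y\<^sup>2 * (real n * y ^ (n - 1)) = real n * y ^ Suc n"
    by (cases n) (auto simp: power2_eq_square)
  also have "1 + real n * y ^ Suc n + (y ^ Suc n)\<^sup>2 \<ge> real n * y ^ Suc n + 2 * y ^ Suc n"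
    using zero_le_power2[of "1 - y ^ Suc n"] unfolding power2_diff by simp
  finally show ?case by (simp add: algebra_simps)
qed (use assms in auto)

text \<open>Equivalently, 1 / ((1 - x) n) - v n is nonnegative and decreasing. With 1 - x^n = (1 -
  x) S n, the decrease amounts to n (n + 1) x^n \<le> S n * S (n + 1). The geometric bound at y =
  sqrt x gives n (n + 1) y^(2 n - 1) below the right side, and y \<le> 1.\<close>

lemma lambert_weight_bound:
  fixes x :: real
  assumes x: "0 < x" "x < 1" and n: "n > 0"
  defines "v \<equiv> \<lambda>n. x ^ n / (1 - x ^ n)"
  shows "v n - v (Suc n) \<le> 1 / (1 - x) * (1 / real n - 1 / real (Suc n))" "v n \<le> 1 / (1 - x) * (1 / real n)"
proof -
  define S where "S = (\<lambda>n. \<Sum>i<n. x ^ i)"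
  have S: "1 - x ^ m = (1 - x) * S m" for m
    unfolding S_def by (simp add: one_diff_power_eq)
  define y where "y = sqrt x"
  have y: "y\<^sup>2 = x" "0 \<le> y" "y \<le> 1" using x by (auto simp: y_def)
  have Sb: "real m * y ^ (m - 1) \<le> S m" for m
    using geometric_lower_bound[OF y(2), of m] y(1) by (simp add: S_def)
  have pos: "S m > 0" if "m > 0" for m
    unfolding S_def using x that by (intro sum_pos) auto
  have "real n * real (Suc n) * x ^ n \<le> (real n * y ^ (n - 1)) * (real (Suc n) * y ^ n)"
  proof -
    have "x ^ n = y ^ (n + n)" by (simp add: y(1)[symmetric] power_mult[symmetric] mult_2)
    also have "\<dots> \<le> y ^ (n - 1 + n)" using y by (intro power_decreasing) auto
    finally have "real n * real (Suc n) * x ^ n \<le> real n * real (Suc n) * y ^ (n - 1 + n)"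
      by (intro mult_left_mono) auto
    then show ?thesis by (simp only: power_add mult_ac)
  qed
  also have "\<dots> \<le> S n * S (Suc n)"
    using Sb[of n] Sb[of "Suc n"] y pos[OF n] by (intro mult_mono) (auto intro: less_imp_le)
  finally have key: "real n * real (Suc n) * x ^ n \<le> S n * S (Suc n)" .
  have "v n - v (Suc n) = (x ^ n - x ^ Suc n) / ((1 - x ^ n) * (1 - x ^ Suc n))"
  proof -
    have "x ^ m < 1" if "m > 0" for m using x that by (simp add: power_less_one_iff)
    from this[of n] this[of "Suc n"] show ?thesis using n unfolding v_def
      by (simp add: divide_simps) (simp add: algebra_simps)
  qed
  also have "x ^ n - x ^ Suc n = (1 - x) * x ^ n" by (simp add: algebra_simps)
  also have "(1 - x) * x ^ n / ((1 - x ^ n) * (1 - x ^ Suc n)) = 1 / (1 - x) * (x ^ n / (S n * S (Suc n)))"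
    unfolding S using x by (simp add: divide_simps)
  also have "\<dots> \<le> 1 / (1 - x) * (1 / (real n * real (Suc n)))"
  proof -
    have "x ^ n / (S n * S (Suc n)) \<le> 1 / (real n * real (Suc n))"
    proof -
      have "a / P \<le> 1 / Q" if "Q * a \<le> P" "P > 0" "Q > 0" for a P Q :: real
        using that by (simp add: field_simps)
      from this[OF key] show ?thesis using n pos[OF n] pos[of "Suc n"] by simp
    qed
    then show ?thesis using x by (intro mult_left_mono) auto
  qed
  also have "1 / (real n * real (Suc n)) = 1 / real n - 1 / real (Suc n)"
    using n by (simp add: field_simps)
  finally show "v n - v (Suc n) \<le> 1 / (1 - x) * (1 / real n - 1 / real (Suc n))" .
  have "real n * x ^ n \<le> S n"
  proof -
    have "real n * x ^ n = (\<Sum>i<n. x ^ n)" by simp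
    also have "\<dots> \<le> S n" unfolding S_def using x by (intro sum_mono power_decreasing) auto
    finally show ?thesis .
  qed
  then have "x ^ n / S n \<le> 1 / real n"
    using n pos[OF n] by (simp add: divide_simps mult_ac)
  moreover have "v n = 1 / (1 - x) * (x ^ n / S n)" unfolding v_def S by simp
  ultimately show "v n \<le> 1 / (1 - x) * (1 / real n)"
    using x by (simp only:) (intro mult_left_mono, auto)
qed

text \<open>By multiplicativity only prime powers matter, and there the sum is geometric with ratio
  -1, 0 or 1.\<close>

lemma divisor_sum_nonneg:
  fixes r :: "nat \<Rightarrow> real"
  assumes mult: "\<And>m n. r (m * n) = r m * r n" and vals: "\<And>n. r n \<in> {-1, 0, 1}" and r1: "r 1 = 1" and "n > 0"
  shows "(\<Sum>d | d dvd n. r d) \<ge> 0"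
  using \<open>n > 0\<close>
proof (induction n rule: less_induct)
  case (less n)
  show ?case
  proof (cases "n = 1")
    case False
    then obtain p a m where *: "prime p" "a > 0" "n = p ^ a * m" "coprime (p ^ a) m" "m > 0" "m < n"
      using nat_prime_power_decompose[of n] less.prems by (metis less_one linorder_neqE_nat not_less_zero)
    have pw: "r (p ^ i) = r p ^ i" for i by (induction i) (use r1 in \<open>auto simp: mult\<close>)
    have geo: "(\<Sum>i\<le>a. r p ^ i) \<ge> 0"
    proof -
      have "(\<Sum>i\<le>j. (-1::real) ^ i) = (if even j then 1 else 0)" for j
        by (induction j) auto
      moreover have "r p = -1 \<or> r p \<ge> 0" using vals[of p] by auto
      ultimately show ?thesis by (auto intro: sum_nonneg)
    qed
    have "(\<Sum>d | d dvd n. r d) = (\<Sum>x | x dvd p ^ a. \<Sum>y | y dvd m. r x * r y)"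
      unfolding *(3) sum_divisors_coprime[OF *(4)] by (intro sum.cong refl mult)
    also have "\<dots> = (\<Sum>x | x dvd p ^ a. r x) * (\<Sum>y | y dvd m. r y)"
      by (simp add: sum_product)
    also have "(\<Sum>x | x dvd p ^ a. r x) = (\<Sum>i\<le>a. r p ^ i)"
      by (subst sum_divisors_prime_power[OF *(1)]) (simp only: pw)
    also have "\<dots> * (\<Sum>y | y dvd m. r y) \<ge> 0"
      using geo less.IH[OF *(6,5)] by simp
    finally show ?thesis .
  qed (use r1 in auto)
qed

text \<open>The double series of r d * x^(d e) is summed over e first, which gives x^d / (1 - x^d),
  and then along d e = n. Absolute convergence follows from comparison with x^d / (1 - x).\<close>

lemma lambert_series:
  fixes r :: "nat \<Rightarrow> real"
  assumes x: "0 < x" "x < (1::real)" and r: "\<And>n. \<bar>r n\<bar> \<le> 1"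
  shows "\<exists>S. ((\<lambda>n. (\<Sum>d | d dvd n. r d) * x ^ n) has_sum S) {1..} \<and>
    (\<lambda>n. r (Suc n) * (x ^ Suc n / (1 - x ^ Suc n))) sums S"
proof -
  let ?f = "\<lambda>d e. r d * x ^ (d * e)"
  have xd: "x ^ d < 1" "0 < x ^ d" if "d > 0" for d using x that by (simp_all add: power_less_one_iff)
  have geo: "((\<lambda>e. (x ^ d) ^ e) has_sum (x ^ d / (1 - x ^ d))) {1..}" if d: "d > 0" for d
  proof -
    have "(\<lambda>e. (x ^ d) ^ e) sums (1 / (1 - x ^ d))" using xd[OF d] by (intro geometric_sums) auto
    then have "((\<lambda>e. (x ^ d) ^ e) has_sum (1 / (1 - x ^ d))) UNIV"
      using xd[OF d] by (intro sums_nonneg_imp_has_sum) auto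
    moreover have "((\<lambda>e. (x ^ d) ^ e) has_sum 1) {0}"
      using has_sum_finite[of "{0::nat}" "\<lambda>e. (x ^ d) ^ e"] by simp
    ultimately have "((\<lambda>e. (x ^ d) ^ e) has_sum (1 / (1 - x ^ d) - 1)) (UNIV - {0})"
      by (intro has_sum_Diff) auto
    moreover have "UNIV - {0::nat} = {1..}" by auto
    moreover have "1 / (1 - x ^ d) - 1 = x ^ d / (1 - x ^ d)" using xd[OF d] by (simp add: field_simps)
    ultimately show ?thesis by simp
  qed
  have sm: "(\<lambda>d. x ^ d / (1 - x ^ d)) summable_on {1..}"
  proof -
    have "summable (\<lambda>d. 1 / (1 - x) * x ^ d)" using x by (intro summable_mult summable_geometric) auto
    then have "(\<lambda>d. 1 / (1 - x) * x ^ d) summable_on {1..}"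
      using x by (intro summable_on_subset_banach[OF norm_summable_imp_summable_on]) auto
    then show ?thesis
    proof (rule summable_on_comparison_test)
      fix d :: nat assume "d \<in> {1..}"
      then have d: "d > 0" by auto
      have "x ^ d \<le> x" using x d by (cases d) (auto simp: mult_left_le power_le_one)
      then show "x ^ d / (1 - x ^ d) \<le> 1 / (1 - x) * x ^ d"
        using x xd[OF d] by (simp add: divide_simps)
      show "0 \<le> x ^ d / (1 - x ^ d)" using xd[OF d] by simp
    qed
  qed
  have abs: "(\<lambda>z. norm (case z of (d, e) \<Rightarrow> x ^ (d * e))) summable_on {1..} \<times> {1..}"
    unfolding Infinite_Sum.abs_summable_on_Sigma_iff
  proof (intro conjI ballI)
    fix d :: nat assume "d \<in> {1..}"
    then show "(\<lambda>e. norm (case (d, e) of (d, e) \<Rightarrow> x ^ (d * e))) summable_on {1..}"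
      using geo[of d] x by (auto simp: power_mult summable_on_def)
  next
    have "norm (infsum (\<lambda>e. norm (x ^ (d * e))) {1..}) = x ^ d / (1 - x ^ d)" if "d \<in> {1..}" for d :: nat
    proof -
      have "infsum (\<lambda>e. norm (x ^ (d * e))) {1..} = x ^ d / (1 - x ^ d)"
        using geo[of d] x that by (intro infsumI) (auto simp: power_mult)
      moreover have "x ^ d / (1 - x ^ d) \<ge> 0" using xd[of d] that by (intro divide_nonneg_nonneg) auto
      ultimately show ?thesis by (simp only: real_norm_def abs_of_nonneg)
    qed
    then have "(\<lambda>d. norm (infsum (\<lambda>e. norm (x ^ (d * e))) {1..})) summable_on {1..} \<longleftrightarrow>
       (\<lambda>d. x ^ d / (1 - x ^ d)) summable_on {1..}"
      by (intro summable_on_cong)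
    then show "(\<lambda>d. norm (infsum (\<lambda>e. norm (case (d, e) of (d, e) \<Rightarrow> x ^ (d * e))) {1..})) summable_on {1..}"
      using sm by simp
  qed
  have "(\<lambda>z. norm (case z of (d, e) \<Rightarrow> ?f d e)) summable_on {1..} \<times> {1..}"
    using abs
  proof (rule summable_on_comparison_test)
    fix z :: "nat \<times> nat"
    show "norm (case z of (d, e) \<Rightarrow> ?f d e) \<le> norm (case z of (d, e) \<Rightarrow> x ^ (d * e))"
      using mult_right_mono[OF r[of "fst z"], of "norm (x ^ (fst z * snd z))"]
      by (simp add: case_prod_unfold abs_mult)
  qed auto
  then have "(\<lambda>(d, e). ?f d e) summable_on {1..} \<times> {1..}" by (rule abs_summable_summable)
  then obtain S where S: "((\<lambda>(d, e). ?f d e) has_sum S) ({1..} \<times> {1..})"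
    by (auto simp: summable_on_def)
  have "((\<lambda>n. \<Sum>d | d dvd n. ?f d (n div d)) has_sum S) {1..}"
    by (rule has_sum_divisors[OF S])
  then have "((\<lambda>n. (\<Sum>d | d dvd n. r d) * x ^ n) has_sum S) {1..}"
    by (rule has_sum_cong[THEN iffD1, rotated]) (auto simp: sum_distrib_right intro!: sum.cong)
  moreover have "((\<lambda>d. r d * (x ^ d / (1 - x ^ d))) has_sum S) {1..}"
  proof (rule has_sum_SigmaD[OF S])
    fix d :: nat assume "d \<in> {1..}"
    then show "((\<lambda>e. case (d, e) of (d, e) \<Rightarrow> ?f d e) has_sum r d * (x ^ d / (1 - x ^ d))) {1..}"
      using has_sum_cmult_right[OF geo[of d], of "r d"] by (simp only: power_mult prod.case atLeast_iff Suc_le_eq One_nat_def)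
  qed
  then have "((\<lambda>n. r (Suc n) * (x ^ Suc n / (1 - x ^ Suc n))) has_sum S) UNIV"
    by (rule iffD1[OF has_sum_reindex_bij_witness[where i = Suc and j = "\<lambda>n. n - 1"], rotated -1]) auto
  then have "(\<lambda>n. r (Suc n) * (x ^ Suc n / (1 - x ^ Suc n))) sums S" by (rule has_sum_imp_sums)
  ultimately show ?thesis by (intro exI conjI)
qed

text \<open>Monsky's proof that \<open>L(1)\<close> does not vanish for a real character: compare the Lambert
  series of the character with its value at \<open>x \<rightarrow> 1\<close>.\<close>
lemma monsky:
  fixes r :: "nat \<Rightarrow> real"
  assumes mult: "\<And>m n. r (m * n) = r m * r n" and vals: "\<And>n. r n \<in> {-1, 0, 1}" and r1: "r 1 = 1"
    and p: "prime p" "r p = 0"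
    and B: "\<And>N. \<bar>\<Sum>n\<in>{1..N}. r n\<bar> \<le> B"
    and L: "(\<lambda>n. (\<Sum>m\<in>{1..Suc n}. r m) * (1 / real (n + 1) - 1 / real (n + 2))) sums 0"
  shows False
proof -
  define A where "A = (\<lambda>N. \<Sum>n\<in>{1..N}. r n)"
  define c where "c = (\<lambda>n. \<Sum>d | d dvd n. r d)"
  have r_abs: "\<bar>r n\<bar> \<le> 1" for n using vals[of n] by auto
  have B': "\<bar>A N\<bar> \<le> B" for N unfolding A_def by (rule B)
  have B0: "B \<ge> 0" using B[of 0] by simp
  have main: "(\<Sum>j<J. x ^ (p ^ j)) \<le> B" if x: "0 < x" "x < 1" for x and J :: nat
  proof -
    define v where "v = (\<lambda>n. x ^ n / (1 - x ^ n))"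
    \<comment> \<open>The series of \<open>r\<close> against 1 / ((1 - x) n) is a multiple of L(1) =
      0, so only the correction \<open>b\<close> to the Lambert weight remains, and it is monotone
      in n.\<close>
    define b where "b = (\<lambda>n. 1 / (1 - x) * (1 / real n) - v n)"
    obtain S where S: "((\<lambda>n. c n * x ^ n) has_sum S) {1..}" "(\<lambda>n. r (Suc n) * v (Suc n)) sums S"
      using lambert_series[of x r, OF x r_abs] unfolding c_def v_def by (elim exE conjE)
    have b: "b n \<ge> b (Suc n)" "b n \<ge> 0" if "n > 0" for n
      using lambert_weight_bound[OF x that] unfolding b_def v_def right_diff_distrib by linarith+
    have v0: "v n \<ge> 0" if "n > 0" for n
      unfolding v_def using x that by (auto simp: power_le_one)
    have abel: "(\<Sum>n<M. r (Suc n) * v (Suc n)) = 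
       1 / (1 - x) * (\<Sum>n<M. A (Suc n) * (1 / real (n + 1) - 1 / real (n + 2)))
       - (\<Sum>n<M. A (Suc n) * (b (Suc n) - b (Suc (Suc n)))) + A M * v (Suc M)" for M
    proof (induction M)
      case (Suc M)
      have "A (Suc M) = A M + r (Suc M)" by (simp add: A_def)
      moreover have "v (Suc M) - v (Suc (Suc M)) = 1 / (1 - x) * (1 / real (M + 1) - 1 / real (M + 2)) - (b (Suc M) - b (Suc (Suc M)))"
        by (simp add: b_def right_diff_distrib)
      moreover have "r' * v1 = A1 * D + A1 * v2 - A0 * v1" if "A1 = A0 + r'" "v1 - v2 = D" for A0 A1 r' v1 v2 D :: real
        unfolding that(1) that(2)[symmetric] by (simp add: algebra_simps)
      ultimately have "r (Suc M) * v (Suc M) = A (Suc M) * (1 / (1 - x) * (1 / real (M + 1) - 1 / real (M + 2)) - (b (Suc M) - b (Suc (Suc M))))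
          + A (Suc M) * v (Suc (Suc M)) - A M * v (Suc M)"
        by blast
      then show ?case unfolding sum.lessThan_Suc Suc.IH by (simp add: algebra_simps)
    qed (simp add: A_def)
    have bsum: "\<bar>\<Sum>n<M. A (Suc n) * (b (Suc n) - b (Suc (Suc n)))\<bar> \<le> B" for M
    proof -
      have "\<bar>\<Sum>n<M. A (Suc n) * (b (Suc n) - b (Suc (Suc n)))\<bar> \<le> (\<Sum>n<M. B * (b (Suc n) - b (Suc (Suc n))))"
      proof (intro order_trans[OF sum_abs] sum_mono)
        fix n
        show "\<bar>A (Suc n) * (b (Suc n) - b (Suc (Suc n)))\<bar> \<le> B * (b (Suc n) - b (Suc (Suc n)))"
          using b(1)[of "Suc n"] B'[of "Suc n"] B0 unfolding abs_mult by (intro mult_mono) auto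
      qed
      also have "\<dots> = B * (b 1 - b (Suc M))"
        by (simp only: sum_distrib_left[symmetric]) (simp add: sum_lessThan_telescope'[of "\<lambda>n. b (Suc n)"])
      also have "\<dots> \<le> B * (1 - 0)"
      proof -
        \<comment> \<open>The total variation of \<open>b\<close> is at most b 1 = 1 / (1 - x) - x /
          (1 - x) = 1, so the bound on S does not depend on x.\<close>
        have "b 1 = 1" using x by (simp add: b_def v_def divide_simps)
        then show ?thesis using b(2)[of "Suc M"] B0 by (intro mult_left_mono diff_mono) auto
      qed
      finally show ?thesis by simp
    qed
    have "S \<le> B"
    proof (rule LIMSEQ_le)
      show "(\<lambda>M. \<Sum>n<M. r (Suc n) * v (Suc n)) \<longlonglongrightarrow> S" using S(2) by (simp add: sums_def)
      have "(\<lambda>M. x ^ Suc M / (1 - x ^ Suc M)) \<longlonglongrightarrow> 0 / (1 - 0)"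
        using x by (intro tendsto_intros LIMSEQ_Suc LIMSEQ_realpow_zero) auto
      then have "(\<lambda>M. v (Suc M)) \<longlonglongrightarrow> 0" by (simp add: v_def)
      then have "(\<lambda>M. 1 / (1 - x) * (\<Sum>n<M. A (Suc n) * (1 / real (n + 1) - 1 / real (n + 2))) + B + B * v (Suc M))
         \<longlonglongrightarrow> 1 / (1 - x) * 0 + B + B * 0"
        using L unfolding sums_def A_def by (intro tendsto_intros)
      then show "(\<lambda>M. 1 / (1 - x) * (\<Sum>n<M. A (Suc n) * (1 / real (n + 1) - 1 / real (n + 2))) + B + B * v (Suc M)) \<longlonglongrightarrow> B"
        by simp
      have "A M * v (Suc M) \<le> B * v (Suc M)" for M
        using B'[of M] v0[of "Suc M"] by (intro mult_right_mono) auto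
      then show "\<exists>N. \<forall>M\<ge>N. (\<Sum>n<M. r (Suc n) * v (Suc n)) \<le> 
         1 / (1 - x) * (\<Sum>n<M. A (Suc n) * (1 / real (n + 1) - 1 / real (n + 2))) + B + B * v (Suc M)"
        unfolding abel using bsum by (intro exI[of _ 0] allI impI add_mono) (auto simp: abs_le_iff)
    qed
    moreover have "(\<Sum>j<J. x ^ (p ^ j)) \<le> S"
    proof -
      have pw: "r (p ^ i) = r p ^ i" for i by (induction i) (use r1 in \<open>auto simp: mult\<close>)
      \<comment> \<open>Because \<open>r p = 0\<close>, the divisor sum at every power of
        \<open>p\<close> is 1. This yields J terms with coefficient 1, whose sum tends to J as x
        tends to 1 while the bound stays \<open>B\<close>.\<close>
      have c1: "c (p ^ j) = 1" for j
        unfolding c_def using p by (simp add: sum_divisors_prime_power pw power_0_left)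
      have inj: "inj_on (\<lambda>j. p ^ j) {..<J}" 
        using prime_gt_1_nat[OF p(1)] by (auto simp: inj_on_def)
      have "(\<Sum>j<J. x ^ (p ^ j)) = (\<Sum>n\<in>(\<lambda>j. p ^ j) ` {..<J}. c n * x ^ n)"
        by (subst sum.reindex[OF inj]) (simp add: c1)
      also have "\<dots> \<le> S"
      proof (rule has_sum_mono_neutral[OF has_sum_finite S(1)])
        show "0 \<le> c n * x ^ n" if "n \<in> {1..} - (\<lambda>j. p ^ j) ` {..<J}" for n
          unfolding c_def using x that divisor_sum_nonneg[OF mult vals r1, of n] by auto
      qed (use prime_gt_0_nat[OF p(1)] in \<open>auto simp: Suc_le_eq\<close>)
      finally show ?thesis .
    qed
    ultimately show ?thesis by simp
  qed
  obtain J :: nat where J: "real J > B" using reals_Archimedean2 by blast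
  have "((\<lambda>x. \<Sum>j<J. x ^ (p ^ j)) \<longlongrightarrow> (\<Sum>j<J. 1 ^ (p ^ j))) (at_left (1::real))"
    by (intro tendsto_intros)
  moreover have "eventually (\<lambda>x::real. x \<in> {0<..<1}) (at_left 1)" by (intro eventually_at_left_real) auto
  then have "eventually (\<lambda>x. (\<Sum>j<J. x ^ (p ^ j)) \<le> B) (at_left (1::real))"
    by eventually_elim (use main in auto)
  ultimately have "(\<Sum>j<J. (1::real) ^ (p ^ j)) \<le> B"
    by (rule tendsto_upperbound) auto
  then show False using J by simp
qed

section \<open>Nonvanishing on the line of real part one\<close>

definition Lcont :: "nat \<Rightarrow> (nat \<Rightarrow> complex) \<Rightarrow> complex \<Rightarrow> complex" where
  "Lcont k \<xi> = (SOME K. continues_L k \<xi> K)"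

lemma continues_L_Lcont: "k > 0 \<Longrightarrow> dchar k \<xi> \<Longrightarrow> continues_L k \<xi> (Lcont k \<xi>)"
  unfolding Lcont_def by (rule someI_ex[OF exists_continues_L])

lemma Lcont:
  assumes "k > 0" "dchar k \<xi>"
  shows "Lcont k \<xi> holomorphic_on {s. Re s > 0}" "\<And>s. Re s > 1 \<Longrightarrow> Lcont k \<xi> s \<noteq> 0"
    "\<And>s. Re s > 1 \<Longrightarrow> (\<lambda>n. \<xi> n * mangoldt n * of_nat n powr (-s)) sums
        (of_bool (\<xi> = principal k) / (s - 1) - deriv (Lcont k \<xi>) s / Lcont k \<xi> s)"
    "\<xi> = principal k \<Longrightarrow> Lcont k \<xi> 1 \<noteq> 0"
    "\<xi> \<noteq> principal k \<Longrightarrow> (\<lambda>n. (\<Sum>m\<in>{1..Suc n}. \<xi> m) * (1 / of_nat (n + 1) - 1 / of_nat (n + 2))) sums Lcont k \<xi> 1"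
  using continues_L_Lcont[OF assms] unfolding continues_L_def by simp_all

text \<open>\<open>m\<close> is the order of the zero of \<open>Lcont k \<xi>\<close> at \<open>z\<close>.\<close>
lemma Lcont_residue:
  assumes k: "k > 0" and \<xi>: "dchar k \<xi>" and z: "Re z = 1"
  shows "\<exists>m::nat. (m = 0 \<longleftrightarrow> Lcont k \<xi> z \<noteq> 0) \<and>
    ((\<lambda>e. of_real e * (of_bool (\<xi> = principal k) / (z + of_real e - 1) -
        deriv (Lcont k \<xi>) (z + of_real e) / Lcont k \<xi> (z + of_real e)))
      \<longlongrightarrow> of_bool (\<xi> = principal k \<and> z = 1) - of_nat m) (at_right 0)"
proof -
  obtain m :: nat where m: "m = 0 \<longleftrightarrow> Lcont k \<xi> z \<noteq> 0"
    "((\<lambda>e. of_real e * (deriv (Lcont k \<xi>) (z + of_real e) / Lcont k \<xi> (z + of_real e))) \<longlongrightarrow> of_nat m) (at_right 0)"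
    using log_derivative_order[OF Lcont(1,2)[OF k \<xi>] z] by blast
  have "((\<lambda>e. of_real e * (of_bool (\<xi> = principal k) / (z + of_real e - 1))) \<longlongrightarrow> of_bool (\<xi> = principal k \<and> z = 1)) (at_right 0)"
  proof (cases "z = 1")
    case True
    have "eventually (\<lambda>e::real. e > 0) (at_right 0)" by (rule eventually_at_right_less)
    then have "eventually (\<lambda>e. of_bool (\<xi> = principal k \<and> z = 1) = of_real e * (of_bool (\<xi> = principal k) / (z + of_real e - 1))) (at_right 0)"
      by eventually_elim (use True in auto)
    then show ?thesis by (rule Lim_transform_eventually[OF tendsto_const])
  next
    case False
    have "((\<lambda>e. of_real e * (of_bool (\<xi> = principal k) / (z + of_real e - 1))) \<longlongrightarrow> of_real 0 * (of_bool (\<xi> = principal k) / (z + of_real 0 - 1))) (at_right 0)"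
      by (intro tendsto_intros) (use False in auto)
    then show ?thesis using False by simp
  qed
  from tendsto_diff[OF this m(2)] show ?thesis
    unfolding right_diff_distrib by (intro exI[of _ m] conjI m(1))
qed

text \<open>With u = \<xi> n * n^(-i t) of modulus 1, the n-th term of the combined series is a
  nonnegative multiple of 3 + 4 Re u + Re (u^2) = 2 (1 + Re u)^2. At n not coprime to
  \<open>k\<close> all three characters vanish.\<close>

lemma three_four_one:
  assumes k: "k > 0" and \<xi>: "dchar k \<xi>" and e: "e > 0"
  defines "D \<equiv> \<lambda>\<xi> s. of_bool (\<xi> = principal k) / (s - 1) - deriv (Lcont k \<xi>) s / Lcont k \<xi> s"
  shows "Re (3 * D (principal k) (1 + of_real e) + 4 * D \<xi> (1 + \<i> * of_real t + of_real e) +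
    D (\<lambda>n. \<xi> n * \<xi> n) (1 + \<i> * of_real (2 * t) + of_real e)) \<ge> 0"
proof -
  let ?\<xi>2 = "\<lambda>n. \<xi> n * \<xi> n"
  let ?t = "\<lambda>\<xi> s n. \<xi> n * mangoldt n * of_nat n powr (-s)"
  let ?T = "\<lambda>n. 3 * ?t (principal k) (1 + of_real e) n + 4 * ?t \<xi> (1 + \<i> * of_real t + of_real e) n + 
      ?t ?\<xi>2 (1 + \<i> * of_real (2 * t) + of_real e) n"
  let ?D = "3 * D (principal k) (1 + of_real e) + 4 * D \<xi> (1 + \<i> * of_real t + of_real e) +
      D ?\<xi>2 (1 + \<i> * of_real (2 * t) + of_real e)"
  have "?T sums ?D"
    unfolding D_def
    by (intro sums_add sums_mult Lcont(3)[OF k] \<xi> dchar_principal dchar_product) (use e in auto)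
  from sums_Re[OF this] have *: "(\<lambda>n. Re (?T n)) sums Re ?D" .
  show ?thesis
  proof (rule sums_le[OF _ sums_zero *])
    fix n
    show "0 \<le> Re (?T n)"
    proof (cases "n > 0 \<and> coprime n k")
      case True
      then have n: "n > 0" by simp
      define w where "w = exp (- (\<i> * of_real (t * ln (real n))))"
      define N where "N = exp (- (1 + e) * ln (real n))"
      define u where "u = \<xi> n * w"
      have "norm w = 1" unfolding w_def by (subst norm_exp_eq_Re) simp
      then have nu: "norm u = 1" using norm_dchar[OF \<xi> k, of n] True by (simp add: u_def norm_mult)
      have 0: "of_nat n powr (-(1 + of_real e)) = (of_real N :: complex)"
        unfolding of_nat_powr_minus[OF n] N_def by (simp add: exp_of_real[symmetric])
      have 1: "of_nat n powr (-(1 + \<i> * of_real t + of_real e)) = of_real N * w"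
        unfolding of_nat_powr_minus[OF n] N_def w_def exp_of_real[symmetric] exp_add[symmetric]
        by (simp add: algebra_simps)
      have 2: "of_nat n powr (-(1 + \<i> * of_real (2 * t) + of_real e)) = of_real N * (w * w)"
        unfolding of_nat_powr_minus[OF n] N_def w_def exp_of_real[symmetric] exp_add[symmetric]
        by (simp add: algebra_simps)
      have "?T n = of_real (mangoldt n * N) * (3 + 4 * u + u * u)"
        unfolding 0 1 2 u_def using True by (simp add: principal_def algebra_simps)
      also have "Re \<dots> = mangoldt n * N * (3 + 4 * Re u + ((Re u)\<^sup>2 - (Im u)\<^sup>2))"
        by (simp add: power2_eq_square)
      also have "(Im u)\<^sup>2 = 1 - (Re u)\<^sup>2"
        using nu by (metis add_diff_cancel_left' cmod_power2 power_one)
      also have "3 + 4 * Re u + ((Re u)\<^sup>2 - (1 - (Re u)\<^sup>2)) = 2 * (1 + Re u)\<^sup>2"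
        by (simp add: power2_eq_square algebra_simps)
      finally show ?thesis by (simp add: N_def mangoldt_nonneg)
    next
      case False
      then show ?thesis
      proof (cases "n = 0")
        case False
        then have "\<not>coprime n k" using \<open>\<not>(n > 0 \<and> coprime n k)\<close> by simp
        then show ?thesis using dchar_eq_0_iff[OF \<xi>, of n] by (simp add: principal_def)
      qed simp
    qed
  qed
qed

text \<open>The values lie in -1, 0, 1, so the Lambert series argument applies. It needs a prime
  where the character vanishes: modulo 1 every character is principal, so k \<noteq> 1 and a prime
  divisor of \<open>k\<close> serves.\<close>

lemma Lcont_real_nonzero:
  assumes k: "k > 0" and \<xi>: "dchar k \<xi>" "\<xi> \<noteq> principal k" "(\<lambda>n. \<xi> n * \<xi> n) = principal k"
  shows "Lcont k \<xi> 1 \<noteq> 0"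
proof
  assume 0: "Lcont k \<xi> 1 = 0"
  have vals: "\<xi> n \<in> {-1, 0, 1}" for n
  proof -
    have "\<xi> n * \<xi> n = 0 \<or> \<xi> n * \<xi> n = 1" using fun_cong[OF \<xi>(3), of n] by (auto simp: principal_def)
    then show ?thesis by (auto simp: square_eq_1_iff)
  qed
  define r where "r = (\<lambda>n. Re (\<xi> n))"
  have \<xi>r: "\<xi> n = of_real (r n)" for n using vals[of n] by (auto simp: r_def)
  have "k \<noteq> 1"
  proof
    assume "k = 1"
    have "\<xi> n = principal k n" for n
    proof -
      have "[n = 1] (mod k)" using \<open>k = 1\<close> by (simp add: cong_def)
      then have "\<xi> n = 1" using dchar_cong[OF \<xi>(1)] dchar_1(1)[OF \<xi>(1)] by metis
      then show ?thesis using \<open>k = 1\<close> by (simp add: principal_def)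
    qed
    then show False using \<xi>(2) by blast
  qed
  then obtain p where p: "prime p" "p dvd k" using prime_factor_nat by blast
  then have "\<not>coprime p k" by (meson coprime_common_divisor dvd_refl not_prime_unit)
  then have rp: "r p = 0" using dchar_eq_0_iff[OF \<xi>(1), of p] by (simp add: r_def)
  obtain B where B: "\<And>N. norm ((\<Sum>n\<in>{1..N}. \<xi> n) - (\<Sum>n<k. \<xi> n) / of_nat k * of_nat N) \<le> B"
    using periodic_sums_bounded[OF k, of \<xi>] dchar_periodic[OF \<xi>(1)] by blast
  show False
  proof (rule monsky[of r p B])
    show "r (m * n) = r m * r n" for m n
      using dchar_mult[OF \<xi>(1), of m n] unfolding \<xi>r of_real_mult[symmetric] of_real_eq_iff .
    show "r n \<in> {-1, 0, 1}" for n using vals[of n] by (auto simp: r_def)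
    show "r 1 = 1" using dchar_1(1)[OF \<xi>(1)] by (simp add: r_def)
    show "\<bar>\<Sum>n\<in>{1..N}. r n\<bar> \<le> B" for N
    proof -
      have "norm (of_real (\<Sum>n\<in>{1..N}. r n) :: complex) \<le> B"
        using B[of N] sum_nonprincipal_eq_0[OF k \<xi>(1,2)] by (simp add: \<xi>r del: of_real_sum flip: of_real_sum)
      then show ?thesis by (simp only: norm_of_real)
    qed
    have "(\<lambda>n. Re ((\<Sum>m\<in>{1..Suc n}. \<xi> m) * (1 / of_nat (n + 1) - 1 / of_nat (n + 2)))) sums Re 0"
      using sums_Re[OF Lcont(5)[OF k \<xi>(1,2)]] unfolding 0 .
    moreover have "Re ((\<Sum>m\<in>{1..Suc n}. \<xi> m) * (1 / of_nat (n + 1) - 1 / of_nat (n + 2)))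
       = (\<Sum>m\<in>{1..Suc n}. r m) * (1 / real (n + 1) - 1 / real (n + 2))" for n
    proof -
      have "(\<Sum>m\<in>{1..Suc n}. \<xi> m) * (1 / of_nat (n + 1) - 1 / of_nat (n + 2)) =
        of_real ((\<Sum>m\<in>{1..Suc n}. r m) * (1 / real (n + 1) - 1 / real (n + 2)))"
        unfolding \<xi>r by (simp del: of_nat_add of_nat_Suc)
      then show ?thesis by (simp only: Re_complex_of_real)
    qed
    ultimately show "(\<lambda>n. (\<Sum>m\<in>{1..Suc n}. r m) * (1 / real (n + 1) - 1 / real (n + 2))) sums 0"
      by simp
  qed (use p rp in auto)
qed

text \<open>Multiplying the inequality by e and letting e tend to 0 gives 4 m1 + m2 \<le> 3 for the
  orders of vanishing at z and at the doubled height, plus 1 on the right if the squared character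
  has its pole there. Without that pole m1 = 0; with it the character is real and z = 1.\<close>

lemma Lcont_nonzero:
  assumes k: "k > 0" and \<xi>: "dchar k \<xi>" and z: "Re z \<ge> 1"
  shows "Lcont k \<xi> z \<noteq> 0"
proof (cases "Re z > 1 \<or> (\<xi> = principal k \<and> z = 1)")
  case True
  then show ?thesis using Lcont(2,4)[OF k \<xi>] by auto
next
  case False
  then have z1: "Re z = 1" using z by simp
  define t where "t = Im z"
  have zt: "z = 1 + \<i> * of_real t" using z1 by (simp add: t_def complex_eq_iff)
  let ?\<xi>2 = "\<lambda>n. \<xi> n * \<xi> n"
  have \<xi>2: "dchar k ?\<xi>2" by (rule dchar_product[OF \<xi> \<xi>])
  let ?z2 = "1 + \<i> * of_real (2 * t)"
  define D where "D = (\<lambda>\<xi> s. of_bool (\<xi> = principal k) / (s - 1) - deriv (Lcont k \<xi>) s / Lcont k \<xi> s)"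
  have res: "\<exists>m::nat. (m = 0 \<longleftrightarrow> Lcont k \<psi> w \<noteq> 0) \<and> 
     ((\<lambda>e. of_real e * D \<psi> (w + of_real e)) \<longlongrightarrow> of_bool (\<psi> = principal k \<and> w = 1) - of_nat m) (at_right 0)"
    if "dchar k \<psi>" "Re w = 1" for \<psi> w
    using Lcont_residue[OF k that] unfolding D_def .
  obtain m0 :: nat where m0: "m0 = 0 \<longleftrightarrow> Lcont k (principal k) 1 \<noteq> 0"
    "((\<lambda>e. of_real e * D (principal k) (1 + of_real e)) \<longlongrightarrow> of_bool (principal k = principal k \<and> (1::complex) = 1) - of_nat m0) (at_right 0)"
    using res[OF dchar_principal one_complex.simps(1)] by (elim exE conjE)
  obtain m1 :: nat where m1: "m1 = 0 \<longleftrightarrow> Lcont k \<xi> z \<noteq> 0"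
    "((\<lambda>e. of_real e * D \<xi> (z + of_real e)) \<longlongrightarrow> of_bool (\<xi> = principal k \<and> z = 1) - of_nat m1) (at_right 0)"
    using res[OF \<xi> z1] by (elim exE conjE)
  have "Re ?z2 = 1" by simp
  from res[OF \<xi>2 this] obtain m2 :: nat where 
    m2: "((\<lambda>e. of_real e * D ?\<xi>2 (?z2 + of_real e)) \<longlongrightarrow> of_bool (?\<xi>2 = principal k \<and> ?z2 = 1) - of_nat m2) (at_right 0)"
    by (elim exE conjE)
  let ?lim = "Re (3 * (of_bool (principal k = principal k \<and> (1::complex) = 1) - of_nat m0) + 4 * (of_bool (\<xi> = principal k \<and> z = 1) - of_nat m1)
       + (of_bool (?\<xi>2 = principal k \<and> ?z2 = 1) - of_nat m2))"
  let ?E = "\<lambda>e. 3 * (of_real e * D (principal k) (1 + of_real e)) + 4 * (of_real e * D \<xi> (z + of_real e)) +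
       of_real e * D ?\<xi>2 (?z2 + of_real e)"
  have "m0 = 0" using m0(1) Lcont(4)[OF k dchar_principal] by simp
  have "((\<lambda>e. Re (?E e))
     \<longlongrightarrow> ?lim) (at_right 0)"
    by (intro tendsto_Re tendsto_add tendsto_mult tendsto_const m0(2) m1(2) m2)
  then have "0 \<le> ?lim"
  proof (rule tendsto_lowerbound)
    have "eventually (\<lambda>e::real. e > 0) (at_right 0)" by (rule eventually_at_right_less)
    then show "eventually (\<lambda>e. 0 \<le> Re (?E e)) (at_right 0)"
    proof eventually_elim
      case (elim e)
      have "?E e =
        of_real e * (3 * D (principal k) (1 + of_real e) + 4 * D \<xi> (z + of_real e) + D ?\<xi>2 (?z2 + of_real e))"
        by (simp add: algebra_simps)
      also have "Re \<dots> = e * Re (3 * D (principal k) (1 + of_real e) + 4 * D \<xi> (z + of_real e) + D ?\<xi>2 (?z2 + of_real e))"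
        by (simp only: times_complex.simps Re_complex_of_real Im_complex_of_real mult_zero_left diff_zero)
      also have "\<dots> \<ge> 0"
        using three_four_one[OF k \<xi> elim, of t] elim unfolding D_def zt by (intro mult_nonneg_nonneg) auto
      finally show ?case .
    qed
  qed auto
  \<comment> \<open>The 3 is the pole of the principal character at 1, where its continuation has no
    zero. The assumption \<open>False\<close> excludes a pole of the middle term.\<close>
  then have ineq: "4 * real m1 + real m2 \<le> 3 + of_bool (?\<xi>2 = principal k \<and> ?z2 = 1)"
    using False \<open>m0 = 0\<close> by (auto simp: of_bool_def split: if_splits)
  show ?thesis
  proof (cases "?\<xi>2 = principal k \<and> ?z2 = 1")
    case True
    then have "t = 0" by (simp add: complex_eq_iff)
    then have "z = 1" using zt by simp
    then show ?thesis using Lcont_real_nonzero[OF k \<xi>] True False by auto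
  next
    case F2: False
    then have "of_bool (?\<xi>2 = principal k \<and> ?z2 = 1) = (0 :: real)" by (simp only: of_bool_def if_False)
    then have "4 * real m1 \<le> 3" using ineq by linarith
    then have "m1 = 0" by simp
    then show ?thesis using m1(1) by simp
  qed
qed

section \<open>The Tauberian theorem for Dirichlet series\<close>

text \<open>At s = 1 the slice is a real integral of (A - c t) / t^2 over an interval of length 1,
  so pointwise bounds pass to it. This is all the density argument uses about slices.\<close>

lemma slice_int_real_bounds:
  fixes A :: "nat \<Rightarrow> real" and c :: real
  defines "s \<equiv> \<lambda>n. Re (slice_int (\<lambda>n. of_real (A n)) (of_real c) n 1)"
  shows "(\<And>t. real n + 1 \<le> t \<Longrightarrow> t \<le> real n + 2 \<Longrightarrow> v \<le> (A (Suc n) - c * t) / t\<^sup>2) \<Longrightarrow> v \<le> s n"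
    and "(\<And>t. real n + 1 \<le> t \<Longrightarrow> t \<le> real n + 2 \<Longrightarrow> (A (Suc n) - c * t) / t\<^sup>2 \<le> w) \<Longrightarrow> s n \<le> w"
proof -
  let ?f = "\<lambda>t. (of_real (A (Suc n)) - of_real c * of_real t) * exp (- (1 + 1) * of_real (ln t)) :: complex"
  have "?f integrable_on {real n + 1..real n + 2}"
    using continuous_on_slice[of n "\<lambda>n. of_real (A n)" "of_real c" 1] by (rule integrable_continuous_real)
  then have "(?f has_integral (slice_int (\<lambda>n. of_real (A n)) (of_real c) n 1)) {real n + 1..real n + 2}"
    unfolding slice_int_def by (rule integrable_integral)
  then have "((\<lambda>t. Re (?f t)) has_integral s n) {real n + 1..real n + 2}"
    unfolding s_def by (rule has_integral_Re)
  moreover have "Re (?f t) = (A (Suc n) - c * t) / t\<^sup>2" if "t \<in> {real n + 1..real n + 2}" for t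
  proof -
    have t: "t > 0" using that by auto
    have "?f t = of_real ((A (Suc n) - c * t) * exp (- 2 * ln t))"
      by (simp add: exp_of_real[symmetric])
    then have "Re (?f t) = (A (Suc n) - c * t) * exp (- 2 * ln t)" by (simp only: Re_complex_of_real)
    also have "exp (- 2 * ln t) = 1 / t\<^sup>2"
    proof -
      have "exp (- 2 * ln t) * (exp (ln t))\<^sup>2 = exp (- 2 * ln t + (ln t + ln t))"
        by (simp only: exp_add power2_eq_square)
      also have "\<dots> = 1" by simp
      finally show ?thesis using t by (simp add: field_simps)
    qed
    finally show ?thesis by simp
  qed
  ultimately have I: "((\<lambda>t. (A (Suc n) - c * t) / t\<^sup>2) has_integral s n) {real n + 1..real n + 2}"
    by (rule has_integral_eq[rotated])
  have const: "((\<lambda>t. u) has_integral u) {real n + 1..real n + 2}" for u :: real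
    using has_integral_const_real[of u "real n + 1" "real n + 2"] by simp
  show "v \<le> s n" if "\<And>t. real n + 1 \<le> t \<Longrightarrow> t \<le> real n + 2 \<Longrightarrow> v \<le> (A (Suc n) - c * t) / t\<^sup>2"
    by (rule has_integral_le[OF const I]) (use that in auto)
  show "s n \<le> w" if "\<And>t. real n + 1 \<le> t \<Longrightarrow> t \<le> real n + 2 \<Longrightarrow> (A (Suc n) - c * t) / t\<^sup>2 \<le> w"
    by (rule has_integral_le[OF I const]) (use that in auto)
qed

text \<open>If A N exceeds (c + \<epsilon>) N, monotonicity keeps A t - c t large on
  [N, (1 + \<delta>) N], so that block of the series has a sum bounded below independently of N,
  against the Cauchy criterion. A deficit is refuted in the same way on
  [(1 - \<delta>) N, N].\<close>

lemma summable_slice_imp_density: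
  fixes A s :: "nat \<Rightarrow> real"
  assumes mono: "mono A" and c: "c \<ge> 0" and s: "summable s"
    and lower: "\<And>n v. (\<And>t. real n + 1 \<le> t \<Longrightarrow> t \<le> real n + 2 \<Longrightarrow> v \<le> (A (Suc n) - c * t) / t\<^sup>2) \<Longrightarrow> v \<le> s n"
    and upper: "\<And>n w. (\<And>t. real n + 1 \<le> t \<Longrightarrow> t \<le> real n + 2 \<Longrightarrow> (A (Suc n) - c * t) / t\<^sup>2 \<le> w) \<Longrightarrow> s n \<le> w"
  shows "(\<lambda>N. A N / real N) \<longlonglongrightarrow> c"
proof (rule LIMSEQ_I)
  fix \<epsilon> :: real assume \<epsilon>: "\<epsilon> > 0"
  \<comment> \<open>The bound c \<delta> \<le> \<epsilon> / 2 preserves half of the deviation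
    throughout the block, and \<delta> \<le> 1/2 keeps t below 3/2 N.\<close>
  define \<delta> where "\<delta> = min (1/2) (\<epsilon> / (2 * (c + 1)))"
  have \<delta>: "\<delta> > 0" "\<delta> \<le> 1/2" "c * \<delta> \<le> \<epsilon> / 2"
  proof -
    show "\<delta> > 0" using \<epsilon> c by (simp add: \<delta>_def)
    show "\<delta> \<le> 1/2" unfolding \<delta>_def by (rule min.cobounded1)
    have "c * \<delta> \<le> c * (\<epsilon> / (2 * (c + 1)))" using c by (intro mult_left_mono) (auto simp: \<delta>_def)
    also have "\<dots> \<le> \<epsilon> / 2" using c \<epsilon> by (simp add: field_simps)
    finally show "c * \<delta> \<le> \<epsilon> / 2" .
  qed
  \<comment> \<open>The upper block has at least \<delta> N / 2 slices, each at least 2 \<epsilon> /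
    (9 N), with this product; the lower block gives \<delta> \<epsilon> / 4, which is more.\<close>
  define \<eta> where "\<eta> = \<delta> * \<epsilon> / 9"
  have \<eta>: "\<eta> > 0" using \<delta> \<epsilon> by (simp add: \<eta>_def)
  obtain N0 where N0: "\<And>m n. m \<ge> N0 \<Longrightarrow> norm (sum s {m..<n}) < \<eta>"
    using s \<eta> unfolding summable_Cauchy by metis
  \<comment> \<open>The first condition keeps the lower block beyond \<open>N0\<close>; the second
    makes \<delta> N at least 2, so that rounding down to \<open>m\<close> loses at most
    half.\<close>
  have "norm (A N / real N - c) < \<epsilon>" if N: "real N \<ge> 2 * real N0 + 4" "real N \<ge> 2 / \<delta>" for N
  proof -
    have Npos: "real N > 0" using N by linarith
    define m where "m = nat \<lfloor>\<delta> * real N\<rfloor>"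
    have dN: "\<delta> * real N \<ge> 2" using N(2) \<delta> by (simp add: field_simps)
    have m1: "real m \<le> \<delta> * real N" using dN by (simp add: m_def)
    have "real m \<ge> \<delta> * real N - 1" unfolding m_def using dN by linarith
    then have m2: "real m \<ge> \<delta> * real N / 2" using dN by linarith
    have "\<delta> * real N \<le> 1/2 * real N" using \<delta> by (intro mult_right_mono) auto
    then have m3: "real m \<le> real N / 2" using m1 by linarith
    have up: "A N / real N < c + \<epsilon>"
    proof (rule ccontr)
      assume "\<not> A N / real N < c + \<epsilon>"
      then have AN: "A N \<ge> (c + \<epsilon>) * real N" using Npos by (simp add: field_simps)
      define v where "v = (\<epsilon> / 2 * real N) / (3/2 * real N)\<^sup>2"
      have v: "v = 2 * \<epsilon> / (9 * real N)" using Npos by (simp add: v_def power2_eq_square field_simps)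
      \<comment> \<open>Slice n lives on [n + 1, n + 2], so the block starting at t = N begins with
        index N - 1.\<close>
      have "v \<le> s n" if n: "n \<in> {N - 1..<N - 1 + m}" for n
      proof (rule lower)
        fix t assume t: "real n + 1 \<le> t" "t \<le> real n + 2"
        have nN: "real n \<ge> real N - 1" "real n + 2 \<le> real N + real m" using n Npos by auto
        have t2: "t > 0" "t \<le> (1 + \<delta>) * real N" using t nN m1 Npos by (auto simp: algebra_simps)
        have "(1 + \<delta>) * real N \<le> 3/2 * real N" using \<delta> by (intro mult_right_mono) auto
        then have t3: "t \<le> 3/2 * real N" using t2 by linarith
        have "A N \<le> A (Suc n)" using n by (intro monoD[OF mono]) auto
        moreover have "c * t \<le> c * ((1 + \<delta>) * real N)" using t2 c by (intro mult_left_mono) auto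
        moreover have "(c * \<delta>) * real N \<le> \<epsilon> / 2 * real N" using \<delta> by (intro mult_right_mono) auto
        ultimately have a: "\<epsilon> / 2 * real N \<le> A (Suc n) - c * t" using AN by (simp add: algebra_simps)
        have "t\<^sup>2 \<le> (3/2 * real N)\<^sup>2" using t2 t3 by (intro power_mono) auto
        moreover have "0 \<le> \<epsilon> / 2 * real N" using \<epsilon> Npos by simp
        ultimately show "v \<le> (A (Suc n) - c * t) / t\<^sup>2"
          unfolding v_def using t2 a order_trans[OF _ a] by (intro frac_le) simp_all
      qed
      then have "(\<Sum>n\<in>{N - 1..<N - 1 + m}. v) \<le> sum s {N - 1..<N - 1 + m}" by (rule sum_mono)
      moreover have "(\<Sum>n\<in>{N - 1..<N - 1 + m}. v) = real m * v" by simp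
      moreover have "real m * v \<ge> \<delta> * real N / 2 * v"
        using m2 \<epsilon> Npos unfolding v by (intro mult_right_mono) auto
      moreover have "\<delta> * real N / 2 * v = \<eta>" using Npos by (simp add: v \<eta>_def)
      moreover have "norm (sum s {N - 1..<N - 1 + m}) < \<eta>" using N(1) by (intro N0) linarith
      ultimately show False unfolding real_norm_def abs_less_iff by linarith
    qed
    have low: "A N / real N > c - \<epsilon>"
    proof (rule ccontr)
      assume "\<not> A N / real N > c - \<epsilon>"
      then have AN: "A N \<le> (c - \<epsilon>) * real N" using Npos by (simp add: field_simps)
      define v where "v = \<epsilon> / (2 * real N)"
      have mN: "m + 1 \<le> N" using m3 N by linarith
      have "s n \<le> - v" if n: "n \<in> {N - 1 - m..<N - 1}" for n
      proof (rule upper)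
        fix t assume t: "real n + 1 \<le> t" "t \<le> real n + 2"
        have nN: "real n + 1 \<ge> real N - real m" "real n + 2 \<le> real N" using n mN by auto
        have t2: "t > 0" "t \<le> real N" "t \<ge> (1 - \<delta>) * real N" using t nN m1 by (auto simp: algebra_simps)
        have "A (Suc n) \<le> A N" using n by (intro monoD[OF mono]) auto
        moreover have "c * t \<ge> c * ((1 - \<delta>) * real N)" using t2 c by (intro mult_left_mono) auto
        moreover have "(c * \<delta>) * real N \<le> \<epsilon> / 2 * real N" using \<delta> by (intro mult_right_mono) auto
        ultimately have a: "\<epsilon> / 2 * real N \<le> c * t - A (Suc n)" using AN by (simp add: algebra_simps)
        have "v = (\<epsilon> / 2 * real N) / (real N)\<^sup>2" using Npos by (simp add: v_def power2_eq_square field_simps)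
        also have "\<dots> \<le> (c * t - A (Suc n)) / t\<^sup>2"
          using a t2 order_trans[OF _ a, of 0] \<epsilon> Npos by (intro frac_le power_mono) simp_all
        finally have "v \<le> - ((A (Suc n) - c * t) / t\<^sup>2)" by (simp add: diff_divide_distrib)
        then show "(A (Suc n) - c * t) / t\<^sup>2 \<le> - v" by linarith
      qed
      then have "sum s {N - 1 - m..<N - 1} \<le> (\<Sum>n\<in>{N - 1 - m..<N - 1}. - v)" by (rule sum_mono)
      moreover have "(\<Sum>n\<in>{N - 1 - m..<N - 1}. - v) = - (real m * v)" using mN by (simp add: of_nat_diff)
      moreover have "real m * v \<ge> \<delta> * real N / 2 * v"
        using m2 \<epsilon> Npos unfolding v_def by (intro mult_right_mono) auto
      moreover have "\<delta> * real N / 2 * v = \<delta> * \<epsilon> / 4" using Npos by (simp add: v_def)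
      moreover have "\<delta> * \<epsilon> / 4 \<ge> \<eta>" using \<delta> \<epsilon> by (simp add: \<eta>_def)
      moreover have "norm (sum s {N - 1 - m..<N - 1}) < \<eta>"
      proof (rule N0)
        have "real N0 + 1 + real m \<le> real N" using N(1) m3 by linarith
        then show "N0 \<le> N - 1 - m" by linarith
      qed
      ultimately show False unfolding real_norm_def abs_less_iff by linarith
    qed
    show ?thesis using up low by (simp add: abs_less_iff)
  qed
  moreover obtain M :: nat where "real M \<ge> max (2 * real N0 + 4) (2 / \<delta>)" using real_arch_simple by blast
  ultimately show "\<exists>no. \<forall>n\<ge>no. norm (A n / real n - c) < \<epsilon>"
    by (intro exI[of _ M]) (auto simp: max_def split: if_splits)
qed

text \<open>Newman's theorem is applied to the slices at s = z + 1. Its conclusion at z = 0 is the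
  convergence of the integral of (A t - c t) / t^2, which monotonicity of \<open>A\<close> turns
  into a density.\<close>

theorem tauberian_nonneg_dirichlet:
  fixes a :: "nat \<Rightarrow> real" and W :: "complex \<Rightarrow> complex"
  defines "A \<equiv> \<lambda>N. \<Sum>n\<in>{1..N}. a n"
  assumes a: "\<And>n. a n \<ge> 0" and C: "\<And>N. A N \<le> C * real N" and c: "c \<ge> 0"
    and F: "\<And>s. Re s > 1 \<Longrightarrow> (\<lambda>n. of_real (a n) * of_nat n powr (-s)) sums (of_real c / (s - 1) + W s)"
    and U: "open U" "{s. Re s \<ge> 1} \<subseteq> U" and W: "W holomorphic_on U"
  shows "(\<lambda>N. A N / real N) \<longlonglongrightarrow> c"
proof -
  define A' where "A' = (\<lambda>N. of_real (A N) :: complex)"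
  define u where "u = (\<lambda>n z. slice_int A' (of_real c) n (z + 1))"
  \<comment> \<open>The slices sum to (F - c s / (s - 1)) / s, and inserting the pole part of F
    leaves (W - c) / s. Hence \<open>g\<close>, and hence the removal of s = 0 from the
    domain.\<close>
  define V where "V = (\<lambda>z::complex. z + 1) -` (U - {0})"
  define g where "g = (\<lambda>z. (W (z + 1) - of_real c) / (z + 1))"
  have A0: "A N \<ge> 0" for N unfolding A_def by (intro sum_nonneg a)
  have C0: "C \<ge> 0" using order_trans[OF A0 C[of 1]] by simp
  have A'_eq: "A' = (\<lambda>N. \<Sum>n\<in>{1..N}. of_real (a n))" by (simp add: A'_def A_def)
  have "(\<lambda>n. u n 0) sums g 0"
  proof (rule newman_tauberian[where C = "C + c" and U = V])
    show "u n holomorphic_on UNIV" for n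
      unfolding u_def
      by (rule holomorphic_on_compose_gen[OF _ slice_int_holomorphic, unfolded o_def]) (auto intro!: holomorphic_intros)
    show "norm (u n z) \<le> (C + c) * (exp (- Re z * ln (real n + 1)) - exp (- Re z * ln (real n + 2))) / Re z"
      if "Re z \<noteq> 0" for n z
      unfolding u_def
    proof (rule norm_slice_int_le_linear[OF _ that])
      fix t assume t: "real n + 1 \<le> t" "t \<le> real n + 2"
      have "norm (A' (Suc n) - of_real c * of_real t) = \<bar>A (Suc n) - c * t\<bar>"
        unfolding A'_def by (simp del: of_real_diff of_real_mult flip: of_real_diff of_real_mult)
      also have "\<dots> \<le> \<bar>A (Suc n)\<bar> + \<bar>c * t\<bar>" by (rule abs_triangle_ineq4)
      also have "\<dots> = A (Suc n) + c * t" using A0[of "Suc n"] c t by simp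
      also have "\<dots> \<le> C * t + c * t"
        using C[of "Suc n"] mult_left_mono[OF t(1) C0] by (simp add: add.commute)
      finally show "norm (A' (Suc n) - of_real c * of_real t) \<le> (C + c) * t" by (simp add: distrib_right)
    qed
    show "(\<lambda>n. u n z) sums g z" if z: "Re z > 0" for z
    proof -
      define s where "s = z + 1"
      have s: "Re s > 1" "s \<noteq> 0" "s - 1 \<noteq> 0" using z by (auto simp: s_def complex_eq_iff)
      have "norm (\<Sum>n\<in>{1..N}. of_real (a n) :: complex) \<le> C * (real N + 1)" for N
      proof -
        have "norm (\<Sum>n\<in>{1..N}. of_real (a n) :: complex) = A N"
          using A0[of N] unfolding A_def by (simp del: of_real_sum flip: of_real_sum)
        also have "\<dots> \<le> C * (real N + 1)" using C[of N] C0 by (simp add: distrib_left)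
        finally show ?thesis .
      qed
      from sums_slice_int[OF s(1) F[OF s(1)] this, of "of_real c"]
      have "(\<lambda>n. s * slice_int A' (of_real c) n s) sums (of_real c / (s - 1) + W s - of_real c * s / (s - 1))"
        unfolding A'_eq .
      from sums_mult[OF this, of "1 / s"]
      have "(\<lambda>n. slice_int A' (of_real c) n s) sums (1 / s * (of_real c / (s - 1) + W s - of_real c * s / (s - 1)))"
        using s by simp
      also have "1 / s * (of_real c / (s - 1) + W s - of_real c * s / (s - 1)) = (W s - of_real c) / s"
      proof -
        have "x / (s - 1) + y - x * s / (s - 1) = y - x" for x y :: complex
        proof -
          have "x / (s - 1) - x * s / (s - 1) = - x * ((s - 1) / (s - 1))"
            by (simp only: diff_divide_distrib[symmetric] times_divide_eq_right) (simp add: algebra_simps)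
          also have "\<dots> = - x" using s(3) by simp
          finally show ?thesis by (simp add: algebra_simps)
        qed
        then show ?thesis by simp
      qed
      finally show ?thesis by (simp add: u_def g_def s_def)
    qed
    show "open V" unfolding V_def by (intro continuous_open_vimage continuous_intros open_Diff U)
    show "{z. Re z \<ge> 0} \<subseteq> V"
    proof
      fix z :: complex assume "z \<in> {z. Re z \<ge> 0}"
      then have "Re (z + 1) \<ge> 1" by simp
      then have "z + 1 \<in> U" "z + 1 \<noteq> 0" using U(2) by (auto simp: complex_eq_iff)
      then show "z \<in> V" by (simp add: V_def)
    qed
    have "(\<lambda>z. W (z + 1)) holomorphic_on V"
      by (rule holomorphic_on_compose_gen[OF _ W, unfolded o_def]) (auto intro!: holomorphic_intros simp: V_def)
    then show "g holomorphic_on V"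
      unfolding g_def by (intro holomorphic_intros) (auto simp: V_def)
  qed
  then have "summable (\<lambda>n. u n 0)" by (rule sums_summable)
  then have "summable (\<lambda>n. Re (u n 0))" by (rule summable_Re)
  then have s: "summable (\<lambda>n. Re (slice_int (\<lambda>n. of_real (A n)) (of_real c) n 1))"
    by (simp add: u_def A'_def)
  have "mono A" unfolding A_def by (intro monoI sum_mono2) (auto intro: a)
  from summable_slice_imp_density[OF this c s slice_int_real_bounds] show ?thesis .
qed

section \<open>Chebyshev's upper bound\<close>

lemma multiples_eq_image:
  fixes d M :: nat
  assumes "d > 0"
  shows "{n \<in> {1..M}. d dvd n} = (\<lambda>k. d * k) ` {1..M div d}"
proof (intro equalityI subsetI)
  fix n assume "n \<in> {n \<in> {1..M}. d dvd n}"
  then obtain k where "n = d * k" "1 \<le> n" "n \<le> M" by auto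
  then show "n \<in> (\<lambda>k. d * k) ` {1..M div d}"
    using assms by (intro image_eqI[of _ _ k]) (auto simp: less_eq_div_iff_mult_less_eq mult.commute Suc_le_eq)
qed (use assms in \<open>auto simp: less_eq_div_iff_mult_less_eq mult.commute Suc_le_eq\<close>)

lemma card_multiples:
  assumes "d > 0"
  shows "card {n \<in> {1..M}. d dvd n} = M div d"
  unfolding multiples_eq_image[OF assms] using assms by (simp add: card_image inj_on_def)

text \<open>The cutoff \<open>K\<close> is left free so that the identities for N and 2 N can be
  subtracted over one range; terms with d > M vanish since \<open>M div d\<close> is 0.\<close>

lemma ln_fact_eq_sum_mangoldt:
  assumes "M \<le> K"
  shows "ln (fact M) = (\<Sum>d\<in>{1..K}. mangoldt d * real (M div d))"
proof -
  have "ln (fact M) = (\<Sum>n\<in>{1..M}. ln (real n))"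
    by (induction M) (simp_all add: ln_mult add.commute del: of_nat_Suc)
  also have "\<dots> = (\<Sum>n\<in>{1..M}. \<Sum>d\<in>{1..K}. if d dvd n then mangoldt d else 0)"
  proof (intro sum.cong refl)
    fix n assume n: "n \<in> {1..M}"
    have "ln (real n) = (\<Sum>d | d dvd n. mangoldt d)" using n by (subst mangoldt_sum) auto
    also have "{d. d dvd n} = {d \<in> {1..K}. d dvd n}"
      using n assms by (auto dest: dvd_imp_le intro!: Nat.gr0I simp: Suc_le_eq)
    also have "(\<Sum>d\<in>{d \<in> {1..K}. d dvd n}. mangoldt d) = (\<Sum>d\<in>{1..K}. if d dvd n then mangoldt d else 0)"
      by (rule sum.inter_filter) auto
    finally show "ln (real n) = (\<Sum>d\<in>{1..K}. if d dvd n then mangoldt d else 0)" .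
  qed
  also have "\<dots> = (\<Sum>d\<in>{1..K}. \<Sum>n\<in>{1..M}. if d dvd n then mangoldt d else 0)" by (rule sum.swap)
  also have "\<dots> = (\<Sum>d\<in>{1..K}. mangoldt d * real (M div d))"
  proof (intro sum.cong refl)
    fix d assume "d \<in> {1..K}"
    then have "d > 0" by auto
    have "(\<Sum>n\<in>{1..M}. if d dvd n then mangoldt d else 0) = (\<Sum>n\<in>{n \<in> {1..M}. d dvd n}. mangoldt d :: real)"
      by (rule sum.inter_filter[symmetric]) auto
    then show "(\<Sum>n\<in>{1..M}. if d dvd n then mangoldt d else 0) = mangoldt d * real (M div d)"
      by (simp only: sum_constant card_multiples[OF \<open>d > 0\<close>] mult.commute)
  qed
  finally show ?thesis .
qed

text \<open>The weight floor (2 N / d) - 2 floor (N / d) is nonnegative, and at least 1 for N < d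
  \<le> 2 N, so \<psi>(2 N) - \<psi>(N) is at most the logarithm of the central binomial
  coefficient. Summing over dyadic steps costs a factor 2 and rounding N up to a power of 2 another,
  hence 4 with ln 2 < 1.\<close>

lemma chebyshev_upper: "(\<Sum>n\<in>{1..N}. mangoldt n) \<le> 4 * real N"
proof -
  define \<psi> where "\<psi> = (\<lambda>N. \<Sum>n\<in>{1..N}. mangoldt n :: real)"
  have step: "\<psi> (2 * N) \<le> \<psi> N + 2 * real N * ln 2" for N
  proof -
    have "ln (fact (2 * N)) - 2 * ln (fact N) = (\<Sum>d\<in>{1..2*N}. mangoldt d * (real (2 * N div d) - 2 * real (N div d)))"
    proof -
      have "N \<le> 2 * N" by simp
      have "ln (fact (2 * N)) - 2 * ln (fact N) = 
          (\<Sum>d\<in>{1..2*N}. mangoldt d * real (2 * N div d)) - 2 * (\<Sum>d\<in>{1..2*N}. mangoldt d * real (N div d))"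
        unfolding ln_fact_eq_sum_mangoldt[OF order_refl, of "2 * N"] ln_fact_eq_sum_mangoldt[OF \<open>N \<le> 2 * N\<close>] ..
      also have "\<dots> = (\<Sum>d\<in>{1..2*N}. mangoldt d * real (2 * N div d) - 2 * (mangoldt d * real (N div d)))"
        by (simp only: sum_subtractf sum_distrib_left)
      also have "\<dots> = (\<Sum>d\<in>{1..2*N}. mangoldt d * (real (2 * N div d) - 2 * real (N div d)))"
        by (intro sum.cong refl) (simp only: right_diff_distrib mult_ac)
      finally show ?thesis .
    qed
    also have "\<dots> \<ge> (\<Sum>d\<in>{1..2*N}. if d \<le> N then 0 else mangoldt d)"
    proof (rule sum_mono)
      fix d assume d: "d \<in> {1..2*N}"
      show "(if d \<le> N then 0 else mangoldt d) \<le> mangoldt d * (real (2 * N div d) - 2 * real (N div d))"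
      proof (cases "d \<le> N")
        case True
        have "2 * (N div d) \<le> 2 * N div d"
          using d by (simp add: less_eq_div_iff_mult_less_eq)
        then have "2 * real (N div d) \<le> real (2 * N div d)" by linarith
        then show ?thesis using True by (simp add: mangoldt_nonneg)
      next
        case False
        then have "N div d = 0" "2 * N div d \<ge> 1" using d by (auto simp: less_eq_div_iff_mult_less_eq)
        then have "mangoldt d * 1 \<le> mangoldt d * (real (2 * N div d) - 2 * real (N div d))"
          by (intro mult_left_mono) (auto simp: mangoldt_nonneg)
        then show ?thesis using False by simp
      qed
    qed
    also have "(\<Sum>d\<in>{1..2*N}. if d \<le> N then 0 else mangoldt d) = \<psi> (2 * N) - \<psi> N"
    proof -
      have "\<psi> N = (\<Sum>d\<in>{1..2*N}. if d \<le> N then mangoldt d else 0)"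
        unfolding \<psi>_def by (rule sum.mono_neutral_cong_left) auto
      then have "\<psi> (2 * N) - \<psi> N = (\<Sum>d\<in>{1..2*N}. mangoldt d - (if d \<le> N then mangoldt d else 0))"
        by (simp add: \<psi>_def sum_subtractf)
      also have "\<dots> = (\<Sum>d\<in>{1..2*N}. if d \<le> N then 0 else mangoldt d)"
        by (intro sum.cong) auto
      finally show ?thesis by simp
    qed
    finally have 1: "\<psi> (2 * N) - \<psi> N \<le> ln (fact (2 * N)) - 2 * ln (fact N)" .
    have "real (fact (2 * N)) = real (fact N * fact N * (2 * N choose N))"
      using binomial_fact_lemma[of N "2 * N"] by (simp add: mult_2)
    also have "\<dots> \<le> fact N * fact N * 2 ^ (2 * N)"
      using binomial_le_pow2[of "2 * N" N] by (simp del: power_mult flip: of_nat_power)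
    finally have "ln (fact (2 * N)) \<le> ln (fact N * fact N * 2 ^ (2 * N) :: real)"
      by (subst ln_le_cancel_iff) auto
    then have "ln (fact (2 * N)) - 2 * ln (fact N) \<le> 2 * real N * ln 2"
      by (simp add: ln_mult ln_realpow)
    then show ?thesis using 1 by simp
  qed
  have pow: "\<psi> (2 ^ j) \<le> 2 ^ Suc j * ln 2" for j
  proof (induction j)
    case (Suc j)
    then show ?case using step[of "2 ^ j"] by simp
  qed (simp add: \<psi>_def)
  show ?thesis
  proof (cases "N = 0")
    case False
    then obtain j where j: "2 ^ j \<le> N" "N < 2 ^ (j + 1)" using ex_power_ivl1[of 2 N] by auto
    have "\<psi> N \<le> \<psi> (2 ^ Suc j)" unfolding \<psi>_def using j by (intro sum_mono2) (auto simp: mangoldt_nonneg)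
    also have "\<dots> \<le> 2 ^ Suc (Suc j) * ln 2" by (rule pow)
    also have "\<dots> \<le> 2 ^ Suc (Suc j) * 1" using ln_2_less_1 by (intro mult_left_mono) auto
    also have "\<dots> = 4 * real (2 ^ j)" by simp
    also have "\<dots> \<le> 4 * real N" using j by (intro mult_left_mono of_nat_mono) auto
    finally show ?thesis by (simp add: \<psi>_def)
  qed simp
qed

section \<open>The prime number theorem for arithmetic progressions, weighted form\<close>

text \<open>Orthogonality expresses the series restricted to the class of \<open>b\<close> as the
  mean over characters of the conjugate of \<xi> b times -L'/L. Only the principal character has a
  pole at 1, which gives the density; \<open>U\<close> is the common zero-free region of the
  finitely many continuations.\<close>

theorem mangoldt_arithmetic_progression:
  assumes k: "k > 0" and b: "coprime b k"
  shows "(\<lambda>N. (\<Sum>n\<in>{1..N}. of_bool ([n = b] (mod k)) * mangoldt n) / real N) \<longlonglongrightarrow> 1 / real (totient k)"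
proof -
  define X where "X = {\<xi>. dchar k \<xi>}"
  have X: "finite X" "principal k \<in> X" unfolding X_def using finite_dchar[OF k] dchar_principal by auto
  define \<phi> where "\<phi> = real (totient k)"
  have \<phi>: "\<phi> > 0" using k by (simp add: \<phi>_def)
  define U where "U = (\<Inter>\<xi>\<in>X. {s. Re s > 0} \<inter> Lcont k \<xi> -` (- {0}))"
  define W where "W = (\<lambda>s. - (1 / of_real \<phi>) * (\<Sum>\<xi>\<in>X. cnj (\<xi> b) * (deriv (Lcont k \<xi>) s / Lcont k \<xi> s)))"
  have S: "open {s::complex. Re s > 0}" by (simp add: open_halfspace_Re_gt)
  show ?thesis
  proof (rule tauberian_nonneg_dirichlet[where C = 4 and U = U and W = W])
    show "0 \<le> of_bool ([n = b] (mod k)) * (mangoldt n :: real)" for n by (simp add: mangoldt_nonneg)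
    show "(\<Sum>n\<in>{1..N}. of_bool ([n = b] (mod k)) * mangoldt n) \<le> 4 * real N" for N
      by (rule order_trans[OF sum_mono chebyshev_upper]) (simp add: mangoldt_nonneg)
    show "0 \<le> 1 / real (totient k)" by simp
    show "open U" unfolding U_def
    proof (intro open_INT X ballI)
      fix \<xi> assume "\<xi> \<in> X"
      then show "open ({s. Re s > 0} \<inter> Lcont k \<xi> -` (- {0}))"
        using Lcont(1)[OF k, of \<xi>] S
        by (intro continuous_open_preimage holomorphic_on_imp_continuous_on) (auto simp: X_def)
    qed
    show "{s. Re s \<ge> 1} \<subseteq> U" unfolding U_def using Lcont_nonzero[OF k] by (auto simp: X_def)
    have "(\<lambda>s. deriv (Lcont k \<xi>) s / Lcont k \<xi> s) holomorphic_on U" if "\<xi> \<in> X" for \<xi>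
    proof -
      have sub: "U \<subseteq> {s. Re s > 0}" using that by (auto simp: U_def)
      have hol: "Lcont k \<xi> holomorphic_on {s. Re s > 0}" using that Lcont(1)[OF k] by (simp add: X_def)
      show ?thesis
        by (intro holomorphic_on_divide holomorphic_on_subset[OF hol sub]
              holomorphic_on_subset[OF holomorphic_deriv[OF hol S] sub]) (use that in \<open>auto simp: U_def split: if_splits\<close>)
    qed
    then show "W holomorphic_on U" unfolding W_def
      by (intro holomorphic_on_mult holomorphic_on_const holomorphic_on_sum)
    fix s :: complex assume s: "Re s > 1"
    have "(\<lambda>n. \<Sum>\<xi>\<in>X. cnj (\<xi> b) * (\<xi> n * mangoldt n * of_nat n powr (-s))) sums
       (\<Sum>\<xi>\<in>X. cnj (\<xi> b) * (of_bool (\<xi> = principal k) / (s - 1) - deriv (Lcont k \<xi>) s / Lcont k \<xi> s))"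
      by (intro sums_sum sums_mult Lcont(3)[OF k _ s]) (auto simp: X_def)
    from sums_mult[OF this, of "1 / of_real \<phi>"]
    have "(\<lambda>n. 1 / of_real \<phi> * (\<Sum>\<xi>\<in>X. cnj (\<xi> b) * (\<xi> n * mangoldt n * of_nat n powr (-s)))) sums
       (1 / of_real \<phi> * (\<Sum>\<xi>\<in>X. cnj (\<xi> b) * (of_bool (\<xi> = principal k) / (s - 1) - deriv (Lcont k \<xi>) s / Lcont k \<xi> s)))" .
    moreover have "1 / of_real \<phi> * (\<Sum>\<xi>\<in>X. cnj (\<xi> b) * (\<xi> n * mangoldt n * of_nat n powr (-s))) =
      of_real (of_bool ([n = b] (mod k)) * mangoldt n) * of_nat n powr (-s)" for n
    proof -
      have "(\<Sum>\<xi>\<in>X. cnj (\<xi> b) * (\<xi> n * mangoldt n * of_nat n powr (-s))) =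
         (\<Sum>\<xi>\<in>X. cnj (\<xi> b) * \<xi> n) * (mangoldt n * of_nat n powr (-s))"
        unfolding sum_distrib_right by (intro sum.cong refl) (simp only: mult_ac)
      also have "(\<Sum>\<xi>\<in>X. cnj (\<xi> b) * \<xi> n) = of_bool ([n = b] (mod k)) * of_real \<phi>"
        using dchar_orthogonality[OF k b, of n] by (simp add: X_def \<phi>_def)
      finally show ?thesis using \<phi> by simp
    qed
    moreover have "1 / of_real \<phi> * (\<Sum>\<xi>\<in>X. cnj (\<xi> b) * (of_bool (\<xi> = principal k) / (s - 1) - deriv (Lcont k \<xi>) s / Lcont k \<xi> s))
       = of_real (1 / real (totient k)) / (s - 1) + W s"
    proof -
      have "(\<Sum>\<xi>\<in>X. cnj (\<xi> b) * (of_bool (\<xi> = principal k) / (s - 1))) = (\<Sum>\<xi>\<in>{principal k}. cnj (\<xi> b) * (of_bool (\<xi> = principal k) / (s - 1)))"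
        by (intro sum.mono_neutral_right) (use X in auto)
      also have "\<dots> = 1 / (s - 1)" using b by (simp add: principal_def)
      finally show ?thesis
        unfolding W_def right_diff_distrib sum_subtractf by (simp add: \<phi>_def right_diff_distrib)
    qed
    ultimately show "(\<lambda>n. of_real (of_bool ([n = b] (mod k)) * mangoldt n) * of_nat n powr (-s)) sums (of_real (1 / real (totient k)) / (s - 1) + W s)"
      by simp
  qed
qed

section \<open>Primes in arithmetic progressions\<close>

text \<open>Modulus 1 counts all primes, so \<open>prime_pi\<close> is a special case and ratios can
  be compared within one family.\<close>

definition primes_cong :: "nat \<Rightarrow> nat \<Rightarrow> nat \<Rightarrow> nat set" where
  "primes_cong k b N = {p. prime p \<and> p \<le> N \<and> [p = b] (mod k)}"

lemma finite_primes_cong [simp]: "finite (primes_cong k b N)"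
  by (rule finite_subset[of _ "{..N}"]) (auto simp: primes_cong_def)

lemma prime_pi_eq: "prime_pi (real N) = real (card (primes_cong 1 b N))"
  by (simp add: prime_pi_def primes_cong_def cong_def)

lemma prime_pi_nonneg [simp]: "prime_pi x \<ge> 0"
  by (simp add: prime_pi_def)

text \<open>A proper prime power p^j \<le> N has p \<le> sqrt N and j \<le> log 2 N, which bounds
  the number of such powers; each has weight at most ln N.\<close>

lemma sum_mangoldt_nonprime_le:
  assumes "N \<ge> 1"
  shows "(\<Sum>n\<in>{n\<in>{1..N}. \<not>prime n}. mangoldt n) \<le> (sqrt (real N) + 1) * (log 2 (real N) + 1) * ln (real N)"
proof -
  define P where "P = {n\<in>{1..N}. \<not>prime n \<and> primepow n}"
  define I where "I = {..nat \<lfloor>sqrt (real N)\<rfloor>} \<times> {..nat \<lfloor>log 2 (real N)\<rfloor>}"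
  have "P \<subseteq> (\<lambda>(p, j). p ^ j) ` I"
  proof
    fix n assume n: "n \<in> P"
    then obtain p j where pj: "prime p" "j > 0" "n = p ^ j" by (auto simp: P_def primepow_def)
    have "j \<noteq> 1" using n pj by (auto simp: P_def)
    then have j: "j \<ge> 2" using pj(2) by linarith
    have p2: "p \<ge> 2" using prime_ge_2_nat[OF pj(1)] .
    have nN: "n \<le> N" using n by (simp add: P_def)
    have "p ^ 2 \<le> p ^ j" using j p2 by (intro power_increasing) auto
    then have "real p ^ 2 \<le> real N" using nN pj(3) by (simp flip: of_nat_power)
    then have "real p \<le> sqrt (real N)" by (rule real_le_rsqrt)
    then have 1: "p \<le> nat \<lfloor>sqrt (real N)\<rfloor>" by (simp add: le_nat_iff le_floor_iff)
    have "2 ^ j \<le> p ^ j" using p2 by (intro power_mono) auto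
    then have "2 ^ j \<le> N" using nN pj(3) by simp
    then have "real (2 ^ j) \<le> real N" by (simp only: of_nat_le_iff)
    then have "(2::real) powr real j \<le> real N" by (simp add: powr_realpow)
    then have "real j \<le> log 2 (real N)" using assms by (simp add: le_log_iff)
    then have "j \<le> nat \<lfloor>log 2 (real N)\<rfloor>" by (simp add: le_nat_iff le_floor_iff)
    then show "n \<in> (\<lambda>(p, j). p ^ j) ` I" using 1 pj(3) by (auto simp: I_def)
  qed
  moreover have "finite I" by (simp add: I_def)
  ultimately have "card P \<le> card I" by (rule surj_card_le[rotated])
  also have "card I = (nat \<lfloor>sqrt (real N)\<rfloor> + 1) * (nat \<lfloor>log 2 (real N)\<rfloor> + 1)"
    by (simp add: I_def card_cartesian_product)
  finally have "real (card P) \<le> real (nat \<lfloor>sqrt (real N)\<rfloor> + 1) * real (nat \<lfloor>log 2 (real N)\<rfloor> + 1)"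
    unfolding of_nat_mult[symmetric] by (rule of_nat_mono)
  also have "\<dots> \<le> (sqrt (real N) + 1) * (log 2 (real N) + 1)"
    using assms by (intro mult_mono) auto
  finally have card: "real (card P) \<le> (sqrt (real N) + 1) * (log 2 (real N) + 1)" .
  have "(\<Sum>n\<in>{n\<in>{1..N}. \<not>prime n}. mangoldt n) = (\<Sum>n\<in>P. mangoldt n :: real)"
    unfolding P_def by (rule sum.mono_neutral_right) (auto simp: mangoldt_def)
  also have "\<dots> \<le> (\<Sum>n\<in>P. ln (real N))"
  proof (rule sum_mono)
    fix n assume n: "n \<in> P"
    then have "mangoldt n \<le> ln (real n)" by (intro mangoldt_le) (auto simp: P_def)
    also have "\<dots> \<le> ln (real N)" using n by (subst ln_le_cancel_iff) (auto simp: P_def)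
    finally show "mangoldt n \<le> ln (real N)" .
  qed
  also have "\<dots> = real (card P) * ln (real N)" by simp
  also have "\<dots> \<le> (sqrt (real N) + 1) * (log 2 (real N) + 1) * ln (real N)"
    using card assms by (intro mult_right_mono) auto
  finally show ?thesis .
qed

text \<open>From below, every prime up to N has weight at most ln N. From above, primes beyond y = N
  / (ln N)^2 have weight at least ln y, which is asymptotic to ln N, and the integers up to y number
  only o(N / ln N).\<close>

theorem primes_cong_asymptotic:
  assumes k: "k > 0" and b: "coprime b k"
  shows "(\<lambda>N. real (card (primes_cong k b N)) * ln (real N) / real N) \<longlonglongrightarrow> 1 / real (totient k)"
proof -
  define \<psi> where "\<psi> = (\<lambda>N. \<Sum>n\<in>{1..N}. of_bool ([n = b] (mod k)) * mangoldt n :: real)"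
  define P where "P = (\<lambda>N. real (card (primes_cong k b N)))"
  define E where "E = (\<lambda>N. (sqrt (real N) + 1) * (log 2 (real N) + 1) * ln (real N))"
  define y where "y = (\<lambda>N. real N / (ln (real N))\<^sup>2)"
  have \<psi>: "(\<lambda>N. \<psi> N / real N) \<longlonglongrightarrow> 1 / real (totient k)"
    unfolding \<psi>_def by (rule mangoldt_arithmetic_progression[OF k b])
  have lower: "\<psi> N - E N \<le> P N * ln (real N)" if N: "N \<ge> 1" for N
  proof -
    have "\<psi> N = (\<Sum>n\<in>{n\<in>{1..N}. prime n} \<union> {n\<in>{1..N}. \<not>prime n}. of_bool ([n = b] (mod k)) * mangoldt n)"
      unfolding \<psi>_def by (rule sum.cong) auto
    also have "\<dots> = (\<Sum>n\<in>{n\<in>{1..N}. prime n}. of_bool ([n = b] (mod k)) * mangoldt n) + 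
        (\<Sum>n\<in>{n\<in>{1..N}. \<not>prime n}. of_bool ([n = b] (mod k)) * mangoldt n)"
      by (rule sum.union_disjoint) auto
    also have "(\<Sum>n\<in>{n\<in>{1..N}. prime n}. of_bool ([n = b] (mod k)) * mangoldt n) = (\<Sum>p\<in>primes_cong k b N. mangoldt p :: real)"
      by (rule sum.mono_neutral_cong_right) (auto simp: primes_cong_def prime_ge_1_nat Suc_le_eq prime_gt_0_nat)
    also have "\<dots> \<le> (\<Sum>p\<in>primes_cong k b N. ln (real N))"
    proof (rule sum_mono)
      fix p assume "p \<in> primes_cong k b N"
      then have p: "prime p" "p \<le> N" by (auto simp: primes_cong_def)
      then have "ln (real p) \<le> ln (real N)"
        using prime_gt_0_nat[OF p(1)] by (subst ln_le_cancel_iff) auto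
      then show "mangoldt p \<le> ln (real N)" using p(1) by simp
    qed
    also have "(\<Sum>n\<in>{n\<in>{1..N}. \<not>prime n}. of_bool ([n = b] (mod k)) * mangoldt n) \<le> (\<Sum>n\<in>{n\<in>{1..N}. \<not>prime n}. mangoldt n :: real)"
      by (intro sum_mono) (auto simp: mangoldt_nonneg)
    also have "\<dots> \<le> E N" unfolding E_def by (rule sum_mangoldt_nonprime_le[OF N])
    finally show ?thesis by (simp add: P_def)
  qed
  have upper: "P N \<le> y N + \<psi> N / ln (y N)" if N: "y N > 1" for N
  proof -
    define Q where "Q = {p \<in> primes_cong k b N. real p > y N}"
    have "primes_cong k b N \<subseteq> Q \<union> {1..nat \<lfloor>y N\<rfloor>}"
      using N by (auto simp: Q_def primes_cong_def le_nat_iff le_floor_iff prime_ge_1_nat Suc_le_eq prime_gt_0_nat)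
    then have "card (primes_cong k b N) \<le> card (Q \<union> {1..nat \<lfloor>y N\<rfloor>})"
      by (intro card_mono) (auto simp: Q_def)
    also have "\<dots> \<le> card Q + card {1..nat \<lfloor>y N\<rfloor>}" by (rule card_Un_le)
    also have "\<dots> = card Q + nat \<lfloor>y N\<rfloor>" by simp
    finally have "P N \<le> real (card Q) + real (nat \<lfloor>y N\<rfloor>)" unfolding P_def by linarith
    also have "\<dots> \<le> real (card Q) + y N" using N by simp
    also have "real (card Q) * ln (y N) \<le> \<psi> N"
    proof -
      have "real (card Q) * ln (y N) = (\<Sum>p\<in>Q. ln (y N))" by simp
      also have "\<dots> \<le> (\<Sum>p\<in>Q. mangoldt p)"
        using N by (intro sum_mono) (auto simp: Q_def primes_cong_def)
      also have "\<dots> = (\<Sum>p\<in>Q. of_bool ([p = b] (mod k)) * mangoldt p)"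
        by (intro sum.cong) (auto simp: Q_def primes_cong_def)
      also have "\<dots> \<le> \<psi> N" unfolding \<psi>_def
        by (intro sum_mono2) (auto simp: Q_def primes_cong_def mangoldt_nonneg Suc_le_eq prime_gt_0_nat)
      finally show ?thesis .
    qed
    then have "real (card Q) \<le> \<psi> N / ln (y N)" using N by (simp add: field_simps)
    finally show ?thesis by simp
  qed
  show ?thesis
  proof (rule tendsto_sandwich)
    have "(\<lambda>N. E N / real N) \<longlonglongrightarrow> 0" unfolding E_def by real_asymp
    from tendsto_diff[OF \<psi> this]
    show "(\<lambda>N. \<psi> N / real N - E N / real N) \<longlonglongrightarrow> 1 / real (totient k)" by simp
    have "(\<lambda>N. y N * ln (real N) / real N) \<longlonglongrightarrow> 0" unfolding y_def by real_asymp
    moreover have "(\<lambda>N. ln (real N) / ln (y N)) \<longlonglongrightarrow> 1" unfolding y_def by real_asymp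
    ultimately have "(\<lambda>N. y N * ln (real N) / real N + \<psi> N / real N * (ln (real N) / ln (y N))) \<longlonglongrightarrow> 0 + 1 / real (totient k) * 1"
      by (intro tendsto_intros \<psi>)
    then show "(\<lambda>N. y N * ln (real N) / real N + \<psi> N / real N * (ln (real N) / ln (y N))) \<longlonglongrightarrow> 1 / real (totient k)" by simp
    show "\<forall>\<^sub>F N in sequentially. \<psi> N / real N - E N / real N \<le> real (card (primes_cong k b N)) * ln (real N) / real N"
      using eventually_ge_at_top[of 1]
    proof eventually_elim
      case (elim N)
      then show ?case using lower[of N] unfolding P_def diff_divide_distrib[symmetric] by (intro divide_right_mono) auto
    qed
    have "filterlim y at_top sequentially" unfolding y_def by real_asymp
    then have "eventually (\<lambda>N. y N > 1) sequentially" by (simp add: filterlim_at_top_dense)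
    then show "\<forall>\<^sub>F N in sequentially. real (card (primes_cong k b N)) * ln (real N) / real N \<le> y N * ln (real N) / real N + \<psi> N / real N * (ln (real N) / ln (y N))"
      using eventually_ge_at_top[of 1]
    proof eventually_elim
      case (elim N)
      have "P N * ln (real N) / real N \<le> (y N + \<psi> N / ln (y N)) * ln (real N) / real N"
        using upper[of N] elim by (intro divide_right_mono mult_right_mono) auto
      moreover have "(u + v / l) * L / n = u * L / n + v / n * (L / l)" for u v l L n :: real
        by (simp add: divide_inverse algebra_simps)
      ultimately show ?case by (simp only: P_def)
    qed
  qed
qed

corollary primes_cong_density:
  assumes "k > 0" "coprime b k"
  shows "(\<lambda>N. real (card (primes_cong k b N)) / prime_pi (real N)) \<longlonglongrightarrow> 1 / real (totient k)"
proof -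
  have "(\<lambda>N. (real (card (primes_cong k b N)) * ln (real N) / real N) / (real (card (primes_cong 1 1 N)) * ln (real N) / real N))
     \<longlonglongrightarrow> (1 / real (totient k)) / (1 / real (totient 1))"
    using assms by (intro tendsto_divide primes_cong_asymptotic) auto
  moreover have "eventually (\<lambda>N. (real (card (primes_cong k b N)) * ln (real N) / real N) / (real (card (primes_cong 1 1 N)) * ln (real N) / real N)
     = real (card (primes_cong k b N)) / prime_pi (real N)) sequentially"
    using eventually_gt_at_top[of 1] by eventually_elim (auto simp: prime_pi_eq[of _ 1])
  ultimately have "(\<lambda>N. real (card (primes_cong k b N)) / prime_pi (real N))
     \<longlonglongrightarrow> (1 / real (totient k)) / (1 / real (totient 1))"
    by (rule Lim_transform_eventually)
  then show ?thesis by simp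
qed

section \<open>A uniform upper bound for the number of primes congruent to 1 modulo k\<close>

text \<open>With q = M div p, the multiples of p contribute q plus the multiplicity in q!, and 2 q
  \<le> M closes the induction.\<close>

lemma multiplicity_fact_le:
  assumes "prime (p::nat)"
  shows "multiplicity p (fact M) \<le> M"
proof (induction M rule: less_induct)
  case (less M)
  define q where "q = M div p"
  have p: "p \<ge> 2" using prime_ge_2_nat[OF assms] .
  show ?case
  proof (cases "M = 0")
    case False
    have q: "q < M" unfolding q_def using False p by simp
    have dist: "multiplicity p (fact n) = (\<Sum>i\<in>{1..n}. multiplicity p i)" for n
      using prime_elem_multiplicity_prod_distrib[of p "\<lambda>i. i" "{1..n}"] assms by (simp add: fact_prod)
    have "multiplicity p (fact M) = (\<Sum>i\<in>{i\<in>{1..M}. p dvd i}. multiplicity p i)"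
      unfolding dist by (rule sum.mono_neutral_right) (auto simp: not_dvd_imp_multiplicity_0)
    also have "\<dots> = (\<Sum>j\<in>{1..q}. multiplicity p (p * j))"
      unfolding q_def using p by (subst multiples_eq_image) (auto simp: sum.reindex inj_on_def)
    also have "\<dots> = (\<Sum>j\<in>{1..q}. Suc (multiplicity p j))"
      using p by (intro sum.cong refl multiplicity_times_same) auto
    also have "\<dots> = q + multiplicity p (fact q)" by (simp only: dist Suc_eq_plus1_left sum.distrib) simp
    also have "\<dots> \<le> q + q" using less.IH[OF q] by simp
    also have "\<dots> \<le> p * q" using p by (metis mult_2 mult_le_mono1)
    also have "\<dots> \<le> M" unfolding q_def by simp
    finally show ?thesis .
  qed simp
qed

text \<open>Checked prime by prime. If p divides k, the power k^M alone absorbs the p-part of M!.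
  Otherwise let u invert k modulo that p-part: u (1 + k j) is congruent to u + j, so up to a unit
  the product runs over M consecutive integers and is divisible by M!.\<close>

lemma fact_dvd_prod_progression:
  assumes k: "k > 0"
  shows "fact M dvd k ^ M * (\<Prod>j<M. 1 + k * j)"
proof (rule multiplicity_le_imp_dvd)
  fix p :: nat assume p: "prime p"
  define y where "y = k ^ M * (\<Prod>j<M. 1 + k * j)"
  have y: "y \<noteq> 0" using k by (simp add: y_def)
  have pu: "\<not>is_unit p" using p not_prime_unit by blast
  show "multiplicity p (fact M) \<le> multiplicity p (k ^ M * (\<Prod>j<M. 1 + k * j))"
    unfolding y_def[symmetric]
  proof (rule multiplicity_geI[OF y pu])
    show "p ^ multiplicity p (fact M) dvd y"
    proof (cases "p dvd k")
      case True
      have "p ^ multiplicity p (fact M) dvd p ^ M" by (intro le_imp_power_dvd multiplicity_fact_le p)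
      also have "p ^ M dvd k ^ M" using True by (rule dvd_power_same)
      finally show ?thesis unfolding y_def by (rule dvd_mult2)
    next
      case False
      define e where "e = multiplicity p (fact M)"
      have "coprime k (p ^ e)" using prime_imp_coprime[OF p False] by (simp add: coprime_commute)
      then obtain u where "[k * u = Suc 0] (mod p ^ e)" using cong_solve_coprime_nat by metis
      then have u: "[k * u = 1] (mod p ^ e)" by simp
      then have "coprime (k * u) (p ^ e)" by (metis coprime_1_left cong_imp_coprime cong_sym)
      then have "coprime u (p ^ e)" by (simp only: coprime_mult_left_iff)
      then have "coprime (u ^ M) (p ^ e)" by (subst coprime_power_left_iff) (rule disjI1)
      then have cu: "coprime (p ^ e) (u ^ M)" by (rule coprime_commute[THEN iffD1])
      have "[(\<Prod>j<M. (1 + k * j) * u) = (\<Prod>j<M. u + j)] (mod p ^ e)"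
      proof (rule cong_prod)
        fix j
        have "[u + (k * u) * j = u + 1 * j] (mod p ^ e)" by (intro cong_add cong_mult cong_refl u)
        then show "[(1 + k * j) * u = u + j] (mod p ^ e)" by (simp add: algebra_simps)
      qed
      moreover have "p ^ e dvd (\<Prod>j<M. u + j)"
      proof -
        have "int (fact M) dvd int (\<Prod>j<M. u + j)"
          using fact_dvd_pochhammer[of M "int u"] by (simp add: pochhammer_prod atLeast0LessThan)
        then have "fact M dvd (\<Prod>j<M. u + j)" by (simp only: of_nat_dvd_iff)
        then show ?thesis unfolding e_def using multiplicity_dvd dvd_trans by blast
      qed
      ultimately have "p ^ e dvd (\<Prod>j<M. (1 + k * j) * u)" by (simp add: cong_dvd_iff)
      then have "p ^ e dvd (\<Prod>j<M. 1 + k * j) * u ^ M" by (simp only: prod.distrib prod_constant card_lessThan)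
      then have "p ^ e dvd (\<Prod>j<M. 1 + k * j)" using cu by (simp add: coprime_dvd_mult_left_iff)
      then show ?thesis unfolding y_def e_def by (rule dvd_mult)
    qed
  qed
qed simp

text \<open>An elementary substitute for the Brun-Titchmarsh inequality: the primes counted divide
  the integer \<open>k ^ M * (\<Prod>j<M. 1 + k * j) / fact M\<close>.\<close>
lemma prod_primes_progression_le:
  assumes k: "k > 0" and P: "finite P" "\<And>p. p \<in> P \<Longrightarrow> prime p \<and> M < p \<and> p \<le> k * M \<and> [p = 1] (mod k)"
  shows "(\<Prod>p\<in>P. p) \<le> k ^ (2 * M)"
proof -
  obtain Q where Q: "k ^ M * (\<Prod>j<M. 1 + k * j) = fact M * Q"
    using fact_dvd_prod_progression[OF k, of M] by (elim dvdE)
  \<comment> \<open>Each prime is one of the factors 1 + k j with j < M, because p \<le> k M;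
    distinct primes use distinct factors.\<close>
  have form: "p = 1 + k * ((p - 1) div k) \<and> (p - 1) div k < M" if "p \<in> P" for p
  proof -
    have p: "prime p" "p \<le> k * M" "[p = 1] (mod k)" using P(2)[OF that] by auto
    have p1: "p \<ge> 1" using prime_ge_1_nat[OF p(1)] .
    then have "k dvd p - 1" using p(3) by (simp add: cong_altdef_nat cong_sym_eq)
    then have e: "p = 1 + k * ((p - 1) div k)" using p1 by simp
    have "k * ((p - 1) div k) < k * M" using e p(2) by linarith
    then show ?thesis using e by simp
  qed
  have "inj_on (\<lambda>p. (p - 1) div k) P"
    using form by (intro inj_onI) metis
  then have "(\<Prod>p\<in>P. p) = (\<Prod>j\<in>(\<lambda>p. (p - 1) div k) ` P. 1 + k * j)"
    using form by (subst prod.reindex) (auto intro!: prod.cong)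
  also have "\<dots> dvd (\<Prod>j<M. 1 + k * j)"
    using form by (intro prod_dvd_prod_subset) auto
  also have "\<dots> dvd k ^ M * (\<Prod>j<M. 1 + k * j)" by simp
  finally have "(\<Prod>p\<in>P. p) dvd fact M * Q" unfolding Q .
  \<comment> \<open>All these primes exceed M, so they survive division by M! and divide the
    quotient \<open>Q\<close>; and \<open>Q\<close> is small because 1 + k j \<le> k (j +
    1).\<close>
  moreover have "coprime (\<Prod>p\<in>P. p) (fact M)"
  proof (rule prod_coprime_left)
    fix p assume "p \<in> P"
    then have "prime p" "M < p" using P(2) by auto
    then show "coprime p (fact M)" by (intro prime_imp_coprime) (auto simp: prime_dvd_fact_iff)
  qed
  ultimately have "(\<Prod>p\<in>P. p) dvd Q" by (simp add: coprime_dvd_mult_right_iff)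
  moreover have "Q > 0"
  proof (rule Nat.gr0I)
    assume "Q = 0"
    then show False using Q k by simp
  qed
  ultimately have "(\<Prod>p\<in>P. p) \<le> Q" by (rule dvd_imp_le)
  also have "Q \<le> k ^ (2 * M)"
  proof -
    have "(\<Prod>j<M. 1 + k * j) \<le> (\<Prod>j<M. k * Suc j)" using k by (intro prod_mono) auto
    also have "\<dots> = k ^ M * fact M" by (simp only: prod.distrib prod_constant card_lessThan fact_prod_Suc of_nat_id atLeast0LessThan)
    finally have "fact M * Q \<le> k ^ M * (k ^ M * fact M)" unfolding Q[symmetric] by (rule mult_left_mono) simp
    then have "fact M * Q \<le> fact M * (k ^ M * k ^ M)" by (simp only: mult_ac)
    then have "Q \<le> k ^ M * k ^ M" by simp
    then show ?thesis by (simp only: mult_2 power_add)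
  qed
  finally show ?thesis .
qed

lemma one_plus_ln_le_sqrt:
  assumes "x > (0::real)"
  shows "1 + ln x \<le> 2 * sqrt x"
  using ln_le_minus_one[of "sqrt x"] assms by (simp add: ln_sqrt)

text \<open>One threshold serves all k at once, as the dominated limit requires. For k beyond sqrt N
  the integers in the class are few enough. For smaller k, primes up to M, about N / k, are bounded
  by pi(M); the larger ones have a product between M^(their number) and k^(2 M), so their number is
  at most 2 M ln k / ln M.\<close>

theorem card_primes_cong_1_le:
  "\<exists>N1. \<forall>N\<ge>N1. \<forall>k\<ge>1. real (card (primes_cong k 1 N)) \<le> 32 / sqrt (real k) * prime_pi (real N)"
proof -
  define \<pi> where "\<pi> = (\<lambda>N::nat. prime_pi (real N))"
  have "(\<lambda>N. \<pi> N * ln (real N) / real N) \<longlonglongrightarrow> 1"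
    using primes_cong_asymptotic[of 1 1] unfolding \<pi>_def prime_pi_eq[of _ 1] by simp
  then have "eventually (\<lambda>N. \<pi> N * ln (real N) / real N > 1/2 \<and> \<pi> N * ln (real N) / real N < 2) sequentially"
    by (intro eventually_conj order_tendstoD) auto
  then obtain N0 where N0: "\<And>N. N \<ge> N0 \<Longrightarrow> \<pi> N * ln (real N) / real N > 1/2 \<and> \<pi> N * ln (real N) / real N < 2"
    by (auto simp: eventually_sequentially)
  have "eventually (\<lambda>N::nat. 2 * ln (real N) \<le> sqrt (sqrt (real N)) \<and> sqrt (real N) \<ge> real N0 + 2 \<and> real N \<ge> 4 \<and> N \<ge> N0) sequentially"
    by (intro eventually_conj eventually_ge_at_top) real_asymp+
  then obtain N1 where N1: "\<And>N. N \<ge> N1 \<Longrightarrow> 2 * ln (real N) \<le> sqrt (sqrt (real N)) \<and> sqrt (real N) \<ge> real N0 + 2 \<and> real N \<ge> 4 \<and> N \<ge> N0"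
    by (auto simp: eventually_sequentially)
  have "real (card (primes_cong k 1 N)) \<le> 32 / sqrt (real k) * \<pi> N" if N: "N \<ge> N1" and k: "k \<ge> 1" for N k
  proof -
    note * = N1[OF N]
    have lnN: "ln (real N) > 0" using * by simp
    have \<pi>N: "real N / (2 * ln (real N)) \<le> \<pi> N" using N0[of N] * lnN by (simp add: field_simps)
    have sk: "sqrt (real k) > 0" "real k = sqrt (real k) * sqrt (real k)" using k by auto
    show ?thesis
    proof (cases "real k > sqrt (real N)")
      case True
      \<comment> \<open>The trivial count N / k is enough in this range: sqrt k > N^(1/4) \<ge> 2 ln
        N pays for the logarithm.\<close>
      have "primes_cong k 1 N \<subseteq> (\<lambda>j. 1 + k * j) ` {1..N div k}"
      proof
        fix p assume "p \<in> primes_cong k 1 N"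
        then have p: "prime p" "p \<le> N" "[p = 1] (mod k)" by (auto simp: primes_cong_def)
        have p1: "p > 1" using prime_gt_1_nat[OF p(1)] .
        then have "k dvd p - 1" using p(3) by (simp add: cong_altdef_nat cong_sym_eq)
        then obtain j where j: "p - 1 = k * j" by blast
        then have "j \<ge> 1" using p1 by (cases j) auto
        moreover have "j * k \<le> N" using j p(2) by (simp add: mult.commute)
        then have "j \<le> N div k" using k by (simp add: less_eq_div_iff_mult_less_eq)
        ultimately show "p \<in> (\<lambda>j. 1 + k * j) ` {1..N div k}"
          using j p1 by (intro image_eqI[of _ _ j]) auto
      qed
      then have "card (primes_cong k 1 N) \<le> card ((\<lambda>j. 1 + k * j) ` {1..N div k})"
        by (intro card_mono) auto
      also have "\<dots> \<le> card {1..N div k}" by (rule card_image_le) simp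
      finally have "card (primes_cong k 1 N) \<le> N div k" by simp
      then have "real (card (primes_cong k 1 N)) \<le> real (N div k)" by (rule of_nat_mono)
      also have "\<dots> \<le> real N / real k" by (rule of_nat_div_le_of_nat)
      also have "\<dots> = 1 / sqrt (real k) * (real N / sqrt (real k))" by (subst sk(2)) simp
      also have "\<dots> \<le> 1 / sqrt (real k) * (real N / (2 * ln (real N)))"
      proof -
        have "2 * ln (real N) \<le> sqrt (real k)"
          using * True real_sqrt_le_mono[of "sqrt (real N)" "real k"] by linarith
        then show ?thesis using lnN sk by (intro mult_left_mono divide_left_mono) auto
      qed
      also have "\<dots> \<le> 1 / sqrt (real k) * \<pi> N" using sk \<pi>N by (intro mult_left_mono) auto
      also have "\<dots> \<le> 32 / sqrt (real k) * \<pi> N"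
        using sk by (intro mult_right_mono divide_right_mono) (auto simp: \<pi>_def)
      finally show ?thesis .
    next
      case False
      \<comment> \<open>The least M with N < k M, as the product bound requires. Since k \<le> sqrt
        N, M is at least sqrt N and ln M at least half of ln N.\<close>
      define M where "M = N div k + 1"
      have k0: "real k > 0" using k by simp
      have "N mod k < k" using k by simp
      then have NkM: "N < k * M" unfolding M_def
        by (metis Suc_eq_plus1 mult_Suc_right add.commute add_less_cancel_left mult_div_mod_eq)
      have NM: "real N / real k \<le> real M"
      proof -
        have "real N \<le> real k * real M" using NkM by (simp flip: of_nat_mult)
        then show ?thesis using k0 by (simp add: field_simps)
      qed
      have "sqrt (real N) * real k \<le> sqrt (real N) * sqrt (real N)"
        using False by (intro mult_left_mono) auto
      then have "sqrt (real N) * real k \<le> real N" by simp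
      then have "sqrt (real N) \<le> real N / real k" using k0 by (simp add: le_divide_eq)
      then have sM: "sqrt (real N) \<le> real M" using NM by linarith
      then have M0: "real M \<ge> real N0 + 2" using * by linarith
      have "ln (sqrt (real N)) \<le> ln (real M)" using sM * by (subst ln_le_cancel_iff) auto
      then have lnM: "ln (real N) / 2 \<le> ln (real M)" using * by (simp add: ln_sqrt)
      have lnM0: "ln (real M) > 0" using lnM lnN by linarith
      have MN: "real M \<le> 2 * (real N / real k)"
      proof -
        have "real (N div k) \<le> real N / real k" by (rule of_nat_div_le_of_nat)
        moreover have "1 \<le> real N / real k"
        proof -
          have "sqrt (real N) * 1 \<le> sqrt (real N) * sqrt (real N)" by (intro mult_left_mono) (use * in auto)
          then have "sqrt (real N) \<le> real N" by simp
          then show ?thesis using False k0 by simp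
        qed
        ultimately show ?thesis by (simp add: M_def)
      qed
      define P where "P = {p \<in> primes_cong k 1 N. M < p}"
      have "primes_cong k 1 N \<subseteq> primes_cong 1 1 M \<union> P"
        by (auto simp: P_def primes_cong_def cong_def)
      then have "card (primes_cong k 1 N) \<le> card (primes_cong 1 1 M \<union> P)"
        by (intro card_mono) (auto simp: P_def)
      also have "\<dots> \<le> card (primes_cong 1 1 M) + card P" by (rule card_Un_le)
      finally have split: "real (card (primes_cong k 1 N)) \<le> \<pi> M + real (card P)"
        unfolding \<pi>_def prime_pi_eq[of _ 1] by linarith
      have "M ^ card P \<le> (\<Prod>p\<in>P. p)"
      proof -
        have "(\<Prod>p\<in>P. M) \<le> (\<Prod>p\<in>P. p)" by (rule prod_mono) (auto simp: P_def)
        then show ?thesis by simp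
      qed
      also have "\<dots> \<le> k ^ (2 * M)"
        using k NkM by (intro prod_primes_progression_le) (auto simp: P_def primes_cong_def)
      finally have "real (M ^ card P) \<le> real (k ^ (2 * M))" by (simp only: of_nat_le_iff)
      then have "ln (real M ^ card P) \<le> ln (real k ^ (2 * M))"
        using M0 k by (subst ln_le_cancel_iff) auto
      then have "real (card P) * ln (real M) \<le> 2 * real M * ln (real k)"
        using M0 k by (simp add: ln_realpow)
      then have cP: "real (card P) \<le> 2 * real M * ln (real k) / ln (real M)"
        using lnM0 by (simp add: field_simps)
      have "\<pi> M \<le> 2 * real M / ln (real M)"
        using N0[of M] M0 lnM0 by (simp add: field_simps)
      then have "real (card (primes_cong k 1 N)) \<le> 2 * real M * (1 + ln (real k)) / ln (real M)"
        using split cP by (simp add: distrib_left add_divide_distrib)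
      \<comment> \<open>The bounds M \<le> 2 N / k, 1 + ln k \<le> 2 sqrt k and ln M \<ge> ln N / 2
        give 16; the remaining factor 2 of 32 comes from pi(N) \<ge> N / (2 ln N).\<close>
      also have "\<dots> \<le> 2 * (2 * (real N / real k)) * (2 * sqrt (real k)) / (ln (real N) / 2)"
        using one_plus_ln_le_sqrt[OF k0] MN lnM lnN k M0
        by (intro frac_le mult_mono) auto
      also have "\<dots> = 16 / sqrt (real k) * (real N / ln (real N))"
      proof -
        have "2 * (2 * (n / (s * s))) * (2 * s) / (l / 2) = 16 / s * (n / l)" if "s > 0" "l > 0" for n s l :: real
          using that by (simp add: field_simps)
        from this[OF sk(1) lnN, of "real N"] show ?thesis unfolding sk(2)[symmetric] .
      qed
      also have "\<dots> = 32 / sqrt (real k) * (real N / (2 * ln (real N)))" by simp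
      also have "\<dots> \<le> 32 / sqrt (real k) * \<pi> N" using \<pi>N sk by (intro mult_left_mono) auto
      finally show ?thesis .
    qed
  qed
  then show ?thesis unfolding \<pi>_def by blast
qed

section \<open>Density of each index condition\<close>

text \<open>Here \<open>t\<close> is the index of an element, \<open>(p - 1) div t\<close> its
  order, and \<open>m\<close> the variable of the Moebius expansion.\<close>

definition index_cond :: "int \<Rightarrow> nat \<Rightarrow> nat \<Rightarrow> nat \<Rightarrow> nat \<Rightarrow> bool" where
  "index_cond a d t m p \<longleftrightarrow> t * m dvd p - 1 \<and> [int ((p - 1) div t) = a] (mod int d)"

text \<open>The unit group modulo \<open>p\<close> is cyclic, so each divisor \<open>e\<close> of p
  - 1 is the order of exactly \<open>totient e\<close> elements.\<close>

lemma card_ord_cong: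
  assumes p: "prime p"
  shows "card {x \<in> {1..p - 1}. [int (ord p x) = a] (mod int d)} =
    (\<Sum>e | e dvd p - 1. if [int e = a] (mod int d) then totient e else 0)"
proof -
  define A where "A = {x \<in> {1..p - 1}. [int (ord p x) = a] (mod int d)}"
  define E where "E = {e. e dvd p - 1 \<and> [int e = a] (mod int d)}"
  have P: "p - 1 > 0" using prime_gt_1_nat[OF p] by simp
  have tot: "totatives p = {1..p - 1}"
    unfolding totatives_prime[OF p] using P by auto
  have finE: "finite E" unfolding E_def using P by simp
  have "ord p ` A \<subseteq> E"
  proof
    fix e assume "e \<in> ord p ` A"
    then obtain x where x: "x \<in> {1..p - 1}" "[int (ord p x) = a] (mod int d)" "e = ord p x" by (auto simp: A_def)
    then have "x \<in> totatives p" using tot by simp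
    then have "coprime x p" by (simp add: in_totatives_iff)
    then have "ord p x dvd totient p" by (intro order_divides_totient) (simp add: coprime_commute)
    then show "e \<in> E" using x p by (simp add: E_def totient_prime)
  qed
  then have "(\<Sum>e\<in>E. \<Sum>x\<in>{x\<in>A. ord p x = e}. 1) = (\<Sum>x\<in>A. 1::nat)"
    by (intro sum.group finE) (auto simp: A_def)
  moreover have "(\<Sum>x\<in>{x\<in>A. ord p x = e}. 1::nat) = totient e" if "e \<in> E" for e
  proof -
    have "{x\<in>A. ord p x = e} = {x\<in>totatives p. ord p x = e}"
      using that unfolding tot by (auto simp: A_def E_def)
    then show ?thesis
      using prime_card_elements_with_ord_eq_totient[OF prime_gt_1_nat[OF p] p, of e] that by (simp add: E_def)
  qed
  ultimately have "card A = (\<Sum>e\<in>E. totient e)" by simp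
  also have "\<dots> = (\<Sum>e\<in>{e\<in>{e. e dvd p - 1}. [int e = a] (mod int d)}. totient e)" by (simp add: E_def)
  also have "\<dots> = (\<Sum>e | e dvd p - 1. if [int e = a] (mod int d) then totient e else 0)"
    using P by (intro sum.inter_filter) simp
  finally show ?thesis by (simp add: A_def)
qed

text \<open>Both sums run to \<open>N\<close>, a range independent of \<open>p\<close>, so that they
  can be exchanged with the sum over primes.\<close>

lemma delta_p_eq:
  assumes p: "prime p" "p \<le> N"
  shows "delta_p p a d = (\<Sum>t\<in>{1..N}. \<Sum>m\<in>{1..N}.
    if index_cond a d t m p then real_of_int (mu m) / (real m * real t) else 0)"
proof -
  define P where "P = p - 1"
  have P: "P > 0" "P \<le> N" using prime_gt_1_nat[OF p(1)] p(2) by (auto simp: P_def)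
  let ?c = "\<lambda>e. [int e = a] (mod int d)"
  have "delta_p p a d = real (\<Sum>e | e dvd P. if ?c e then totient e else 0) / real P"
    unfolding delta_p_def card_ord_cong[OF p(1)] P_def ..
  also have "real (\<Sum>e | e dvd P. if ?c e then totient e else 0) = (\<Sum>e | e dvd P. if ?c e then real (totient e) else 0)"
    unfolding of_nat_sum by (intro sum.cong) auto
  also have "\<dots> / real P = (\<Sum>e | e dvd P. (if ?c e then real (totient e) else 0) / real P)"
    by (rule sum_divide_distrib)
  also have "\<dots> = (\<Sum>t | t dvd P. (if ?c (P div t) then real (totient (P div t)) else 0) / real P)"
    using P by (intro sum.reindex_bij_witness[of _ "\<lambda>t. P div t" "\<lambda>e. P div e"]) (auto elim!: dvdE)
  also have "\<dots> = (\<Sum>t | t dvd P. \<Sum>m\<in>{1..N}. if index_cond a d t m p then real_of_int (mu m) / (real m * real t) else 0)"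
  proof (intro sum.cong refl)
    fix t assume "t \<in> {t. t dvd P}"
    then obtain e where e: "P = t * e" by auto
    then have t: "t > 0" "e > 0" using P by (auto intro!: Nat.gr0I)
    then have Pt: "P div t = e" using e by simp
    have "real (totient e) / real P = (1 / real t) * (real (totient e) / real e)"
      using t unfolding e by simp
    also have "\<dots> = (1 / real t) * (\<Sum>m | m dvd e. real_of_int (mu m) / real m)"
      using sum_mu_over_divisors_eq_totient[OF t(2)] by simp
    also have "\<dots> = (\<Sum>m\<in>{m\<in>{1..N}. m dvd e}. real_of_int (mu m) / (real m * real t))"
    proof -
      have "e \<le> N" using e P t by (metis dvd_triv_right dvd_imp_le order_trans)
      then have "{m. m dvd e} = {m\<in>{1..N}. m dvd e}"
        using t by (auto dest: dvd_imp_le intro!: Nat.gr0I simp: Suc_le_eq)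
      then show ?thesis by (simp add: sum_distrib_left mult.commute)
    qed
    also have "\<dots> = (\<Sum>m\<in>{1..N}. if m dvd e then real_of_int (mu m) / (real m * real t) else 0)"
      by (rule sum.inter_filter) simp
    finally have *: "real (totient e) / real P = \<dots>" .
    have "index_cond a d t m p \<longleftrightarrow> ?c e \<and> m dvd e" for m
      unfolding index_cond_def P_def[symmetric] Pt using e t by auto
    then show "(if ?c (P div t) then real (totient (P div t)) else 0) / real P =
      (\<Sum>m\<in>{1..N}. if index_cond a d t m p then real_of_int (mu m) / (real m * real t) else 0)"
      unfolding Pt using * by simp
  qed
  also have "\<dots> = (\<Sum>t\<in>{1..N}. \<Sum>m\<in>{1..N}. if index_cond a d t m p then real_of_int (mu m) / (real m * real t) else 0)"
  proof (rule sum.mono_neutral_left)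
    show "{t. t dvd P} \<subseteq> {1..N}"
    proof
      fix t assume "t \<in> {t. t dvd P}"
      then have "t \<le> P" "t \<noteq> 0" using P by (auto dest: dvd_imp_le)
      then show "t \<in> {1..N}" using P by simp
    qed
    have "\<not>index_cond a d t m p" if "\<not>t dvd P" for t m
      using that by (auto simp: index_cond_def P_def dest: dvd_mult_left)
    then show "\<forall>t\<in>{1..N} - {t. t dvd P}. (\<Sum>m\<in>{1..N}. if index_cond a d t m p then real_of_int (mu m) / (real m * real t) else 0) = 0"
      by simp
  qed simp
  finally show ?thesis .
qed

lemma N_ad_eq:
  "N_ad a d (real N) = (\<Sum>t\<in>{1..N}. \<Sum>m\<in>{1..N}.
     real_of_int (mu m) / (real m * real t) * real (card {p. prime p \<and> p \<le> N \<and> index_cond a d t m p}))"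
proof -
  let ?w = "\<lambda>t m. real_of_int (mu m) / (real m * real t)"
  define Q where "Q = {p. prime p \<and> p \<le> N}"
  have Q: "finite Q" unfolding Q_def by simp
  have "N_ad a d (real N) = (\<Sum>p\<in>Q. delta_p p a d)" by (simp add: N_ad_def Q_def)
  also have "\<dots> = (\<Sum>p\<in>Q. \<Sum>t\<in>{1..N}. \<Sum>m\<in>{1..N}. if index_cond a d t m p then ?w t m else 0)"
    by (intro sum.cong refl delta_p_eq) (auto simp: Q_def)
  also have "\<dots> = (\<Sum>t\<in>{1..N}. \<Sum>p\<in>Q. \<Sum>m\<in>{1..N}. if index_cond a d t m p then ?w t m else 0)"
    by (rule sum.swap)
  also have "\<dots> = (\<Sum>t\<in>{1..N}. \<Sum>m\<in>{1..N}. \<Sum>p\<in>Q. if index_cond a d t m p then ?w t m else 0)"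
    by (intro sum.cong refl sum.swap)
  also have "\<dots> = (\<Sum>t\<in>{1..N}. \<Sum>m\<in>{1..N}. ?w t m * real (card {p. prime p \<and> p \<le> N \<and> index_cond a d t m p}))"
  proof (intro sum.cong refl)
    fix t m
    have "(\<Sum>p\<in>Q. if index_cond a d t m p then ?w t m else 0) = (\<Sum>p\<in>{p\<in>Q. index_cond a d t m p}. ?w t m)"
      by (rule sum.inter_filter[OF Q, symmetric])
    also have "{p\<in>Q. index_cond a d t m p} = {p. prime p \<and> p \<le> N \<and> index_cond a d t m p}" by (auto simp: Q_def)
    finally show "(\<Sum>p\<in>Q. if index_cond a d t m p then ?w t m else 0) = ?w t m * real (card {p. prime p \<and> p \<le> N \<and> index_cond a d t m p})"
      by (simp add: mult.commute)
  qed
  finally show ?thesis .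
qed

lemma index_cond_imp_cong_1:
  assumes "prime p" "index_cond a d t m p"
  shows "[p = 1] (mod (t * m))"
proof -
  have "1 \<le> p" using prime_ge_1_nat[OF assms(1)] .
  then have "[p = 1] (mod (t * m)) \<longleftrightarrow> t * m dvd p - 1" by (rule cong_altdef_nat)
  then show ?thesis using assms(2) unfolding index_cond_def by blast
qed

text \<open>Writing p - 1 = t e, the condition is m | e and e \<equiv> a modulo d, which the Chinese
  remainder theorem turns into one class \<open>e0\<close> modulo \<open>lcm m d\<close>, solvable
  because gcd m d divides a. The class b = 1 + t e0 is 1 modulo t and modulo m, and 1 + t a modulo
  d, hence coprime to the modulus.\<close>

lemma index_cond_iff_cong:
  assumes d: "d > 0" and t: "t > 0" and m: "m > 0" and dvd: "int (gcd m d) dvd a" and cop: "coprime (1 + int t * a) (int d)"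
  obtains b where "coprime b (t * lcm m d)"
    "\<And>p. prime p \<Longrightarrow> index_cond a d t m p \<longleftrightarrow> [p = b] (mod (t * lcm m d))"
proof -
  have "gcd (int m) (int d) dvd a" using dvd by simp
  then obtain x where x: "[int m * x = a] (mod int d)" using cong_solve_dvd_int by blast
  define y where "y = nat (x mod int d)"
  have "[int y = x] (mod int d)" using d by (simp add: y_def cong_def)
  then have "[int m * int y = int m * x] (mod int d)" by (intro cong_mult cong_refl)
  then have y: "[int (m * y) = a] (mod int d)" using x by (simp add: cong_trans)
  define e0 where "e0 = m * y"
  define b where "b = 1 + t * e0"
  have "coprime b (t * m * d)"
  proof -
    have "coprime (1 + t * e0) t" "coprime (1 + t * e0) m"
      unfolding e0_def by (metis add.commute coprime_add_one_left coprime_mult_left_iff coprime_mult_right_iff mult.commute)+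
    moreover have "coprime (1 + t * e0) d"
    proof -
      have "[1 + int t * int e0 = 1 + int t * a] (mod int d)"
        unfolding e0_def by (intro cong_add cong_mult cong_refl y)
      then have "coprime (1 + int t * int e0) (int d)"
        using cop by (metis cong_imp_coprime cong_sym)
      then have "coprime (int (1 + t * e0)) (int d)" by simp
      then show ?thesis by (simp only: coprime_int_iff)
    qed
    ultimately show ?thesis unfolding b_def by simp
  qed
  moreover have "t * lcm m d dvd t * m * d" unfolding mult.assoc by (intro mult_dvd_mono dvd_refl lcm_least) auto
  ultimately have cb: "coprime b (t * lcm m d)" using coprime_divisors[OF dvd_refl] by blast
  have "index_cond a d t m p \<longleftrightarrow> [p = b] (mod (t * lcm m d))" if p: "prime p" for p
  proof -
    have p1: "p \<ge> 1" using prime_ge_1_nat[OF p] .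
    have eb: "[p = b] (mod (t * lcm m d)) \<longleftrightarrow> [p - 1 = t * e0] (mod (t * lcm m d))"
    proof -
      have "[1 + (p - 1) = 1 + t * e0] (mod (t * lcm m d)) \<longleftrightarrow> [p - 1 = t * e0] (mod (t * lcm m d))"
        by (rule cong_add_lcancel_nat)
      then show ?thesis using p1 by (simp add: b_def)
    qed
    show ?thesis
    proof
      assume *: "index_cond a d t m p"
      then obtain l where l: "p - 1 = t * m * l" by (auto simp: index_cond_def)
      have "(p - 1) div t = m * l" using l t by (simp add: mult.assoc)
      then have "[int (m * l) = a] (mod int d)" using * by (simp add: index_cond_def)
      then have "[int (m * l) = int e0] (mod int d)" using y unfolding e0_def by (metis cong_sym cong_trans)
      then have 1: "[m * l = e0] (mod d)" by (simp only: cong_int_iff)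
      have 2: "[m * l = e0] (mod m)" by (simp add: e0_def cong_def)
      have "[m * l = e0] (mod lcm m d)" by (rule cong_cong_lcm_nat[OF 2 1])
      then have "[t * (m * l) = t * e0] (mod (t * lcm m d))" by (rule cong_cmult_leftI)
      then show "[p = b] (mod (t * lcm m d))" unfolding eb l by (simp only: mult.assoc)
    next
      assume "[p = b] (mod (t * lcm m d))"
      then have *: "[p - 1 = t * e0] (mod (t * lcm m d))" unfolding eb .
      then have "[p - 1 = t * e0] (mod t)" by (rule cong_dvd_modulus_nat) simp
      then have "t dvd p - 1" by (simp add: cong_dvd_iff)
      then obtain e where e: "p - 1 = t * e" by blast
      have "[e = e0] (mod lcm m d)" using * t unfolding e by (simp add: cong_def mult_mod_right[symmetric])
      then have 1: "[e = e0] (mod m)" "[e = e0] (mod d)" by (auto elim: cong_dvd_modulus_nat)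
      have "m dvd e" using cong_dvd_iff[OF 1(1)] by (simp add: e0_def)
      moreover have "[int e = a] (mod int d)"
        using 1(2) y unfolding e0_def by (metis cong_int_iff cong_trans)
      ultimately show "index_cond a d t m p" using e t by (simp add: index_cond_def)
    qed
  qed
  then show ?thesis using that cb by blast
qed

section \<open>Termwise densities and the passage to the limit\<close>

text \<open>The limit of the term for the pair: the density of its residue class times the Moebius
  coefficient. It is 0 when the congruences have no solution, or when the class is not coprime to
  \<open>d\<close> and so contains only finitely many primes.\<close>

definition index_weight :: "int \<Rightarrow> nat \<Rightarrow> nat \<times> nat \<Rightarrow> real" where
  "index_weight a d = (\<lambda>(t, m). if t > 0 \<and> m > 0 \<and> int (gcd m d) dvd a \<and> coprime (1 + int t * a) (int d)
     then real_of_int (mu m) / (real m * real t * real (totient (t * lcm m d))) else 0)"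

lemma prime_pi_at_top: "filterlim (\<lambda>N. prime_pi (real N)) at_top sequentially"
proof -
  have lim: "(\<lambda>N. prime_pi (real N) * ln (real N) / real N) \<longlonglongrightarrow> 1"
    using primes_cong_asymptotic[of 1 1] unfolding prime_pi_eq[of _ 1] by simp
  have "filterlim (\<lambda>N::nat. real N / ln (real N)) at_top sequentially" by real_asymp
  then have "filterlim (\<lambda>N. (prime_pi (real N) * ln (real N) / real N) * (real N / ln (real N))) at_top sequentially"
    by (rule filterlim_tendsto_pos_mult_at_top[OF lim zero_less_one])
  moreover have "eventually (\<lambda>N. (prime_pi (real N) * ln (real N) / real N) * (real N / ln (real N)) = prime_pi (real N)) sequentially"
    using eventually_gt_at_top[of 1] by eventually_elim auto
  ultimately show ?thesis by (rule filterlim_cong[THEN iffD1, OF refl refl, rotated])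
qed

text \<open>When \<open>gcd m d\<close> does not divide \<open>a\<close> there is nothing to count.
  When 1 + t a and d have a common factor, a qualifying prime must divide d, so the count stays
  bounded while pi(N) grows. The remaining pairs fall under the theorem on arithmetic
  progressions.\<close>

lemma index_cond_density:
  assumes d: "d > 0"
  shows "(\<lambda>N. real_of_int (mu m) / (real m * real t) * real (card {p. prime p \<and> p \<le> N \<and> index_cond a d t m p}) /
      prime_pi (real N)) \<longlonglongrightarrow> index_weight a d (t, m)"
proof -
  let ?w = "real_of_int (mu m) / (real m * real t)"
  let ?S = "\<lambda>N. {p. prime p \<and> p \<le> N \<and> index_cond a d t m p}"
  let ?\<pi> = "\<lambda>N. prime_pi (real N)"
  consider "t = 0 \<or> m = 0" | "t > 0" "m > 0" "\<not>int (gcd m d) dvd a" | "t > 0" "m > 0" "\<not>coprime (1 + int t * a) (int d)"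
    | "t > 0" "m > 0" "int (gcd m d) dvd a" "coprime (1 + int t * a) (int d)" by blast
  then show ?thesis
  proof cases
    case 1
    then show ?thesis by (auto simp: index_weight_def)
  next
    case 2
    have "\<not>index_cond a d t m p" for p
    proof
      assume *: "index_cond a d t m p"
      then obtain l where l: "p - 1 = t * m * l" by (auto simp: index_cond_def)
      then have "(p - 1) div t = m * l" using 2 by (simp add: mult.assoc)
      then have "[int (m * l) = a] (mod int d)" using * by (simp add: index_cond_def)
      then have "[int (m * l) = a] (mod int (gcd m d))" by (rule cong_dvd_modulus) simp
      moreover have "int (gcd m d) dvd int (m * l)" by (simp only: of_nat_dvd_iff) simp
      ultimately show False using 2(3) cong_dvd_iff by blast
    qed
    then show ?thesis using 2 by (simp add: index_weight_def)
  next
    case 3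
    have "?S N \<subseteq> {..d}" for N
    proof
      fix p assume "p \<in> ?S N"
      then have p: "prime p" "index_cond a d t m p" by auto
      have "t dvd p - 1" using p(2) by (auto simp: index_cond_def dest: dvd_mult_left)
      then obtain e where e: "p - 1 = t * e" by blast
      then have "(p - 1) div t = e" using 3 by simp
      then have "[int e = a] (mod int d)" using p(2) by (simp add: index_cond_def)
      then have "[1 + int t * int e = 1 + int t * a] (mod int d)" by (intro cong_add cong_mult cong_refl)
      moreover have "1 + int t * int e = int p" using e prime_ge_1_nat[OF p(1)]
        by (metis of_nat_1 of_nat_add of_nat_mult le_add_diff_inverse)
      ultimately have "[1 + int t * a = int p] (mod int d)" by (simp add: cong_sym)
      then have "\<not>coprime (int p) (int d)" using 3(3) cong_imp_coprime cong_sym by blast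
      then have "\<not>coprime p d" unfolding coprime_int_iff .
      then have "p dvd d" using prime_imp_coprime[OF p(1), of d] by blast
      then show "p \<in> {..d}" using d by (auto dest: dvd_imp_le)
    qed
    then have le: "card (?S N) \<le> Suc d" for N
      using card_mono[of "{..d}" "?S N"] by simp
    have "(\<lambda>N. ?w * real (card (?S N)) / ?\<pi> N) \<longlonglongrightarrow> 0"
    proof (rule Lim_null_comparison)
      show "\<forall>\<^sub>F N in sequentially. norm (?w * real (card (?S N)) / ?\<pi> N) \<le> \<bar>?w\<bar> * real (Suc d) / ?\<pi> N"
        using le by (intro always_eventually allI)
          (auto simp: abs_mult intro!: divide_right_mono mult_left_mono simp del: of_nat_Suc)
      show "(\<lambda>N. \<bar>?w\<bar> * real (Suc d) / ?\<pi> N) \<longlonglongrightarrow> 0"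
        by (rule tendsto_divide_0[OF tendsto_const filterlim_at_top_imp_at_infinity[OF prime_pi_at_top]])
    qed
    then show ?thesis using 3 by (simp add: index_weight_def)
  next
    case 4
    obtain b where b: "coprime b (t * lcm m d)" "\<And>p. prime p \<Longrightarrow> index_cond a d t m p \<longleftrightarrow> [p = b] (mod (t * lcm m d))"
      using index_cond_iff_cong[OF d 4] by blast
    have K: "t * lcm m d > 0" using 4 d by (simp add: lcm_pos_nat)
    have "?S N = primes_cong (t * lcm m d) b N" for N
      using b(2) by (auto simp: primes_cong_def)
    then have "(\<lambda>N. real (card (?S N)) / ?\<pi> N) \<longlonglongrightarrow> 1 / real (totient (t * lcm m d))"
      using primes_cong_density[OF K b(1)] by simp
    then have "(\<lambda>N. ?w * (real (card (?S N)) / ?\<pi> N)) \<longlonglongrightarrow> ?w * (1 / real (totient (t * lcm m d)))"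
      by (intro tendsto_mult tendsto_const)
    then show ?thesis using 4 by (simp add: index_weight_def)
  qed
qed

text \<open>Tannery's theorem over the pairs, enumerated by \<open>prod_decode\<close>. Its majorant
  comes from the index condition forcing p \<equiv> 1 modulo t m, to which the uniform bound
  applies.\<close>

lemma index_weight_limit:
  assumes d: "d > 0"
  shows "index_weight a d summable_on UNIV"
    "(\<lambda>N. N_ad a d (real N) / prime_pi (real N)) \<longlonglongrightarrow> infsum (index_weight a d) UNIV"
proof -
  let ?\<pi> = "\<lambda>N. prime_pi (real N)"
  define f where "f = (\<lambda>(t, m) N. real_of_int (mu m) / (real m * real t) * real (card {p. prime p \<and> p \<le> N \<and> index_cond a d t m p}) / ?\<pi> N)"
  define F where "F = (\<lambda>k. f (prod_decode k))"
  \<comment> \<open>The factor 1 / (m t) of the term and the saving (t m)^(-1/2) combine to the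
    summable exponent -3/2; \<open>0 powr\<close> is 0, matching the vanishing terms with t = 0 or m
    = 0.\<close>
  define h where "h = (\<lambda>n. real n powr (-3/2))"
  define M where "M = (\<lambda>k. 32 * (case prod_decode k of (t, m) \<Rightarrow> h t * h m))"
  have bij: "bij_betw prod_decode UNIV (UNIV :: (nat \<times> nat) set)" by (rule bij_prod_decode)
  have M: "summable M"
  proof -
    have "summable (\<lambda>n. norm (h n))" unfolding h_def by (simp add: summable_real_powr_iff)
    then have hs: "(\<lambda>n. norm (h n)) summable_on UNIV"
      using norm_summable_imp_summable_on[of "\<lambda>n. norm (h n)"] by simp
    have "(\<lambda>z. norm (case z of (t, m) \<Rightarrow> h t * h m)) summable_on UNIV \<times> UNIV"
      by (rule abs_summable_on_product[OF hs hs])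
    then have "(\<lambda>z. case z of (t, m) \<Rightarrow> h t * h m) summable_on UNIV"
      using abs_summable_summable by fastforce
    then have "(\<lambda>k. case prod_decode k of (t, m) \<Rightarrow> h t * h m) summable_on UNIV"
      using summable_on_reindex_bij_betw[OF bij, of "\<lambda>z. case z of (t, m) \<Rightarrow> h t * h m"] by simp
    then show ?thesis unfolding M_def by (intro summable_mult summable_on_imp_summable)
  qed
  obtain N1 where N1: "\<And>N k. N \<ge> N1 \<Longrightarrow> k \<ge> 1 \<Longrightarrow> real (card (primes_cong k 1 N)) \<le> 32 / sqrt (real k) * ?\<pi> N"
    using card_primes_cong_1_le by blast
  have bound: "norm (F k N) \<le> M k" if N: "N \<ge> max N1 2" for k N
  proof -
    obtain t m where tm: "prod_decode k = (t, m)" by force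
    let ?S = "{p. prime p \<and> p \<le> N \<and> index_cond a d t m p}"
    show ?thesis
    proof (cases "t = 0 \<or> m = 0")
      case True
      then show ?thesis by (auto simp: F_def f_def M_def tm h_def)
    next
      case False
      then have tm1: "t * m \<ge> 1" by (simp add: Suc_le_eq)
      have "2 \<in> primes_cong 1 1 N" using N by (simp add: primes_cong_def cong_def)
      then have "card (primes_cong 1 1 N) > 0" unfolding card_gt_0_iff using finite_primes_cong by blast
      then have \<pi>0: "?\<pi> N > 0" unfolding prime_pi_eq[of N 1] by (simp only: of_nat_0_less_iff)
      have "card ?S \<le> card (primes_cong (t * m) 1 N)"
        by (intro card_mono) (auto simp: primes_cong_def index_cond_imp_cong_1[simplified])
      then have "real (card ?S) \<le> real (card (primes_cong (t * m) 1 N))" by (rule of_nat_mono)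
      also have "\<dots> \<le> 32 / sqrt (real (t * m)) * ?\<pi> N" using N tm1 by (intro N1) auto
      finally have S: "real (card ?S) / ?\<pi> N \<le> 32 / sqrt (real (t * m))" using \<pi>0 by (simp add: field_simps)
      have "norm (F k N) = \<bar>real_of_int (mu m)\<bar> * (1 / (real m * real t)) * (real (card ?S) / ?\<pi> N)"
        by (simp add: F_def f_def tm abs_mult)
      also have "\<dots> \<le> 1 * (1 / (real m * real t)) * (32 / sqrt (real (t * m)))"
        using S abs_mu_le[of m] by (intro mult_mono) (auto simp flip: of_int_abs)
      also have "\<dots> = 32 * (h t * h m)"
      proof -
        have "h n = 1 / (real n * sqrt (real n))" if "n > 0" for n
        proof -
          have "(-3/2::real) = -1 + - (1/2)" by simp
          then have "real n powr (-3/2) = real n powr (-1) * real n powr (-(1/2))" by (simp only: powr_add)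
          moreover have "real n powr (-1) = 1 / real n" using that by (simp add: powr_minus_divide)
          moreover have "real n powr (-(1/2)) = 1 / sqrt (real n)"
            by (simp only: powr_minus_divide) (simp add: powr_half_sqrt)
          ultimately show ?thesis by (simp add: h_def)
        qed
        from this[of t] this[of m] False
        have h: "h t = 1 / (real t * sqrt (real t))" "h m = 1 / (real m * sqrt (real m))" by simp_all
        have "1 * (1 / (y * x)) * (32 / (sx * sy)) = 32 * (1 / (x * sx) * (1 / (y * sy)))" for x y sx sy :: real
          by (simp add: mult_ac)
        then show ?thesis unfolding h of_nat_mult real_sqrt_mult .
      qed
      finally show ?thesis by (simp add: M_def tm)
    qed
  qed
  have tan: "eventually (\<lambda>N. summable (\<lambda>k. norm (F k N))) sequentially \<and>
      summable (\<lambda>k. norm (index_weight a d (prod_decode k))) \<and>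
      (\<lambda>N. suminf (\<lambda>k. F k N)) \<longlonglongrightarrow> suminf (\<lambda>k. index_weight a d (prod_decode k))"
  proof (rule tannerys_theorem[OF _ _ M])
    show "(\<lambda>N. F k N) \<longlonglongrightarrow> index_weight a d (prod_decode k)" for k
    proof -
      obtain t m where tm: "prod_decode k = (t, m)" by force
      show ?thesis using index_cond_density[OF d, of m t a] by (simp add: F_def f_def tm)
    qed
    have "eventually (\<lambda>N. N \<ge> max N1 2) sequentially" by (rule eventually_ge_at_top)
    then have "eventually (\<lambda>(k::nat, N). N \<ge> max N1 2) (at_top \<times>\<^sub>F sequentially)"
      by (rule eventually_prod2[THEN iffD2, rotated]) simp
    then show "eventually (\<lambda>(k, N). norm (F k N) \<le> M k) (at_top \<times>\<^sub>F sequentially)"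
      by (rule eventually_mono) (use bound in auto)
  qed auto
  then have ns: "summable (\<lambda>k. norm (index_weight a d (prod_decode k)))" by blast
  have s: "(\<lambda>k. index_weight a d (prod_decode k)) summable_on UNIV"
    by (rule norm_summable_imp_summable_on[OF ns])
  then show "index_weight a d summable_on UNIV"
    using summable_on_reindex_bij_betw[OF bij, of "index_weight a d"] by simp
  have "suminf (\<lambda>k. index_weight a d (prod_decode k)) = infsum (\<lambda>k. index_weight a d (prod_decode k)) UNIV"
    using norm_summable_imp_has_sum[OF ns summable_sums[OF summable_norm_cancel[OF ns]]] by (rule infsumI[symmetric])
  also have "\<dots> = infsum (index_weight a d) UNIV"
    by (rule infsum_reindex_bij_betw[OF bij])
  finally have lim: "(\<lambda>N. suminf (\<lambda>k. F k N)) \<longlonglongrightarrow> infsum (index_weight a d) UNIV"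
    using tan by simp
  have "suminf (\<lambda>k. F k N) = N_ad a d (real N) / ?\<pi> N" for N
  proof -
    let ?I = "{1..N} \<times> {1..N}"
    \<comment> \<open>Since t m divides p - 1, both are below N; for fixed N the series is therefore
      the finite sum for \<open>N_ad\<close>.\<close>
    have zero: "f z N = 0" if "z \<notin> ?I" for z
    proof -
      obtain t m where z: "z = (t, m)" by force
      show ?thesis
      proof (cases "t = 0 \<or> m = 0")
        case False
        have "\<not>index_cond a d t m p" if p: "prime p" "p \<le> N" for p
        proof
          assume "index_cond a d t m p"
          then have "t * m dvd p - 1" by (simp add: index_cond_def)
          then have "t * m \<le> p - 1" using prime_gt_1_nat[OF p(1)] by (intro dvd_imp_le) auto
          moreover have "t \<le> t * m" "m \<le> t * m" using False by auto
          ultimately have "t \<le> N" "m \<le> N" using p(2) by linarith+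
          then show False using False \<open>z \<notin> ?I\<close> unfolding z by auto
        qed
        then have "{p. prime p \<and> p \<le> N \<and> index_cond a d t m p} = {}" by blast
        then show ?thesis by (simp add: f_def z)
      qed (auto simp: f_def z)
    qed
    have "suminf (\<lambda>k. F k N) = (\<Sum>k\<in>prod_encode ` ?I. F k N)"
    proof (rule suminf_finite)
      fix k assume "k \<notin> prod_encode ` ?I"
      then have "prod_decode k \<notin> ?I" by (metis image_eqI prod_decode_inverse)
      then show "F k N = 0" unfolding F_def by (rule zero)
    qed simp
    also have "\<dots> = (\<Sum>z\<in>?I. f z N)"
      by (subst sum.reindex) (auto simp: inj_prod_encode F_def)
    also have "\<dots> = (\<Sum>t\<in>{1..N}. \<Sum>m\<in>{1..N}. f (t, m) N)" by (simp add: sum.cartesian_product)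
    also have "\<dots> = N_ad a d (real N) / ?\<pi> N"
      unfolding N_ad_eq f_def by (simp add: sum_divide_distrib)
    finally show ?thesis .
  qed
  then show "(\<lambda>N. N_ad a d (real N) / ?\<pi> N) \<longlonglongrightarrow> infsum (index_weight a d) UNIV"
    using lim by simp
qed

section \<open>Evaluation of the series\<close>

text \<open>Every m with nonzero weight factors uniquely as x y with x = gcd m d dividing gcd(a, d)
  and y coprime to d. The totient depends on y alone, so the sum over x separates and equals the sum
  of mu x / x over the divisors of gcd(a, d).\<close>

lemma infsum_index_weight_inner:
  fixes a :: int and d t :: nat
  defines "g \<equiv> nat (gcd a (int d))" and "T \<equiv> {m::nat. m \<ge> 1 \<and> coprime m d}"
  assumes d: "d > 0" and t: "t > 0" "coprime (1 + int t * a) (int d)"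
  shows "(\<Sum>\<^sub>\<infinity>m. index_weight a d (t, m)) =
    real (totient g) / real g * (\<Sum>\<^sub>\<infinity>m\<in>T. real_of_int (mu m) / (real m * real t * real (totient (m * t * d))))"
proof -
  define F where "F = (\<lambda>m. index_weight a d (t, m))"
  define G where "G = (\<lambda>m. real_of_int (mu m) / (real m * real t * real (totient (m * t * d))))"
  define D where "D = {x. x dvd g}"
  define h :: "nat \<times> nat \<Rightarrow> nat" where "h = (\<lambda>(x, y). x * y)"
  have g: "g > 0" "int g = gcd a (int d)" using d by (auto simp: g_def)
  have finD: "finite D" unfolding D_def using g by simp
  have Dd: "x > 0" "x dvd d" "int x dvd a" if "x \<in> D" for x
  proof -
    have "int x dvd gcd a (int d)" using that unfolding D_def g(2)[symmetric] by simp
    then have "int x dvd int d" "int x dvd a" by (meson dvd_trans gcd_dvd1 gcd_dvd2)+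
    then show "x dvd d" "int x dvd a" by simp_all
    show "x > 0" using that g(1) unfolding D_def by (auto intro!: Nat.gr0I)
  qed
  have gcdh: "gcd (x * y) d = x" if "x \<in> D" "y \<in> T" for x y
  proof -
    have "coprime y d" using that(2) by (simp add: T_def)
    then have "gcd (x * y) d = gcd x d"
      by (metis coprime_commute gcd.commute gcd_mult_right_right_cancel)
    then show ?thesis using Dd(2)[OF that(1)] by (simp add: gcd_nat.absorb1)
  qed
  have Fh: "F (x * y) = real_of_int (mu x) / real x * G y" if x: "x \<in> D" and y: "y \<in> T" for x y
  proof -
    have y1: "y > 0" "coprime y d" using y by (auto simp: T_def)
    note x1 = Dd[OF x]
    have "x * y * d = gcd (x * y) d * lcm (x * y) d" by (rule prod_gcd_lcm_nat)
    \<comment> \<open>The lcm does not involve x; this is what makes the double sum a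
      product.\<close>
    then have l: "lcm (x * y) d = y * d" unfolding gcdh[OF x y] using x1(1) by (simp add: mult.assoc)
    have "coprime d y" using y1(2) by (simp only: coprime_commute)
    then have "coprime x y" by (rule coprime_divisors[OF x1(2) dvd_refl])
    then have m: "mu (x * y) = mu x * mu y" by (rule mu_mult_coprime)
    have e: "t * (y * d) = y * t * d" by simp
    then show ?thesis
      unfolding F_def G_def index_weight_def using x1 y1 t by (simp add: gcdh[OF x y] l m e)
  qed
  have inj: "inj_on h (D \<times> T)"
  proof (rule inj_onI)
    fix z z' assume z: "z \<in> D \<times> T" "z' \<in> D \<times> T" "h z = h z'"
    obtain x y x' y' where xy: "z = (x, y)" "z' = (x', y')" by (metis surj_pair)
    then have *: "x \<in> D" "y \<in> T" "x' \<in> D" "y' \<in> T" using z by auto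
    have eq: "x * y = x' * y'" using z(3) by (simp only: xy h_def prod.case)
    have "x = x'" using gcdh[OF *(1,2)] gcdh[OF *(3,4)] unfolding eq by (rule trans[OF sym])
    moreover from this have "y = y'" using eq Dd(1)[OF *(3)] by simp
    ultimately show "z = z'" by (simp only: xy)
  qed
  have zero: "F m = 0" if m: "m \<notin> h ` (D \<times> T)" for m
  proof (rule ccontr)
    assume "F m \<noteq> 0"
    then have m1: "m > 0" "int (gcd m d) dvd a" "mu m \<noteq> 0"
      unfolding F_def index_weight_def by (auto split: if_splits)
    then have sq: "squarefree m" by (auto simp: mu_def split: if_splits)
    define x y where "x = gcd m d" and "y = m div x"
    have xy: "m = x * y" by (simp add: x_def y_def)
    have "int x dvd gcd a (int d)" using m1(2) by (simp add: x_def)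
    then have "int x dvd int g" unfolding g(2) .
    then have "x \<in> D" by (simp add: D_def)
    \<comment> \<open>A prime dividing y and d divides m and d, hence x as well, so its square would
      divide the squarefree m.\<close>
    moreover have "coprime y d"
    proof (rule ccontr)
      assume "\<not>coprime y d"
      then have "gcd y d \<noteq> 1" unfolding coprime_iff_gcd_eq_1 .
      then obtain q where q: "prime q" "q dvd gcd y d" using prime_factor_nat by blast
      then have "q dvd y" "q dvd d" by (meson dvd_trans gcd_dvd1 gcd_dvd2)+
      moreover from this have "q dvd m" unfolding xy by simp
      ultimately have "q dvd x" unfolding x_def by (intro gcd_greatest)
      then have "q * q dvd m" unfolding xy using \<open>q dvd y\<close> by (rule mult_dvd_mono)
      then have "q ^ 2 dvd m" by (simp only: power2_eq_square)
      then have "q dvd 1" using sq unfolding squarefree_def by blast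
      then show False using q(1) not_prime_unit by blast
    qed
    moreover have "y \<ge> 1" using m1(1) xy by (cases y) auto
    ultimately have "m \<in> h ` (D \<times> T)" using xy by (force simp: h_def T_def)
    then show False using m by blast
  qed
  have Fs: "F summable_on UNIV"
  proof -
    have "index_weight a d summable_on range (Pair t)"
      using index_weight_limit(1)[OF d] by (rule summable_on_subset_banach) simp
    then have "index_weight a d \<circ> Pair t summable_on UNIV"
      by (subst (asm) summable_on_reindex) (auto simp: inj_on_def)
    then show ?thesis by (simp add: F_def o_def)
  qed
  have "F summable_on h ` (D \<times> T)" using Fs by (rule summable_on_subset_banach) simp
  then have "F \<circ> h summable_on D \<times> T" by (subst (asm) summable_on_reindex[OF inj])
  moreover have Fh': "(F \<circ> h) z = (case z of (x, y) \<Rightarrow> real_of_int (mu x) / real x * G y)" if "z \<in> D \<times> T" for z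
    using that Fh by (auto simp: h_def)
  ultimately have sm: "(\<lambda>(x, y). real_of_int (mu x) / real x * G y) summable_on D \<times> T"
    using summable_on_cong[of "D \<times> T" "F \<circ> h"] by blast
  have "infsum F UNIV = infsum F (h ` (D \<times> T))"
    by (rule infsum_cong_neutral) (use zero in auto)
  also have "\<dots> = infsum (F \<circ> h) (D \<times> T)" by (rule infsum_reindex[OF inj])
  also have "\<dots> = infsum (\<lambda>(x, y). real_of_int (mu x) / real x * G y) (D \<times> T)"
    by (rule infsum_cong) (rule Fh')
  also have "\<dots> = (\<Sum>\<^sub>\<infinity>x\<in>D. \<Sum>\<^sub>\<infinity>y\<in>T. real_of_int (mu x) / real x * G y)"
    by (rule infsum_Sigma'_banach[OF sm, symmetric])
  also have "\<dots> = (\<Sum>x\<in>D. real_of_int (mu x) / real x) * infsum G T"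
    by (simp only: infsum_cmult_right' infsum_finite[OF finD] sum_distrib_right)
  also have "(\<Sum>x\<in>D. real_of_int (mu x) / real x) = real (totient g) / real g"
    unfolding D_def by (rule sum_mu_over_divisors_eq_totient[OF g(1)])
  finally show ?thesis unfolding F_def G_def .
qed

theorem theorem1:
  fixes a :: int and d :: nat
  assumes "d \<ge> 1"
  shows "((\<lambda>x. N_ad a d x / prime_pi x) \<longlongrightarrow>
           real (totient (nat (gcd a (int d)))) / real (nat (gcd a (int d))) *
           (\<Sum>\<^sub>\<infinity> r \<in> {r::nat. r \<ge> 1 \<and> coprime (1 + int r * a) (int d)}.
              \<Sum>\<^sub>\<infinity> m \<in> {m::nat. m \<ge> 1 \<and> coprime m d}.
                 real_of_int (mu m) / (real m * real r * real (totient (m * r * d)))))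
         at_top"
proof -
  have d: "d > 0" using assms by simp
  define R where "R = {r::nat. r \<ge> 1 \<and> coprime (1 + int r * a) (int d)}"
  define c where "c = real (totient (nat (gcd a (int d)))) / real (nat (gcd a (int d)))"
  define I where "I = (\<lambda>r. \<Sum>\<^sub>\<infinity> m \<in> {m::nat. m \<ge> 1 \<and> coprime m d}.
                 real_of_int (mu m) / (real m * real r * real (totient (m * r * d))))"
  have "(\<lambda>(t, m). index_weight a d (t, m)) summable_on UNIV \<times> UNIV"
    using index_weight_limit(1)[OF d] by simp
  from infsum_Sigma'_banach[OF this]
  have "infsum (index_weight a d) UNIV = (\<Sum>\<^sub>\<infinity>t. \<Sum>\<^sub>\<infinity>m. index_weight a d (t, m))" by simp
  also have "\<dots> = (\<Sum>\<^sub>\<infinity>r\<in>R. c * I r)"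
  proof (rule infsum_cong_neutral)
    fix t assume t: "t \<in> UNIV - R"
    have "index_weight a d (t, m) = 0" for m
      using t by (auto simp: index_weight_def R_def)
    then show "(\<Sum>\<^sub>\<infinity>m. index_weight a d (t, m)) = 0" by simp
  next
    fix t assume "t \<in> UNIV \<inter> R"
    then show "(\<Sum>\<^sub>\<infinity>m. index_weight a d (t, m)) = c * I t"
      unfolding c_def I_def by (intro infsum_index_weight_inner d) (auto simp: R_def)
  qed auto
  also have "\<dots> = c * (\<Sum>\<^sub>\<infinity>r\<in>R. I r)" by (rule infsum_cmult_right')
  finally have total: "infsum (index_weight a d) UNIV = c * (\<Sum>\<^sub>\<infinity>r\<in>R. I r)" .
  \<comment> \<open>Numerator and denominator are constant between consecutive integers, so the
    limit along integers is the limit along reals.\<close>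
  have "filterlim (\<lambda>x::real. nat \<lfloor>x\<rfloor>) sequentially at_top"
    by (rule filterlim_compose[OF filterlim_nat_sequentially filterlim_floor_sequentially])
  from filterlim_compose[OF index_weight_limit(2)[OF d, of a] this]
  have lim: "((\<lambda>x::real. N_ad a d (real (nat \<lfloor>x\<rfloor>)) / prime_pi (real (nat \<lfloor>x\<rfloor>))) \<longlongrightarrow> c * (\<Sum>\<^sub>\<infinity>r\<in>R. I r)) at_top"
    unfolding total .
  have "eventually (\<lambda>x. N_ad a d (real (nat \<lfloor>x\<rfloor>)) / prime_pi (real (nat \<lfloor>x\<rfloor>)) = N_ad a d x / prime_pi x) at_top"
    using eventually_ge_at_top[of "0::real"]
  proof eventually_elim
    case (elim x)
    have "p \<le> nat \<lfloor>x\<rfloor> \<longleftrightarrow> real p \<le> x" for p using elim by (simp add: le_nat_iff le_floor_iff)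
    then show ?case by (simp add: N_ad_def prime_pi_def)
  qed
  from Lim_transform_eventually[OF lim this] show ?thesis
    unfolding c_def R_def I_def .
qed

end
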